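(* Let $\kappa\ge0$ and let $b:[0,\infty)\times[0,\infty)\to\mathbb{R}$ be a Borel measurable function with $|b(t,x)|\le\kappa$ for $t>0$ and $x\ge0$. Let $q_b(s,x;t,y)$ be the transition probability density of the diffusion $X$ in $[0,\infty)$ with drift $b$ reflected at $0$. For $\beta\in\mathbb{R}$ and $y\in\mathbb{R}$ let $p_y^\beta(x,t,z)$ be the transition probability density function of the diffusion process in $\mathbb{R}$ $$dZ_t=-\beta\,\mathrm{sgn}(Z_t-y)\,dt+dB_t,$$ so that $$p_y^\beta(x,t,y)=\frac{1}{\sqrt{2\pi t}}\int_{|x-y|/\sqrt t}^\infty z\,e^{-(z-\beta\sqrt t)^2/2}\,dz .$$ Then $$p_y^{-\kappa}(x,t-s,y)+p_{-y}^{-\kappa}(x,t-s,-y)\le q_b(s,x;t,y)\le p_y^{\kappa}(x,t-s,y)+p_{-y}^{\kappa}(x,t-s,-y)$$ for all $0\le s<t$ and all $x,y\ge0$. In the case $y=0$ these bounds are optimal, i.e. each of the two bounds is attained by the density $q_b(s,x;t,0)$ of some drift $b$ with $|b|\le\kappa$.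
   Context: The reflecting diffusion in $[0,\infty)$ with bounded Borel measurable drift $b$ is the weak solution of $dX_t=b(t,X_t)\,dt+dB_t+dL_t$, $X_s=x\ge0$, with $X\ge0$, $B$ a one-dimensional Brownian motion, and $L$ continuous, increasing, initially zero, increasing only on $\{t:X_t=0\}$. Its transition density $q_b(s,x;t,y)$ ($0\le s<t$, $x,y\ge0$) is the continuous function with $\mathbb{E}[f(X_t)\mid X_s=x]=\int_{[0,\infty)}q_b(s,x;t,y)f(y)\,dy$ for bounded Borel $f$. $p_y^\beta(x,t,z)$ is the continuous density at $z$ of $Z_t$ given $Z_0=x$. *)

theory Defs
  imports "HOL-Probability.Probability"
begin

text \<open>
  All processes start at a deterministic time \<open>s \<ge> 0\<close>; only their values at times \<open>\<ge> s\<close> matter.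
  Brownian motion starts from \<open>0\<close> at time \<open>s\<close>, so \<open>B t\<close> is the increment over \<open>[s, t]\<close>.
\<close>

definition adapted_on :: "real \<Rightarrow> (real \<Rightarrow> 'a measure) \<Rightarrow> (real \<Rightarrow> 'a \<Rightarrow> real) \<Rightarrow> bool" where
  "adapted_on s F Y \<longleftrightarrow> (\<forall>t\<ge>s. Y t \<in> borel_measurable (F t))"

definition filtered_prob_space :: "'a measure \<Rightarrow> (real \<Rightarrow> 'a measure) \<Rightarrow> bool" where
  "filtered_prob_space M F \<longleftrightarrow>
     prob_space M \<and> filtration (space M) F \<and> (\<forall>t. subalgebra M (F t))"

definition brownian_motion_from ::
  "real \<Rightarrow> 'a measure \<Rightarrow> (real \<Rightarrow> 'a measure) \<Rightarrow> (real \<Rightarrow> 'a \<Rightarrow> real) \<Rightarrow> bool" where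
  "brownian_motion_from s M F B \<longleftrightarrow>
     filtered_prob_space M F \<and> adapted_on s F B \<and>
     (AE \<omega> in M. B s \<omega> = 0 \<and> continuous_on {s..} (\<lambda>t. B t \<omega>)) \<and>
     (\<forall>u t. s \<le> u \<and> u < t \<longrightarrow>
        distributed M lborel (\<lambda>\<omega>. B t \<omega> - B u \<omega>) (normal_density 0 (sqrt (t - u))) \<and>
        prob_space.indep_set M (sets (F u))
          {(\<lambda>\<omega>. B t \<omega> - B u \<omega>) -` A \<inter> space M |A. A \<in> sets borel})"

definition weak_solution ::
  "(real \<Rightarrow> real \<Rightarrow> real) \<Rightarrow> real \<Rightarrow> real \<Rightarrow> 'a measure \<Rightarrow> (real \<Rightarrow> 'a measure) \<Rightarrow>
   (real \<Rightarrow> 'a \<Rightarrow> real) \<Rightarrow> (real \<Rightarrow> 'a \<Rightarrow> real) \<Rightarrow> bool" where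
  "weak_solution c s x M F B Z \<longleftrightarrow>
     brownian_motion_from s M F B \<and> adapted_on s F Z \<and>
     (AE \<omega> in M. continuous_on {s..} (\<lambda>t. Z t \<omega>) \<and>
       (\<forall>t\<ge>s. set_integrable lborel {s..t} (\<lambda>r. c r (Z r \<omega>)) \<and>
              Z t \<omega> = x + (LBINT r:{s..t}. c r (Z r \<omega>)) + B t \<omega>))"

text \<open>
  The last conjunct expresses that \<open>L\<close> increases only on \<open>{t. X t = 0}\<close>: it is constant on
  every interval on which \<open>X\<close> does not vanish.
\<close>

definition reflecting_weak_solution ::
  "(real \<Rightarrow> real \<Rightarrow> real) \<Rightarrow> real \<Rightarrow> real \<Rightarrow> 'a measure \<Rightarrow> (real \<Rightarrow> 'a measure) \<Rightarrow>
   (real \<Rightarrow> 'a \<Rightarrow> real) \<Rightarrow> (real \<Rightarrow> 'a \<Rightarrow> real) \<Rightarrow> (real \<Rightarrow> 'a \<Rightarrow> real) \<Rightarrow> bool" where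
  "reflecting_weak_solution b s x M F B L X \<longleftrightarrow>
     brownian_motion_from s M F B \<and> adapted_on s F X \<and> adapted_on s F L \<and>
     (AE \<omega> in M.
       continuous_on {s..} (\<lambda>t. X t \<omega>) \<and> (\<forall>t\<ge>s. 0 \<le> X t \<omega>) \<and>
       (\<forall>t\<ge>s. set_integrable lborel {s..t} (\<lambda>r. b r (X r \<omega>)) \<and>
              X t \<omega> = x + (LBINT r:{s..t}. b r (X r \<omega>)) + B t \<omega> + L t \<omega>) \<and>
       continuous_on {s..} (\<lambda>t. L t \<omega>) \<and> mono_on {s..} (\<lambda>t. L t \<omega>) \<and> L s \<omega> = 0 \<and>
       (\<forall>u v. s \<le> u \<and> u \<le> v \<and> (\<forall>r\<in>{u..v}. X r \<omega> \<noteq> 0) \<longrightarrow> L u \<omega> = L v \<omega>))"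

text \<open>
  A solution from every starting point is required to exist on some filtered probability space
  over \<open>'a\<close>, and every such solution must have the given density; the type argument only names
  the type of sample points.  The identity for \<open>f = 1\<close> forces integrability of the density.
\<close>

definition reflecting_transition_density ::
  "'a itself \<Rightarrow> (real \<Rightarrow> real \<Rightarrow> real) \<Rightarrow> (real \<Rightarrow> real \<Rightarrow> real \<Rightarrow> real \<Rightarrow> real) \<Rightarrow> bool" where
  "reflecting_transition_density TYPE('a) b q \<longleftrightarrow>
     continuous_on {(s, x, t, y). 0 \<le> s \<and> s < t \<and> 0 \<le> x \<and> 0 \<le> y} (\<lambda>(s, x, t, y). q s x t y) \<and>
     (\<forall>s\<ge>0. \<forall>x\<ge>0.
        (\<exists>(M :: 'a measure) F B L X. reflecting_weak_solution b s x M F B L X) \<and>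
        (\<forall>(M :: 'a measure) F B L X. reflecting_weak_solution b s x M F B L X \<longrightarrow>
           (\<forall>t>s. \<forall>f \<in> borel_measurable borel. bounded (range f) \<longrightarrow>
              (LINT \<omega>|M. f (X t \<omega>)) = (LBINT y:{0..}. q s x t y * f y))))"

definition sgn_transition_density ::
  "'a itself \<Rightarrow> real \<Rightarrow> real \<Rightarrow> (real \<Rightarrow> real \<Rightarrow> real \<Rightarrow> real) \<Rightarrow> bool" where
  "sgn_transition_density TYPE('a) \<beta> y p \<longleftrightarrow>
     (\<forall>x. \<forall>t>0. continuous_on UNIV (p x t)) \<and>
     (\<forall>x.
        (\<exists>(M :: 'a measure) F B Z. weak_solution (\<lambda>r z. - \<beta> * sgn (z - y)) 0 x M F B Z) \<and>
        (\<forall>(M :: 'a measure) F B Z. weak_solution (\<lambda>r z. - \<beta> * sgn (z - y)) 0 x M F B Z \<longrightarrow>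
           (\<forall>t>0. \<forall>f \<in> borel_measurable borel. bounded (range f) \<longrightarrow>
              (LINT \<omega>|M. f (Z t \<omega>)) = (LBINT z. p x t z * f z))))"

definition bounded_drift :: "real \<Rightarrow> (real \<Rightarrow> real \<Rightarrow> real) \<Rightarrow> bool" where
  "bounded_drift \<kappa> b \<longleftrightarrow>
     (\<lambda>(t, x). b t x) \<in> borel_measurable (restrict_space borel ({0..} \<times> {0..})) \<and>
     (\<forall>t>0. \<forall>x\<ge>0. \<bar>b t x\<bar> \<le> \<kappa>)"

end

theory Submission
  imports Defs "HOL-Real_Asymp.Real_Asymp"
begin

text \<open>
  Write \<open>g \<tau> w\<close> for the claimed closed form of \<open>p\<^sub>y\<^sup>\<beta>(x, \<tau>, y)\<close> with \<open>w = x - y\<close>.  It is even in \<open>w\<close>,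
  decreasing in \<open>\<bar>w\<bar>\<close>, twice continuously differentiable even at \<open>w = 0\<close>, solves the backward
  equation of the drift \<open>- \<beta> sgn w\<close>, and is an approximate identity as \<open>\<tau>\<close> tends to \<open>0\<close>.  Hence
  \<open>E[g \<epsilon> (Z\<^sub>t - y)] = g (t + \<epsilon>) (x - y)\<close> for the diffusion \<open>Z\<close>, and \<open>\<epsilon> \<longrightarrow> 0\<close> identifies the density at \<open>y\<close>.

  Since \<open>g\<close> decreases in \<open>\<bar>w\<bar>\<close>, the drift \<open>- \<kappa> sgn w\<close> is the extremal one among all drifts bounded by
  \<open>\<kappa>\<close>.  The function \<open>u(r, z) = g (t + \<epsilon> - r) (z - y) + g (t + \<epsilon> - r) (z + y)\<close> has vanishing
  derivative at \<open>z = 0\<close>, so along the reflecting diffusion it is a supermartingale for \<open>\<beta> = \<kappa>\<close> and a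
  submartingale for \<open>\<beta> = - \<kappa>\<close>; again \<open>\<epsilon> \<longrightarrow> 0\<close> gives the two bounds.  For \<open>y = 0\<close> they are attained
  by the constant drifts \<open>\<mp> \<kappa>\<close>, for which a solution is explicit (Skorokhod's reflection map) and
  the transition function is known in closed form.

  A Taylor expansion along equidistant partitions takes the place of Ito's formula.
\<close>

section \<open>Brownian increments\<close>

text \<open>The drift is merely measurable and the local time is singular in time, so increments of
  \<open>X - B\<close> cannot be linearised. They are measured by a path-dependent clock, and errors
  are summed against it. The remainder so obtained is small along almost every path but without a
  rate; an L^2 bound carries it over to expectations. Everything is proved as a one-sided
  inequality, and equalities come from applying it to a function and to its negative.

  The kernel is a function of |w|, but its first derivative is \<open>w\<close> times a function of
  |w|, and this factor removes the kink at the centre. If the drift in the backward equation is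
  replaced by a value \<open>c\<close>, what remains of the generator is a nonpositive Gaussian
  factor times \<beta> |w| + c w. For |c| \<le> \<kappa> and \<beta> = \<kappa> or \<beta> = -
  \<kappa> the sign of this expression is known, whatever \<open>c\<close> is.

  The Brownian motion behind the extremal examples is taken from the solutions assumed for
  \<open>p\<close>.\<close>

lemma brownian_motion_fromD:
  assumes "brownian_motion_from s M F B"
  shows "prob_space M" "\<And>t. space (F t) = space M" "\<And>t. sets (F t) \<subseteq> sets M"
    "\<And>u t. u \<le> t \<Longrightarrow> sets (F u) \<subseteq> sets (F t)"
    "\<And>t. s \<le> t \<Longrightarrow> B t \<in> borel_measurable (F t)"
    "AE \<omega> in M. B s \<omega> = 0 \<and> continuous_on {s..} (\<lambda>t. B t \<omega>)"
    "\<And>u t. s \<le> u \<Longrightarrow> u < t \<Longrightarrow>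
      distributed M lborel (\<lambda>\<omega>. B t \<omega> - B u \<omega>) (normal_density 0 (sqrt (t - u)))"
    "\<And>u t. s \<le> u \<Longrightarrow> u < t \<Longrightarrow> prob_space.indep_set M (sets (F u))
      {(\<lambda>\<omega>. B t \<omega> - B u \<omega>) -` A \<inter> space M |A. A \<in> sets borel}"
proof -
  have 1: "prob_space M" "filtration (space M) F" "\<forall>t. subalgebra M (F t)" "\<forall>t\<ge>s. B t \<in> borel_measurable (F t)"
    and 2: "AE \<omega> in M. B s \<omega> = 0 \<and> continuous_on {s..} (\<lambda>t. B t \<omega>)"
    and 3: "\<forall>u t. s \<le> u \<and> u < t \<longrightarrow>
        distributed M lborel (\<lambda>\<omega>. B t \<omega> - B u \<omega>) (normal_density 0 (sqrt (t - u))) \<and>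
        prob_space.indep_set M (sets (F u))
          {(\<lambda>\<omega>. B t \<omega> - B u \<omega>) -` A \<inter> space M |A. A \<in> sets borel}"
    using assms
    unfolding brownian_motion_from_def filtered_prob_space_def adapted_on_def by (iprover | fast)+
  show "prob_space M" "AE \<omega> in M. B s \<omega> = 0 \<and> continuous_on {s..} (\<lambda>t. B t \<omega>)" by fact+
  show "space (F t) = space M" "sets (F t) \<subseteq> sets M" for t
    using 1(3) by (simp_all add: subalgebra_def)
  show "sets (F u) \<subseteq> sets (F t)" if "u \<le> t" for u t
    using 1(2) that by (simp add: filtration_def)
  show "B t \<in> borel_measurable (F t)" if "s \<le> t" for t
    using 1(4) that by simp
  show "distributed M lborel (\<lambda>\<omega>. B t \<omega> - B u \<omega>) (normal_density 0 (sqrt (t - u)))"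
    "prob_space.indep_set M (sets (F u)) {(\<lambda>\<omega>. B t \<omega> - B u \<omega>) -` A \<inter> space M |A. A \<in> sets borel}"
    if "s \<le> u" "u < t" for u t
    using 3[rule_format, of u t] that by simp_all
qed

lemma filtered_measurable_mono:
  assumes "brownian_motion_from s M F B" "f \<in> borel_measurable (F u)" "u \<le> t"
  shows "f \<in> borel_measurable (F t)"
  by (rule measurable_mono[THEN subsetD, OF order_refl refl _ _ assms(2)])
     (simp_all add: brownian_motion_fromD[OF assms(1)] assms(3))

lemma filtered_measurable_ambient:
  assumes "brownian_motion_from s M F B" "f \<in> borel_measurable (F u)"
  shows "f \<in> borel_measurable M"
  by (rule measurable_mono[THEN subsetD, OF order_refl refl _ _ assms(2)])
     (simp_all add: brownian_motion_fromD[OF assms(1)])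

lemma Int_stable_vimage: "Int_stable {X -` A \<inter> \<Omega> |A. A \<in> sets S}"
proof (rule Int_stableI)
  fix a b assume "a \<in> {X -` A \<inter> \<Omega> |A. A \<in> sets S}" "b \<in> {X -` A \<inter> \<Omega> |A. A \<in> sets S}"
  then obtain A A' where "A \<in> sets S" "A' \<in> sets S" "a = X -` A \<inter> \<Omega>" "b = X -` A' \<inter> \<Omega>"
    by auto
  then have "A \<inter> A' \<in> sets S" "a \<inter> b = X -` (A \<inter> A') \<inter> \<Omega>" by auto
  then show "a \<inter> b \<in> {X -` A \<inter> \<Omega> |A. A \<in> sets S}" by blast
qed

text \<open>The hypothesis speaks of independent families of events. Preimages under
  \<open>f\<close> lie in \<open>F u\<close>, and families of preimages are stable under
  intersection, so independence extends to the generated sigma-algebras, hence to \<open>f\<close>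
  and any measurable function of the increment.\<close>

lemma brownian_increment_indep_var:
  fixes f :: "'a \<Rightarrow> real" and g :: "real \<Rightarrow> real"
  assumes bm: "brownian_motion_from s M F B" and "s \<le> u" "u < t"
    and f: "f \<in> borel_measurable (F u)" and g: "g \<in> borel_measurable borel"
  shows "prob_space.indep_var M borel f borel (\<lambda>\<omega>. g (B t \<omega> - B u \<omega>))"
proof -
  note bmD = brownian_motion_fromD[OF bm]
  interpret prob_space M by (rule bmD)
  let ?D = "\<lambda>\<omega>. B t \<omega> - B u \<omega>"
  have D[measurable]: "?D \<in> borel_measurable M"
    using distributed_measurable[OF bmD(7)[OF assms(2,3)]] by simp
  have fM[measurable]: "f \<in> borel_measurable M"
    by (rule filtered_measurable_ambient[OF bm f])
  have "indep_set {f -` A \<inter> space M |A. A \<in> sets borel}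
      {?D -` A \<inter> space M |A. A \<in> sets borel}"
    unfolding indep_set_def
  proof (rule indep_sets_mono_sets[OF bmD(8)[OF assms(2,3), unfolded indep_set_def]])
    show "case_bool {f -` A \<inter> space M |A. A \<in> sets borel}
        {?D -` A \<inter> space M |A. A \<in> sets borel} i
      \<subseteq> case_bool (sets (F u)) {?D -` A \<inter> space M |A. A \<in> sets borel} i" for i
      using measurable_sets[OF f] bmD(2)[of u] by (auto split: bool.split)
  qed
  then have "indep_var borel f borel ?D"
    unfolding indep_var_eq
    by (intro conjI indep_set_sigma_sets Int_stable_vimage) simp_all
  from indep_var_compose[OF this measurable_id g] show ?thesis
    by (simp add: comp_def)
qed

text \<open>Only the normal moments of order 1, 2 and 4 enter. The last value is the variance of the
  squared increment: 3h^2 - 2h^2 + h^2 with h = t - u.\<close>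

lemma brownian_increment_moments:
  assumes bm: "brownian_motion_from s M F B" and "s \<le> u" "u < t"
  defines "D \<equiv> (\<lambda>\<omega>. B t \<omega> - B u \<omega>)"
  shows "integrable M D" "integral\<^sup>L M D = 0"
    "integrable M (\<lambda>\<omega>. (D \<omega>)\<^sup>2)" "(\<integral>\<omega>. (D \<omega>)\<^sup>2 \<partial>M) = t - u"
    "integrable M (\<lambda>\<omega>. ((D \<omega>)\<^sup>2 - (t - u))\<^sup>2)"
    "(\<integral>\<omega>. ((D \<omega>)\<^sup>2 - (t - u))\<^sup>2 \<partial>M) = 2 * (t - u)\<^sup>2"
proof -
  interpret prob_space M by (rule brownian_motion_fromD[OF bm])
  have d: "distributed M lborel D (normal_density 0 (sqrt (t - u)))"
    unfolding D_def by (rule brownian_motion_fromD(7)[OF bm assms(2,3)])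
  have pos: "0 < sqrt (t - u)" using assms by simp
  have int: "integrable M (\<lambda>\<omega>. (D \<omega>) ^ k)" for k
    by (subst distributed_integrable[OF d, symmetric])
       (use integrable_normal_moment[OF pos, of 0 k] in auto)
  have ev: "(\<integral>\<omega>. (D \<omega>) ^ k \<partial>M) = (\<integral>x. normal_density 0 (sqrt (t - u)) x * x ^ k \<partial>lborel)" for k
    by (subst distributed_integral[OF d, symmetric]) auto
  show "integrable M D" using int[of 1] by simp
  show "integral\<^sup>L M D = 0"
    using ev[of 1] integral_normal_moment_odd[OF pos, of 0 0] by simp
  show i2: "integrable M (\<lambda>\<omega>. (D \<omega>)\<^sup>2)" by (rule int)
  show e2: "(\<integral>\<omega>. (D \<omega>)\<^sup>2 \<partial>M) = t - u"
    using ev[of 2] integral_normal_moment_even[OF pos, of 0 1] assms by simp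
  have e4: "(\<integral>\<omega>. (D \<omega>)^4 \<partial>M) = 3 * (t - u)\<^sup>2"
    using ev[of 4] integral_normal_moment_even[OF pos, of 0 2] assms
    by (simp add: fact_numeral power2_eq_square)
  have eq: "(\<lambda>\<omega>. ((D \<omega>)\<^sup>2 - (t - u))\<^sup>2) = (\<lambda>\<omega>. (D \<omega>)^4 - 2 * (t - u) * (D \<omega>)\<^sup>2 + (t - u)\<^sup>2)"
    by (simp add: fun_eq_iff power2_diff power_mult[symmetric])
  show "integrable M (\<lambda>\<omega>. ((D \<omega>)\<^sup>2 - (t - u))\<^sup>2)"
    unfolding eq using int[of 4] i2 by simp
  show "(\<integral>\<omega>. ((D \<omega>)\<^sup>2 - (t - u))\<^sup>2 \<partial>M) = 2 * (t - u)\<^sup>2"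
    unfolding eq using int[of 4] i2 e2 e4 by (simp add: prob_space power2_eq_square)
qed

section \<open>Discrete martingales built from Brownian increments\<close>

definition quadratic_martingale ::
  "real \<Rightarrow> real \<Rightarrow> (real \<Rightarrow> 'a \<Rightarrow> real) \<Rightarrow> (nat \<Rightarrow> 'a \<Rightarrow> real) \<Rightarrow> (nat \<Rightarrow> 'a \<Rightarrow> real) \<Rightarrow> nat \<Rightarrow> 'a \<Rightarrow> real"
  where "quadratic_martingale s h B \<alpha> \<gamma> k \<omega> =
    (\<Sum>i<k. \<alpha> i \<omega> * (B (s + real (Suc i) * h) \<omega> - B (s + real i * h) \<omega>)
         + \<gamma> i \<omega> * ((B (s + real (Suc i) * h) \<omega> - B (s + real i * h) \<omega>)\<^sup>2 - h))"

text \<open>Each new summand is centred given the past, so its product with \<open>N k\<close> has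
  mean zero and the second moments add. For k = n and h = (t - s)/n the bound stays bounded in n,
  which is what the limit of fine partitions needs. Measurability is carried through the induction
  because independence of the next increment refers to \<open>F\<close>.\<close>

lemma quadratic_martingale_moments:
  assumes bm: "brownian_motion_from s M F B" and h: "0 < h"
    and \<alpha>: "\<And>i. \<alpha> i \<in> borel_measurable (F (s + real i * h))"
    and \<gamma>: "\<And>i. \<gamma> i \<in> borel_measurable (F (s + real i * h))"
    and \<alpha>U: "\<And>i \<omega>. \<bar>\<alpha> i \<omega>\<bar> \<le> U" and \<gamma>U: "\<And>i \<omega>. \<bar>\<gamma> i \<omega>\<bar> \<le> U"
  defines "N \<equiv> quadratic_martingale s h B \<alpha> \<gamma>"
  shows "N k \<in> borel_measurable (F (s + real k * h)) \<and>
    integrable M (N k) \<and> integral\<^sup>L M (N k) = 0 \<and>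
    integrable M (\<lambda>\<omega>. (N k \<omega>)\<^sup>2) \<and> (\<integral>\<omega>. (N k \<omega>)\<^sup>2 \<partial>M) \<le> k * (2 * U\<^sup>2 * (h + 2 * h\<^sup>2))"
proof (induction k)
  case 0
  show ?case by (simp add: N_def quadratic_martingale_def)
next
  case (Suc k)
  note bmD = brownian_motion_fromD[OF bm]
  interpret prob_space M by (rule bmD)
  define u where "u = s + real k * h"
  define v where "v = s + real (Suc k) * h"
  define D where "D = (\<lambda>\<omega>. B v \<omega> - B u \<omega>)"
  have uv: "s \<le> u" "u < v" and vu: "v - u = h"
    using h by (auto simp: u_def v_def algebra_simps)
  have mom: "integrable M D" "integral\<^sup>L M D = 0"
    "integrable M (\<lambda>\<omega>. (D \<omega>)\<^sup>2)" "(\<integral>\<omega>. (D \<omega>)\<^sup>2 \<partial>M) = h"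
    "integrable M (\<lambda>\<omega>. ((D \<omega>)\<^sup>2 - h)\<^sup>2)" "(\<integral>\<omega>. ((D \<omega>)\<^sup>2 - h)\<^sup>2 \<partial>M) = 2 * h\<^sup>2"
    unfolding D_def by (fact brownian_increment_moments[OF bm uv, unfolded vu])+
  have step: "N (Suc k) = (\<lambda>\<omega>. N k \<omega> + (\<alpha> k \<omega> * D \<omega> + \<gamma> k \<omega> * ((D \<omega>)\<^sup>2 - h)))"
    by (simp add: N_def quadratic_martingale_def D_def u_def v_def fun_eq_iff)
  have Nm: "N k \<in> borel_measurable (F u)" and \<alpha>m: "\<alpha> k \<in> borel_measurable (F u)"
    and \<gamma>m: "\<gamma> k \<in> borel_measurable (F u)"
    unfolding u_def using Suc \<alpha> \<gamma> by blast+
  have Bm: "B u \<in> borel_measurable (F u)" "B v \<in> borel_measurable (F v)"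
    using uv by (simp_all add: bmD(5))
  have Dm: "D \<in> borel_measurable (F v)"
    unfolding D_def
    by (rule borel_measurable_diff[OF Bm(2) filtered_measurable_mono[OF bm Bm(1) less_imp_le[OF uv(2)]]])
  have m1: "N (Suc k) \<in> borel_measurable (F v)"
    unfolding step
    by (intro borel_measurable_add borel_measurable_times borel_measurable_diff borel_measurable_power
        borel_measurable_const Dm filtered_measurable_mono[OF bm Nm less_imp_le[OF uv(2)]]
        filtered_measurable_mono[OF bm \<alpha>m less_imp_le[OF uv(2)]]
        filtered_measurable_mono[OF bm \<gamma>m less_imp_le[OF uv(2)]])
  note amb = filtered_measurable_ambient[OF bm]
  have [measurable]: "N k \<in> borel_measurable M" "\<alpha> k \<in> borel_measurable M"
    "\<gamma> k \<in> borel_measurable M" "D \<in> borel_measurable M"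
    by (fact amb[OF Nm] amb[OF \<alpha>m] amb[OF \<gamma>m] amb[OF Dm])+
  have iN: "integrable M (N k)" using Suc by blast
  \<comment> \<open>A factor known at time \<open>u\<close> times a centred function of the next
    increment is integrable by independence alone, although \<open>N k\<close> is unbounded, and has
    mean zero.\<close>
  have ind: "integrable M (\<lambda>\<omega>. f \<omega> * g (D \<omega>)) \<and> (\<integral>\<omega>. f \<omega> * g (D \<omega>) \<partial>M) = 0"
    if "f \<in> borel_measurable (F u)" "integrable M f" "g \<in> borel_measurable borel"
      "integrable M (\<lambda>\<omega>. g (D \<omega>))" "(\<integral>\<omega>. g (D \<omega>) \<partial>M) = 0" for f and g :: "real \<Rightarrow> real"
  proof -
    have iv: "indep_var borel f borel (\<lambda>\<omega>. g (D \<omega>))"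
      unfolding D_def by (rule brownian_increment_indep_var[OF bm uv that(1,3)])
    show ?thesis
      using indep_var_integrable[OF iv that(2,4)] indep_var_lebesgue_integral[OF iv that(2,4)] that(5)
      by simp
  qed
  have id: "integrable M (\<lambda>\<omega>. (D \<omega>)\<^sup>2 - h)" "(\<integral>\<omega>. (D \<omega>)\<^sup>2 - h \<partial>M) = 0"
    using mom by (auto simp: prob_space)
  have i\<alpha>: "integrable M (\<alpha> k)"
    by (rule integrable_const_bound[where B=U]) (auto simp: \<alpha>U)
  have i\<gamma>: "integrable M (\<gamma> k)"
    by (rule integrable_const_bound[where B=U]) (auto simp: \<gamma>U)
  have bdd: "integrable M (\<lambda>\<omega>. N k \<omega> * f \<omega>)"
    if [measurable]: "f \<in> borel_measurable M" and f: "\<And>\<omega>. \<bar>f \<omega>\<bar> \<le> U" for f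
  proof (rule Bochner_Integration.integrable_bound[OF integrable_mult_left[OF iN, of U]])
    have "\<bar>N k \<omega>\<bar> * \<bar>f \<omega>\<bar> \<le> \<bar>N k \<omega>\<bar> * \<bar>U\<bar>" for \<omega>
      using f[of \<omega>] by (intro mult_left_mono) auto
    then show "AE \<omega> in M. norm (N k \<omega> * f \<omega>) \<le> norm (N k \<omega> * U)"
      by (simp add: abs_mult)
  qed measurable
  have iN\<alpha>: "integrable M (\<lambda>\<omega>. N k \<omega> * \<alpha> k \<omega>)" and iN\<gamma>: "integrable M (\<lambda>\<omega>. N k \<omega> * \<gamma> k \<omega>)"
    by (rule bdd, measurable, rule \<alpha>U \<gamma>U)+
  have I1: "integrable M (\<lambda>\<omega>. \<alpha> k \<omega> * D \<omega>) \<and> (\<integral>\<omega>. \<alpha> k \<omega> * D \<omega> \<partial>M) = 0"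
    by (rule ind[of "\<alpha> k" "\<lambda>x. x", OF \<alpha>m i\<alpha> measurable_ident[unfolded id_def] mom(1,2)])
  have qm: "(\<lambda>x. x\<^sup>2 - h) \<in> borel_measurable borel" by measurable
  have I2: "integrable M (\<lambda>\<omega>. \<gamma> k \<omega> * ((D \<omega>)\<^sup>2 - h)) \<and> (\<integral>\<omega>. \<gamma> k \<omega> * ((D \<omega>)\<^sup>2 - h) \<partial>M) = 0"
    by (rule ind[of "\<gamma> k", OF \<gamma>m i\<gamma> qm id])
  have I3: "integrable M (\<lambda>\<omega>. N k \<omega> * \<alpha> k \<omega> * D \<omega>) \<and> (\<integral>\<omega>. N k \<omega> * \<alpha> k \<omega> * D \<omega> \<partial>M) = 0"
    by (rule ind[of "\<lambda>\<omega>. N k \<omega> * \<alpha> k \<omega>" "\<lambda>x. x", OF borel_measurable_times[OF Nm \<alpha>m] iN\<alpha>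
          measurable_ident[unfolded id_def] mom(1,2)])
  have I4: "integrable M (\<lambda>\<omega>. N k \<omega> * \<gamma> k \<omega> * ((D \<omega>)\<^sup>2 - h)) \<and>
      (\<integral>\<omega>. N k \<omega> * \<gamma> k \<omega> * ((D \<omega>)\<^sup>2 - h) \<partial>M) = 0"
    by (rule ind[of "\<lambda>\<omega>. N k \<omega> * \<gamma> k \<omega>", OF borel_measurable_times[OF Nm \<gamma>m] iN\<gamma> qm id])
  define m where "m = (\<lambda>\<omega>. \<alpha> k \<omega> * D \<omega> + \<gamma> k \<omega> * ((D \<omega>)\<^sup>2 - h))"
  have [measurable]: "m \<in> borel_measurable M" unfolding m_def by measurable
  have m2: "(m \<omega>)\<^sup>2 \<le> 2 * U\<^sup>2 * ((D \<omega>)\<^sup>2 + ((D \<omega>)\<^sup>2 - h)\<^sup>2)" for \<omega>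
  proof -
    have sq: "a\<^sup>2 \<le> U\<^sup>2" if "\<bar>a\<bar> \<le> U" for a
      using that by (metis abs_ge_zero power2_abs power_mono)
    have "(a + b)\<^sup>2 \<le> 2 * (a\<^sup>2 + b\<^sup>2)" for a b :: real
      using zero_le_power2[of "a - b"] by (simp add: power2_sum power2_diff)
    then have "(m \<omega>)\<^sup>2 \<le> 2 * ((\<alpha> k \<omega> * D \<omega>)\<^sup>2 + (\<gamma> k \<omega> * ((D \<omega>)\<^sup>2 - h))\<^sup>2)"
      unfolding m_def .
    also have "\<dots> \<le> 2 * (U\<^sup>2 * (D \<omega>)\<^sup>2 + U\<^sup>2 * ((D \<omega>)\<^sup>2 - h)\<^sup>2)"
      unfolding power_mult_distrib
      by (intro mult_left_mono add_mono mult_right_mono sq \<alpha>U \<gamma>U) auto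
    finally show ?thesis by (simp only: distrib_left mult.assoc)
  qed
  have iB: "integrable M (\<lambda>\<omega>. 2 * U\<^sup>2 * ((D \<omega>)\<^sup>2 + ((D \<omega>)\<^sup>2 - h)\<^sup>2))"
    by (rule integrable_mult_right[OF Bochner_Integration.integrable_add[OF mom(3,5)]])
  have im2: "integrable M (\<lambda>\<omega>. (m \<omega>)\<^sup>2)"
  proof (rule Bochner_Integration.integrable_bound[OF iB])
    show "AE \<omega> in M. norm ((m \<omega>)\<^sup>2) \<le> norm (2 * U\<^sup>2 * ((D \<omega>)\<^sup>2 + ((D \<omega>)\<^sup>2 - h)\<^sup>2))"
      unfolding real_norm_def abs_power2 by (rule AE_I2, rule order_trans[OF m2 abs_ge_self])
  qed measurable
  have em2: "(\<integral>\<omega>. (m \<omega>)\<^sup>2 \<partial>M) \<le> 2 * U\<^sup>2 * (h + 2 * h\<^sup>2)"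
  proof -
    have "(\<integral>\<omega>. (m \<omega>)\<^sup>2 \<partial>M) \<le> (\<integral>\<omega>. 2 * U\<^sup>2 * ((D \<omega>)\<^sup>2 + ((D \<omega>)\<^sup>2 - h)\<^sup>2) \<partial>M)"
      by (rule integral_mono[OF im2 iB m2])
    also have "\<dots> = 2 * U\<^sup>2 * (h + 2 * h\<^sup>2)"
      by (simp only: integral_mult_right_zero Bochner_Integration.integral_add[OF mom(3,5)] mom(4,6))
    finally show ?thesis .
  qed
  have sqeq: "(N (Suc k) \<omega>)\<^sup>2 = (N k \<omega>)\<^sup>2 + 2 * (N k \<omega> * \<alpha> k \<omega> * D \<omega>)
      + 2 * (N k \<omega> * \<gamma> k \<omega> * ((D \<omega>)\<^sup>2 - h)) + (m \<omega>)\<^sup>2" for \<omega>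
  proof -
    have "(N (Suc k) \<omega>)\<^sup>2 = (N k \<omega>)\<^sup>2 + 2 * N k \<omega> * m \<omega> + (m \<omega>)\<^sup>2"
    proof -
      have "N (Suc k) \<omega> = N k \<omega> + m \<omega>" by (simp add: step m_def)
      then show ?thesis by (simp add: power2_sum)
    qed
    also have "2 * N k \<omega> * m \<omega> = 2 * (N k \<omega> * \<alpha> k \<omega> * D \<omega>)
        + 2 * (N k \<omega> * \<gamma> k \<omega> * ((D \<omega>)\<^sup>2 - h))"
      by (simp add: m_def distrib_left mult.assoc)
    finally show ?thesis by simp
  qed
  have iN2: "integrable M (\<lambda>\<omega>. (N k \<omega>)\<^sup>2)" "(\<integral>\<omega>. (N k \<omega>)\<^sup>2 \<partial>M) \<le> k * (2 * U\<^sup>2 * (h + 2 * h\<^sup>2))"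
    "integral\<^sup>L M (N k) = 0"
    using Suc by blast+
  have hb: "has_bochner_integral M (\<lambda>\<omega>. (N (Suc k) \<omega>)\<^sup>2)
      ((\<integral>\<omega>. (N k \<omega>)\<^sup>2 \<partial>M) + 2 * 0 + 2 * 0 + (\<integral>\<omega>. (m \<omega>)\<^sup>2 \<partial>M))"
    unfolding sqeq
    by (intro has_bochner_integral_add has_bochner_integral_mult_right)
       (use iN2 I3 I4 im2 in \<open>auto simp: has_bochner_integral_iff simp del: power2_eq_iff\<close>)
  have hb1: "has_bochner_integral M (N (Suc k)) (0 + (0 + 0))"
    unfolding step
    by (intro has_bochner_integral_add) (use iN iN2 I1 I2 in \<open>auto simp: has_bochner_integral_iff\<close>)
  have le: "(\<integral>\<omega>. (N (Suc k) \<omega>)\<^sup>2 \<partial>M) \<le> real (Suc k) * (2 * U\<^sup>2 * (h + 2 * h\<^sup>2))"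
  proof -
    have "(\<integral>\<omega>. (N (Suc k) \<omega>)\<^sup>2 \<partial>M) = (\<integral>\<omega>. (N k \<omega>)\<^sup>2 \<partial>M) + (\<integral>\<omega>. (m \<omega>)\<^sup>2 \<partial>M)"
      using has_bochner_integral_integral_eq[OF hb] by simp
    also have "\<dots> \<le> k * (2 * U\<^sup>2 * (h + 2 * h\<^sup>2)) + 2 * U\<^sup>2 * (h + 2 * h\<^sup>2)"
      by (intro add_mono iN2 em2)
    finally show ?thesis by (simp only: of_nat_Suc distrib_right mult_1)
  qed
  show ?case
    using m1 le has_bochner_integral_integral_eq[OF hb1] hb hb1
    unfolding v_def has_bochner_integral_iff by simp
qed

section \<open>Expectations of smooth functions along a semimartingale\<close>

text \<open>The bound \<open>U\<close> is global in space for \<open>u\<close>, \<open>ux\<close>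
  and \<open>uxx\<close>, which enter expectations and martingale coefficients. Continuity of
  \<open>ut\<close> and \<open>uxx\<close> is exploited on the compact range of a single path, where
  it is uniform.\<close>

definition smooth_bounded ::
  "real \<Rightarrow> real \<Rightarrow> real \<Rightarrow> (real \<Rightarrow> real \<Rightarrow> real) \<Rightarrow> (real \<Rightarrow> real \<Rightarrow> real) \<Rightarrow> (real \<Rightarrow> real \<Rightarrow> real) \<Rightarrow>
   (real \<Rightarrow> real \<Rightarrow> real) \<Rightarrow> bool" where
  "smooth_bounded s t U u ut ux uxx \<longleftrightarrow>
     (\<forall>r\<in>{s..t}. \<forall>z. ((\<lambda>r. u r z) has_real_derivative ut r z) (at r) \<and>
        (u r has_real_derivative ux r z) (at z) \<and> (ux r has_real_derivative uxx r z) (at z) \<and>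
        \<bar>u r z\<bar> \<le> U \<and> \<bar>ux r z\<bar> \<le> U \<and> \<bar>uxx r z\<bar> \<le> U) \<and>
     continuous_on ({s..t} \<times> UNIV) (\<lambda>(r, z). ut r z) \<and>
     continuous_on ({s..t} \<times> UNIV) (\<lambda>(r, z). uxx r z)"

lemma smooth_boundedD:
  assumes "smooth_bounded s t U u ut ux uxx"
  shows "\<And>r z. r \<in> {s..t} \<Longrightarrow> ((\<lambda>r. u r z) has_real_derivative ut r z) (at r)"
    "\<And>r z. r \<in> {s..t} \<Longrightarrow> (u r has_real_derivative ux r z) (at z)"
    "\<And>r z. r \<in> {s..t} \<Longrightarrow> (ux r has_real_derivative uxx r z) (at z)"
    "\<And>r z. r \<in> {s..t} \<Longrightarrow> \<bar>u r z\<bar> \<le> U" "\<And>r z. r \<in> {s..t} \<Longrightarrow> \<bar>ux r z\<bar> \<le> U"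
    "\<And>r z. r \<in> {s..t} \<Longrightarrow> \<bar>uxx r z\<bar> \<le> U"
    "continuous_on ({s..t} \<times> UNIV) (\<lambda>(r, z). ut r z)"
    "continuous_on ({s..t} \<times> UNIV) (\<lambda>(r, z). uxx r z)"
  using assms by (auto simp: smooth_bounded_def)

lemma smooth_bounded_add:
  assumes "smooth_bounded s t U u ut ux uxx" "smooth_bounded s t V v vt vx vxx"
  shows "smooth_bounded s t (U + V) (\<lambda>r z. u r z + v r z) (\<lambda>r z. ut r z + vt r z)
    (\<lambda>r z. ux r z + vx r z) (\<lambda>r z. uxx r z + vxx r z)"
  unfolding smooth_bounded_def
proof (intro conjI ballI allI)
  note u = smooth_boundedD[OF assms(1)] and v = smooth_boundedD[OF assms(2)]
  show "continuous_on ({s..t} \<times> UNIV) (\<lambda>(r, z). ut r z + vt r z)"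
    using continuous_on_add[OF u(7) v(7)] by (simp add: case_prod_beta')
  show "continuous_on ({s..t} \<times> UNIV) (\<lambda>(r, z). uxx r z + vxx r z)"
    using continuous_on_add[OF u(8) v(8)] by (simp add: case_prod_beta')
  fix r z assume r: "r \<in> {s..t}"
  show "((\<lambda>r. u r z + v r z) has_real_derivative ut r z + vt r z) (at r)"
    "((\<lambda>z. u r z + v r z) has_real_derivative ux r z + vx r z) (at z)"
    "((\<lambda>z. ux r z + vx r z) has_real_derivative uxx r z + vxx r z) (at z)"
    using r u v by (auto intro!: DERIV_add)
  show "\<bar>u r z + v r z\<bar> \<le> U + V" "\<bar>ux r z + vx r z\<bar> \<le> U + V" "\<bar>uxx r z + vxx r z\<bar> \<le> U + V"
    using u(4-6)[OF r, of z] v(4-6)[OF r, of z] by linarith+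
qed

lemma smooth_bounded_cmult:
  assumes "smooth_bounded s t U u ut ux uxx"
  shows "smooth_bounded s t (\<bar>c\<bar> * U) (\<lambda>r z. c * u r z) (\<lambda>r z. c * ut r z)
    (\<lambda>r z. c * ux r z) (\<lambda>r z. c * uxx r z)"
  unfolding smooth_bounded_def
proof (intro conjI ballI allI)
  note u = smooth_boundedD[OF assms(1)]
  show "continuous_on ({s..t} \<times> UNIV) (\<lambda>(r, z). c * ut r z)"
    using continuous_on_mult_left[OF u(7)] by (simp add: case_prod_beta')
  show "continuous_on ({s..t} \<times> UNIV) (\<lambda>(r, z). c * uxx r z)"
    using continuous_on_mult_left[OF u(8)] by (simp add: case_prod_beta')
  fix r z assume r: "r \<in> {s..t}"
  show "((\<lambda>r. c * u r z) has_real_derivative c * ut r z) (at r)"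
    "((\<lambda>z. c * u r z) has_real_derivative c * ux r z) (at z)"
    "((\<lambda>z. c * ux r z) has_real_derivative c * uxx r z) (at z)"
    using r u by (auto intro!: DERIV_cmult)
  show "\<bar>c * u r z\<bar> \<le> \<bar>c\<bar> * U" "\<bar>c * ux r z\<bar> \<le> \<bar>c\<bar> * U" "\<bar>c * uxx r z\<bar> \<le> \<bar>c\<bar> * U"
    using u(4-6)[OF r, of z] by (auto simp: abs_mult intro!: mult_left_mono)
qed

section \<open>Taylor expansion along a path\<close>

lemma Taylor_second_order:
  fixes f f' f'' :: "real \<Rightarrow> real"
  assumes "\<And>z. (f has_real_derivative f' z) (at z)" "\<And>z. (f' has_real_derivative f'' z) (at z)"
  obtains \<zeta> where "\<bar>\<zeta> - z\<bar> \<le> \<bar>w - z\<bar>" "f w = f z + f' z * (w - z) + f'' \<zeta> / 2 * (w - z)\<^sup>2"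
proof (cases "w = z")
  case True
  then show ?thesis by (auto intro: that[of z])
next
  case False
  define diff where "diff m = (if m = 0 then f else if m = 1 then f' else f'')" for m :: nat
  have "\<exists>y. (if w < z then w < y \<and> y < z else z < y \<and> y < w) \<and>
      f w = (\<Sum>m<2. diff m z / fact m * (w - z) ^ m) + diff 2 y / fact 2 * (w - z) ^ 2"
  proof (rule Taylor[where a="min w z" and b="max w z"])
    show "\<forall>m t. m < 2 \<and> min w z \<le> t \<and> t \<le> max w z \<longrightarrow> DERIV (diff m) t :> diff (Suc m) t"
      using assms by (auto simp: diff_def less_2_cases_iff)
  qed (use False in \<open>auto simp: diff_def\<close>)
  then obtain y where "if w < z then w < y \<and> y < z else z < y \<and> y < w"
    "f w = f z + f' z * (w - z) + f'' y / 2 * (w - z) ^ 2"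
    by (auto simp: diff_def numeral_2_eq_2)
  then show ?thesis by (intro that[of y]) (auto split: if_splits)
qed

text \<open>The move from (a, z) to (b, w) passes through (a, w): time is advanced at the new
  position, space is expanded at the old time. Hence the different shapes of the two oscillation
  hypotheses. Only the upper estimate is kept; lower ones come from negating
  \<open>u\<close>.\<close>

lemma Taylor_space_time:
  assumes sm: "smooth_bounded s t U u ut ux uxx"
    and ab: "a \<in> {s..t}" "b \<in> {s..t}" "a \<le> b"
    and ut: "\<And>r. r \<in> {a..b} \<Longrightarrow> \<bar>ut r w - ut a z\<bar> \<le> \<eta>"
    and uxx: "\<And>\<zeta>. \<bar>\<zeta> - z\<bar> \<le> \<bar>w - z\<bar> \<Longrightarrow> \<bar>uxx a \<zeta> - uxx a z\<bar> \<le> \<eta>"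
  shows "u b w - u a z \<le> ut a z * (b - a) + ux a z * (w - z) + uxx a z / 2 * (w - z)\<^sup>2
    + \<eta> * ((b - a) + (w - z)\<^sup>2)"
proof -
  note u = smooth_boundedD[OF sm]
  have "0 \<le> \<eta>" using uxx[of z] by simp
  have time: "u b w - u a w \<le> ut a z * (b - a) + \<eta> * (b - a)"
  proof (cases "a = b")
    case False
    then have "\<exists>\<xi>>a. \<xi> < b \<and> u b w - u a w = (b - a) * ut \<xi> w"
      using ab u(1)[of _ w] by (intro MVT2) auto
    then obtain \<xi> where \<xi>: "a < \<xi>" "\<xi> < b" "u b w - u a w = (b - a) * ut \<xi> w" by auto
    have "ut \<xi> w \<le> ut a z + \<eta>" using ut[of \<xi>] \<xi> by auto
    then have "(b - a) * ut \<xi> w \<le> (b - a) * (ut a z + \<eta>)" using ab by (intro mult_left_mono) auto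
    then show ?thesis using \<xi> by (simp add: algebra_simps)
  qed simp
  obtain \<zeta> where \<zeta>: "\<bar>\<zeta> - z\<bar> \<le> \<bar>w - z\<bar>"
    "u a w = u a z + ux a z * (w - z) + uxx a \<zeta> / 2 * (w - z)\<^sup>2"
    using Taylor_second_order[of "u a" "ux a" "uxx a" z w] u(2,3) ab(1) by metis
  have "uxx a \<zeta> / 2 \<le> uxx a z / 2 + \<eta>" using uxx[OF \<zeta>(1)] \<open>0 \<le> \<eta>\<close> by linarith
  then have "uxx a \<zeta> / 2 * (w - z)\<^sup>2 \<le> (uxx a z / 2 + \<eta>) * (w - z)\<^sup>2"
    by (rule mult_right_mono) simp
  then show ?thesis using time \<zeta>(2) by (simp add: algebra_simps)
qed

text \<open>
  The clock \<open>A\<close> dominates both time and the bounded variation part \<open>X - B\<close>; for a reflecting path it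
  is time plus local time.  In the generator inequality the derivatives are frozen at the left end
  point \<open>a\<close>, so no regularity of the drift in \<open>X - B\<close> is needed.
\<close>

definition controlled_path ::
  "real \<Rightarrow> real \<Rightarrow> real \<Rightarrow> real \<Rightarrow> (real \<Rightarrow> real \<Rightarrow> real) \<Rightarrow> (real \<Rightarrow> real \<Rightarrow> real) \<Rightarrow>
   (real \<Rightarrow> real \<Rightarrow> real) \<Rightarrow> (real \<Rightarrow> real) \<Rightarrow> (real \<Rightarrow> real) \<Rightarrow> bool" where
  "controlled_path s t C K ut ux uxx X B \<longleftrightarrow>
     continuous_on {s..t} X \<and> continuous_on {s..t} B \<and>
     (\<exists>A. \<forall>a b. s \<le> a \<and> a \<le> b \<and> b \<le> t \<longrightarrow>
        b - a \<le> A b - A a \<and> \<bar>(X b - B b) - (X a - B a)\<bar> \<le> C * (A b - A a) \<and>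
        (\<forall>\<delta>. (\<forall>r\<in>{a..b}. \<bar>X r - X a\<bar> \<le> \<delta>) \<longrightarrow>
          (ut a (X a) + uxx a (X a) / 2) * (b - a) + ux a (X a) * ((X b - B b) - (X a - B a))
            \<le> K * \<delta> * (A b - A a)))"

text \<open>Per step the error is a small multiple of the clock increment plus
  \<open>\<eta>' * h n\<close> and \<open>\<eta>' * (D n i)\<^sup>2\<close>. The clock increments
  telescope, however irregular the clock is. The sum of squared increments does not become small and
  is kept in the bound, since its expectation is known. The threshold for \<open>n\<close> depends
  on the path.\<close>

lemma pathwise_remainder:
  fixes X B :: "real \<Rightarrow> real"
  assumes sm: "smooth_bounded s t U u ut ux uxx" and st: "s < t"
    and path: "controlled_path s t C K ut ux uxx X B"
    and C: "0 \<le> C" and K: "0 \<le> K" and \<eta>: "0 < \<eta>"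
  defines "h \<equiv> \<lambda>n. (t - s) / real n"
  defines "\<tau> \<equiv> \<lambda>n i. s + real i * h n"
  defines "D \<equiv> \<lambda>n i. B (\<tau> n (Suc i)) - B (\<tau> n i)"
  shows "\<forall>\<^sub>F n in sequentially. u t (X t) - u s (X s) -
      (\<Sum>i<n. ux (\<tau> n i) (X (\<tau> n i)) * D n i + uxx (\<tau> n i) (X (\<tau> n i)) / 2 * ((D n i)\<^sup>2 - h n))
    \<le> \<eta> * (1 + (\<Sum>i<n. (D n i)\<^sup>2))"
proof -
  have contX: "continuous_on {s..t} X" and contB: "continuous_on {s..t} B"
    using path by (auto simp: controlled_path_def)
  obtain A where clock: "\<And>a b. s \<le> a \<Longrightarrow> a \<le> b \<Longrightarrow> b \<le> t \<Longrightarrow> b - a \<le> A b - A a"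
    and fv: "\<And>a b. s \<le> a \<Longrightarrow> a \<le> b \<Longrightarrow> b \<le> t \<Longrightarrow>
      \<bar>(X b - B b) - (X a - B a)\<bar> \<le> C * (A b - A a)"
    and gen: "\<And>a b \<delta>. s \<le> a \<Longrightarrow> a \<le> b \<Longrightarrow> b \<le> t \<Longrightarrow> \<forall>r\<in>{a..b}. \<bar>X r - X a\<bar> \<le> \<delta> \<Longrightarrow>
      (ut a (X a) + uxx a (X a) / 2) * (b - a) + ux a (X a) * ((X b - B b) - (X a - B a))
        \<le> K * \<delta> * (A b - A a)"
    using path unfolding controlled_path_def by blast
  note u = smooth_boundedD[OF sm]
  have U: "0 \<le> U" using u(4)[of s 0] st by auto
  define T where "T = A t - A s"
  have T: "0 < T" using clock[of s t] st by (simp add: T_def)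
  \<comment> \<open>The oscillation error over the whole interval, \<open>\<eta>' * (t - s)\<close>,
    is to cost at most half of \<eta>.\<close>
  define \<eta>' where "\<eta>' = \<eta> / (2 * (1 + (t - s)))"
  have \<eta>': "0 < \<eta>'" "\<eta>' \<le> \<eta>" "\<eta>' * (t - s) \<le> \<eta> / 2"
  proof -
    define d where "d = t - s"
    have d: "0 < d" "0 < \<eta> * d" using st \<eta> by (auto simp: d_def)
    show "0 < \<eta>'" "\<eta>' \<le> \<eta>" "\<eta>' * (t - s) \<le> \<eta> / 2"
      unfolding \<eta>'_def d_def[symmetric] using \<eta> d by (simp_all add: field_simps)
  qed
  \<comment> \<open>\<open>K\<close> comes from the generator inequality. Replacing squared
    increments of \<open>X\<close> by those of \<open>B\<close> costs \<open>U * C\<close> in the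
    second-order term and \<open>2 * \<eta>' * C\<close> in the Taylor remainder, all per unit of
    \<delta> and of the clock.\<close>
  define E where "E = K + (U + 2 * \<eta>') * C"
  have E: "0 \<le> E" using K U C \<eta>' by (simp add: E_def)
  \<comment> \<open>Makes the total clock error cost the other half of \<eta>; the summand 1 covers
    the case \<open>E = 0\<close>.\<close>
  define \<delta>0 where "\<delta>0 = \<eta> / (2 * (E * T + 1))"
  have \<delta>0: "0 < \<delta>0" "E * \<delta>0 * T \<le> \<eta> / 2"
  proof -
    have P: "0 \<le> E * T" using E T by simp
    show "0 < \<delta>0" using P \<eta> by (simp add: \<delta>0_def add_nonneg_pos)
    have "E * \<delta>0 * T = (\<eta> / 2) * (E * T / (E * T + 1))" by (simp add: \<delta>0_def field_simps)
    also have "\<dots> \<le> (\<eta> / 2) * 1" using P \<eta> by (intro mult_left_mono) auto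
    finally show "E * \<delta>0 * T \<le> \<eta> / 2" by simp
  qed
  have "bounded (X ` {s..t})"
    by (intro compact_imp_bounded compact_continuous_image contX compact_Icc)
  then obtain R where "\<forall>y\<in>X ` {s..t}. norm y \<le> R"
    unfolding bounded_iff by blast
  then have R: "\<bar>X r\<bar> \<le> R" if "r \<in> {s..t}" for r
    using that by auto
  \<comment> \<open>The box exceeds the range of the path by 1, because the intermediate Taylor
    point is only known to lie within \<delta> \<le> 1 of the path.\<close>
  let ?S = "{s..t} \<times> {-(R + 1)..R + 1}"
  have cS: "compact ?S" by (intro compact_Times compact_Icc)
  have "uniformly_continuous_on ?S (\<lambda>(r, z). ut r z)"
    by (rule compact_uniformly_continuous[OF continuous_on_subset[OF u(7)] cS]) auto
  then obtain d1 where d1: "0 < d1" "\<And>p q. p \<in> ?S \<Longrightarrow> q \<in> ?S \<Longrightarrow> dist q p < d1 \<Longrightarrow>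
      dist (case q of (r, z) \<Rightarrow> ut r z) (case p of (r, z) \<Rightarrow> ut r z) < \<eta>'"
    unfolding uniformly_continuous_on_def using \<eta>'(1) by metis
  have "uniformly_continuous_on ?S (\<lambda>(r, z). uxx r z)"
    by (rule compact_uniformly_continuous[OF continuous_on_subset[OF u(8)] cS]) auto
  then obtain d2 where d2: "0 < d2" "\<And>p q. p \<in> ?S \<Longrightarrow> q \<in> ?S \<Longrightarrow> dist q p < d2 \<Longrightarrow>
      dist (case q of (r, z) \<Rightarrow> uxx r z) (case p of (r, z) \<Rightarrow> uxx r z) < \<eta>'"
    unfolding uniformly_continuous_on_def using \<eta>'(1) by metis
  have dist_pair: "dist (r, z) (r', z') \<le> \<bar>r - r'\<bar> + \<bar>z - z'\<bar>" for r z r' z' :: real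
    using sqrt_sum_squares_le_sum_abs[of "r - r'" "z - z'"]
    by (simp add: dist_Pair_Pair dist_real_def)
  \<comment> \<open>Thirds leave room to add a displacement in time and one in space and still stay
    strictly below \<open>d1\<close> or \<open>d2\<close>.\<close>
  define \<delta> where "\<delta> = min (min 1 \<delta>0) (min (d1 / 3) (d2 / 3))"
  have \<delta>: "0 < \<delta>" "\<delta> \<le> 1" "\<delta> \<le> \<delta>0" "\<delta> \<le> d1 / 3" "\<delta> \<le> d2 / 3"
    using \<delta>0 d1(1) d2(1) by (auto simp: \<delta>_def)
  have "uniformly_continuous_on {s..t} X" "uniformly_continuous_on {s..t} B"
    by (intro compact_uniformly_continuous contX contB compact_Icc)+
  then obtain e1 e2 where e: "0 < e1" "0 < e2"
    "\<And>a r. a \<in> {s..t} \<Longrightarrow> r \<in> {s..t} \<Longrightarrow> \<bar>r - a\<bar> < e1 \<Longrightarrow> \<bar>X r - X a\<bar> < \<delta>"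
    "\<And>a r. a \<in> {s..t} \<Longrightarrow> r \<in> {s..t} \<Longrightarrow> \<bar>r - a\<bar> < e2 \<Longrightarrow> \<bar>B r - B a\<bar> < \<delta>"
    unfolding uniformly_continuous_on_def dist_real_def using \<delta>(1) by metis
  define H where "H = min (min e1 e2) (min (d1 / 3) (d2 / 3))"
  have H: "0 < H" using e d1(1) d2(1) by (simp add: H_def)
  have "(\<lambda>n. h n) \<longlonglongrightarrow> 0"
    unfolding h_def by (rule real_tendsto_divide_at_top[OF tendsto_const filterlim_real_sequentially])
  then have "\<forall>\<^sub>F n in sequentially. h n < H"
    using H by (rule order_tendstoD)
  moreover have "\<forall>\<^sub>F n in sequentially. 0 < n" by (rule eventually_gt_at_top)
  ultimately show ?thesis
  proof eventually_elim
    case (elim n)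
    define a where "a = \<tau> n"
    have hn: "0 < h n" using elim st by (simp add: h_def)
    have hn': "real n * h n = t - s" using elim by (simp add: h_def)
    have a_le: "s \<le> a i" for i using hn by (simp add: a_def \<tau>_def)
    have le_a: "a i \<le> t" if "i \<le> n" for i
    proof -
      have "real i * h n \<le> real n * h n" using that hn by (intro mult_right_mono) auto
      then show ?thesis using hn' by (simp add: a_def \<tau>_def)
    qed
    have a_Suc: "a (Suc i) = a i + h n" for i by (simp add: a_def \<tau>_def algebra_simps)
    have a0: "a 0 = s" and an: "a n = t" using hn' by (auto simp: a_def \<tau>_def)
    have step: "u (a (Suc i)) (X (a (Suc i))) - u (a i) (X (a i))
        - (ux (a i) (X (a i)) * D n i + uxx (a i) (X (a i)) / 2 * ((D n i)\<^sup>2 - h n))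
        \<le> E * \<delta> * (A (a (Suc i)) - A (a i)) + \<eta>' * h n + \<eta>' * (D n i)\<^sup>2"
      if i: "i < n" for i
    proof -
      define p q where "p = a i" and "q = a (Suc i)"
      have pq: "s \<le> p" "p \<le> q" "q \<le> t" "q - p = h n"
        using a_le[of i] le_a[of "Suc i"] a_Suc[of i] hn i by (auto simp: p_def q_def)
      have osc: "\<bar>X r - X p\<bar> < \<delta>" "\<bar>B r - B p\<bar> < \<delta>" if "r \<in> {p..q}" for r
        using that pq elim by (auto intro!: e simp: H_def)
      have RX: "\<bar>X r\<bar> \<le> R" if "r \<in> {p..q}" for r using R[of r] that pq by auto
      define dX dW dA where "dX = X q - X p" and "dW = (X q - B q) - (X p - B p)" and "dA = A q - A p"
      have DB: "D n i = B q - B p" by (simp add: D_def p_def q_def a_def)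
      have dX: "dX = dW + D n i" by (simp add: dX_def dW_def DB)
      have "u q (X q) - u p (X p) \<le> ut p (X p) * (q - p) + ux p (X p) * (X q - X p)
          + uxx p (X p) / 2 * (X q - X p)\<^sup>2 + \<eta>' * ((q - p) + (X q - X p)\<^sup>2)"
      proof (rule Taylor_space_time[OF sm])
        fix r assume r: "r \<in> {p..q}"
        have "dist (r, X q) (p, X p) \<le> \<bar>r - p\<bar> + \<bar>X q - X p\<bar>" by (rule dist_pair)
        also have "\<dots> < d1" using osc(1)[of q] \<delta> r pq elim d1(1) by (auto simp: H_def)
        finally have "dist (r, X q) (p, X p) < d1" .
        moreover have "(p, X p) \<in> ?S" "(r, X q) \<in> ?S"
          using RX[of q] RX[of p] r pq by auto
        ultimately show "\<bar>ut r (X q) - ut p (X p)\<bar> \<le> \<eta>'"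
          using d1(2)[of "(p, X p)" "(r, X q)"] by (simp add: dist_real_def)
      next
        fix \<zeta> assume \<zeta>: "\<bar>\<zeta> - X p\<bar> \<le> \<bar>X q - X p\<bar>"
        then have \<zeta>': "\<bar>\<zeta> - X p\<bar> < \<delta>" using osc(1)[of q] pq by auto
        have "dist (p, \<zeta>) (p, X p) \<le> \<bar>p - p\<bar> + \<bar>\<zeta> - X p\<bar>" by (rule dist_pair)
        also have "\<dots> < d2" using \<zeta>' \<delta> d2(1) by simp
        finally have "dist (p, \<zeta>) (p, X p) < d2" .
        moreover have "(p, X p) \<in> ?S" "(p, \<zeta>) \<in> ?S"
          using RX[of p] \<zeta>' \<delta>(2) pq by auto
        ultimately show "\<bar>uxx p \<zeta> - uxx p (X p)\<bar> \<le> \<eta>'"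
          using d2(2)[of "(p, X p)" "(p, \<zeta>)"] by (simp add: dist_real_def)
      qed (use pq in auto)
      then have "u q (X q) - u p (X p) \<le> ut p (X p) * h n + ux p (X p) * dX
          + uxx p (X p) / 2 * dX\<^sup>2 + \<eta>' * (h n + dX\<^sup>2)"
        by (simp add: pq dX_def)
      moreover have "(ut p (X p) + uxx p (X p) / 2) * h n + ux p (X p) * dW \<le> K * \<delta> * dA"
        using gen[of p q \<delta>] less_imp_le[OF osc(1)] pq by (simp add: dW_def dA_def)
      \<comment> \<open>The difference of squares factors into the bounded variation increment,
        which the clock controls, and a sum of two increments below \<delta>.\<close>
      moreover have sqd: "\<bar>dX\<^sup>2 - (D n i)\<^sup>2\<bar> \<le> C * dA * (2 * \<delta>)"
      proof -
        have "dX\<^sup>2 - (D n i)\<^sup>2 = dW * (dX + D n i)"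
          by (simp add: dX power2_eq_square algebra_simps)
        moreover have "\<bar>dW\<bar> \<le> C * dA" using fv[of p q] pq by (simp add: dW_def dA_def)
        moreover have "\<bar>dX + D n i\<bar> \<le> 2 * \<delta>" using osc[of q] pq by (auto simp: dX_def DB)
        ultimately show ?thesis by (simp add: abs_mult mult_mono')
      qed
      moreover have "uxx p (X p) / 2 * (dX\<^sup>2 - (D n i)\<^sup>2) \<le> U / 2 * (C * dA * (2 * \<delta>))"
      proof -
        have "uxx p (X p) / 2 * (dX\<^sup>2 - (D n i)\<^sup>2) \<le> \<bar>uxx p (X p) / 2\<bar> * \<bar>dX\<^sup>2 - (D n i)\<^sup>2\<bar>"
          by (metis abs_ge_self abs_mult)
        also have "\<dots> \<le> U / 2 * (C * dA * (2 * \<delta>))"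
          using u(6)[of p "X p"] pq by (intro mult_mono sqd) (auto simp: U)
        finally show ?thesis .
      qed
      moreover have "\<eta>' * dX\<^sup>2 \<le> \<eta>' * ((D n i)\<^sup>2 + C * dA * (2 * \<delta>))"
        using sqd \<eta>'(1) by (intro mult_left_mono) auto
      ultimately have "u q (X q) - u p (X p) - (ux p (X p) * D n i + uxx p (X p) / 2 * ((D n i)\<^sup>2 - h n))
          \<le> E * \<delta> * dA + \<eta>' * h n + \<eta>' * (D n i)\<^sup>2"
        unfolding dX E_def by (simp add: algebra_simps)
      then show ?thesis by (simp add: p_def q_def dA_def)
    qed
    have tel: "(\<Sum>i<n. f (Suc i) - f i) = f n - f 0" for f :: "nat \<Rightarrow> real"
      by (rule sum_lessThan_telescope)
    have "(\<Sum>i<n. u (a (Suc i)) (X (a (Suc i))) - u (a i) (X (a i))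
        - (ux (a i) (X (a i)) * D n i + uxx (a i) (X (a i)) / 2 * ((D n i)\<^sup>2 - h n)))
      \<le> (\<Sum>i<n. E * \<delta> * (A (a (Suc i)) - A (a i)) + \<eta>' * h n + \<eta>' * (D n i)\<^sup>2)"
      by (intro sum_mono step) auto
    then have "u t (X t) - u s (X s)
        - (\<Sum>i<n. ux (a i) (X (a i)) * D n i + uxx (a i) (X (a i)) / 2 * ((D n i)\<^sup>2 - h n))
      \<le> E * \<delta> * T + \<eta>' * (t - s) + \<eta>' * (\<Sum>i<n. (D n i)\<^sup>2)"
      using tel[of "\<lambda>i. u (a i) (X (a i))"] tel[of "\<lambda>i. A (a i)"] hn'
      by (simp add: sum.distrib sum_subtractf sum_distrib_left[symmetric] a0 an T_def mult.left_commute)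
    moreover have "E * \<delta> * T \<le> \<eta> / 2"
      using \<delta>0(2) mult_right_mono[OF mult_left_mono[OF \<delta>(3) E], of T] T by linarith
    moreover have "\<eta>' * (\<Sum>i<n. (D n i)\<^sup>2) \<le> \<eta> * (\<Sum>i<n. (D n i)\<^sup>2)"
      using \<eta>' by (intro mult_right_mono sum_nonneg) auto
    ultimately show ?case
      using \<eta>'(3) by (simp add: a_def algebra_simps)
  qed
qed

text \<open>Since \<open>N n\<close> has mean zero, the quantity to be bounded is the mean of
  \<open>S n\<close> for every positive \<open>n\<close>. The pathwise estimate controls
  \<open>S n\<close> only beyond a random threshold and says nothing about the mean by itself; the
  second moment bound, uniform in \<open>n\<close>, closes the gap.\<close>

lemma expectation_smooth_le:
  fixes X :: "real \<Rightarrow> 'a \<Rightarrow> real"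
  assumes bm: "brownian_motion_from s M F B" and st: "s < t"
    and sm: "smooth_bounded s t U u ut ux uxx"
    and X: "adapted_on s F X" and C: "0 \<le> C" and K: "0 \<le> K"
    and start: "AE \<omega> in M. X s \<omega> = x"
    and path: "AE \<omega> in M. controlled_path s t C K ut ux uxx (\<lambda>r. X r \<omega>) (\<lambda>r. B r \<omega>)"
  shows "(\<integral>\<omega>. u t (X t \<omega>) \<partial>M) \<le> u s x"
proof -
  note bmD = brownian_motion_fromD[OF bm]
  note uD = smooth_boundedD[OF sm]
  interpret prob_space M by (rule bmD)
  have U: "0 \<le> U" using uD(4)[of s 0] st by auto
  have Xm: "X r \<in> borel_measurable (F r)" if "s \<le> r" for r
    using X that by (simp add: adapted_on_def)
  have XM[measurable]: "X s \<in> borel_measurable M" "X t \<in> borel_measurable M"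
    using Xm[of s] Xm[of t] st filtered_measurable_ambient[OF bm] by auto
  have um: "u r \<in> borel_measurable borel" "ux r \<in> borel_measurable borel"
    "uxx r \<in> borel_measurable borel" if r: "r \<in> {s..t}" for r
  proof -
    show "u r \<in> borel_measurable borel" "ux r \<in> borel_measurable borel"
      using uD(2,3)[OF r] by (auto intro!: borel_measurable_continuous_onI DERIV_continuous_on)
    have "continuous_on UNIV (\<lambda>z. (r, z))" by (intro continuous_intros)
    then have "continuous_on UNIV (\<lambda>z. case (r, z) of (r, z) \<Rightarrow> uxx r z)"
      by (rule continuous_on_compose2[OF uD(8)]) (use r in auto)
    then show "uxx r \<in> borel_measurable borel" by (auto intro: borel_measurable_continuous_onI)
  qed
  have [measurable]: "(\<lambda>\<omega>. u t (X t \<omega>)) \<in> borel_measurable M" "(\<lambda>\<omega>. u s (X s \<omega>)) \<in> borel_measurable M"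
    using measurable_compose[OF XM(1) um(1)] measurable_compose[OF XM(2) um(1)] st by auto
  define h where "h n = (t - s) / real n" for n
  define \<tau> where "\<tau> n i = s + real i * h n" for n i
  \<comment> \<open>Cut off at \<open>n\<close>: the moment lemma asks for bounded coefficients at
    every index, while for \<open>i > n\<close> the grid point leaves [s, t], where nothing is known
    about \<open>ux\<close>.\<close>
  define \<alpha> where "\<alpha> n i = (\<lambda>\<omega>. if i < n then ux (\<tau> n i) (X (\<tau> n i) \<omega>) else 0)" for n i
  define \<gamma> where "\<gamma> n i = (\<lambda>\<omega>. if i < n then uxx (\<tau> n i) (X (\<tau> n i) \<omega>) / 2 else 0)" for n i
  define D where "D n i \<omega> = B (\<tau> n (Suc i)) \<omega> - B (\<tau> n i) \<omega>" for n i \<omega>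
  define N where "N n = quadratic_martingale s (h n) B (\<alpha> n) (\<gamma> n) n" for n
  define S where "S n = (\<lambda>\<omega>. u t (X t \<omega>) - u s (X s \<omega>) - N n \<omega>)" for n
  define Q where "Q n = (\<lambda>\<omega>. \<Sum>i<n. (D n i \<omega>)\<^sup>2)" for n
  \<comment> \<open>A difference of two values of \<open>u\<close> is at most 2U, and the second
    moment of \<open>N n\<close> is estimated with \<open>h n \<le> t - s\<close>; the outer factors
    2 come from squaring a difference.\<close>
  define C1 where "C1 = 2 * (2 * U)\<^sup>2 + 2 * (2 * U\<^sup>2 * ((t - s) + 2 * (t - s)\<^sup>2))"
  have C1: "0 \<le> C1" using st by (simp add: C1_def)
  have hpos: "0 < h n" if "0 < n" for n using that st by (simp add: h_def)
  have \<tau>mem: "\<tau> n i \<in> {s..t}" if "i \<le> n" "0 < n" for n i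
  proof -
    have "real i * h n \<le> real n * h n" using that hpos[of n] by (intro mult_right_mono) auto
    moreover have "real n * h n = t - s" using that by (simp add: h_def)
    moreover have "0 \<le> real i * h n" using hpos[of n] that by simp
    ultimately show ?thesis by (simp add: \<tau>_def)
  qed
  have NM: "N n \<in> borel_measurable M \<and> integrable M (N n) \<and> integral\<^sup>L M (N n) = 0 \<and>
      integrable M (\<lambda>\<omega>. (N n \<omega>)\<^sup>2) \<and> (\<integral>\<omega>. (N n \<omega>)\<^sup>2 \<partial>M) \<le> n * (2 * U\<^sup>2 * (h n + 2 * (h n)\<^sup>2))"
    if n: "0 < n" for n
  proof -
    have "N n \<in> borel_measurable (F (s + real n * h n)) \<and>
      integrable M (N n) \<and> integral\<^sup>L M (N n) = 0 \<and>
      integrable M (\<lambda>\<omega>. (N n \<omega>)\<^sup>2) \<and> (\<integral>\<omega>. (N n \<omega>)\<^sup>2 \<partial>M) \<le> n * (2 * U\<^sup>2 * (h n + 2 * (h n)\<^sup>2))"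
      unfolding N_def
    proof (rule quadratic_martingale_moments[OF bm hpos[OF n]])
      fix i
      have Xi: "X (\<tau> n i) \<in> borel_measurable (F (\<tau> n i))" if "i < n"
        using \<tau>mem[of i n] that by (intro Xm) auto
      show "\<alpha> n i \<in> borel_measurable (F (s + real i * h n))"
        using measurable_compose[OF Xi um(2)] \<tau>mem[of i n]
        by (cases "i < n") (auto simp: \<alpha>_def \<tau>_def[symmetric])
      show "\<gamma> n i \<in> borel_measurable (F (s + real i * h n))"
        using measurable_compose[OF Xi um(3)] \<tau>mem[of i n]
        by (cases "i < n") (auto simp: \<gamma>_def \<tau>_def[symmetric])
      show "\<bar>\<alpha> n i \<omega>\<bar> \<le> U" for \<omega>
        using uD(5)[OF \<tau>mem[of i n]] U by (auto simp: \<alpha>_def)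
      show "\<bar>\<gamma> n i \<omega>\<bar> \<le> U" for \<omega>
        using uD(6)[OF \<tau>mem[of i n], of "X (\<tau> n i) \<omega>"] U by (auto simp: \<gamma>_def)
    qed
    then show ?thesis using filtered_measurable_ambient[OF bm] by blast
  qed
  have ES: "integrable M (S n) \<and> integral\<^sup>L M (S n) = (\<integral>\<omega>. u t (X t \<omega>) \<partial>M) - u s x" if n: "0 < n" for n
  proof -
    have i: "integrable M (\<lambda>\<omega>. u t (X t \<omega>))" "integrable M (\<lambda>\<omega>. u s (X s \<omega>))"
      using uD(4) st by (auto intro!: integrable_const_bound[where B=U])
    have "(\<integral>\<omega>. u s (X s \<omega>) \<partial>M) = (\<integral>\<omega>. u s x \<partial>M)"
      by (rule integral_cong_AE) (use start in auto)
    then show ?thesis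
      unfolding S_def using i NM[OF n] by (simp add: prob_space)
  qed
  have S2: "integrable M (\<lambda>\<omega>. (S n \<omega>)\<^sup>2) \<and> (\<integral>\<omega>. (S n \<omega>)\<^sup>2 \<partial>M) \<le> C1" if n: "0 < n" for n
  proof -
    have le: "(S n \<omega>)\<^sup>2 \<le> 2 * (2 * U)\<^sup>2 + 2 * (N n \<omega>)\<^sup>2" for \<omega>
    proof -
      have "(a - b)\<^sup>2 \<le> 2 * a\<^sup>2 + 2 * b\<^sup>2" for a b :: real
        using zero_le_power2[of "a + b"] by (simp add: power2_sum power2_diff)
      then have "(S n \<omega>)\<^sup>2 \<le> 2 * (u t (X t \<omega>) - u s (X s \<omega>))\<^sup>2 + 2 * (N n \<omega>)\<^sup>2"
        unfolding S_def .
      moreover have "\<bar>u t (X t \<omega>) - u s (X s \<omega>)\<bar> \<le> 2 * U"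
        using uD(4)[of t "X t \<omega>"] uD(4)[of s "X s \<omega>"] st by auto
      then have "(u t (X t \<omega>) - u s (X s \<omega>))\<^sup>2 \<le> (2 * U)\<^sup>2"
        by (metis abs_ge_zero power2_abs power_mono)
      ultimately show ?thesis by linarith
    qed
    have iB: "integrable M (\<lambda>\<omega>. 2 * (2 * U)\<^sup>2 + 2 * (N n \<omega>)\<^sup>2)" using NM[OF n] by simp
    have i: "integrable M (\<lambda>\<omega>. (S n \<omega>)\<^sup>2)"
    proof (rule Bochner_Integration.integrable_bound[OF iB])
      have [measurable]: "S n \<in> borel_measurable M" using ES[OF n] by auto
      show "(\<lambda>\<omega>. (S n \<omega>)\<^sup>2) \<in> borel_measurable M" by measurable
      show "AE \<omega> in M. norm ((S n \<omega>)\<^sup>2) \<le> norm (2 * (2 * U)\<^sup>2 + 2 * (N n \<omega>)\<^sup>2)"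
        unfolding real_norm_def abs_power2 by (rule AE_I2, rule order_trans[OF le abs_ge_self])
    qed
    have "(\<integral>\<omega>. (S n \<omega>)\<^sup>2 \<partial>M) \<le> (\<integral>\<omega>. 2 * (2 * U)\<^sup>2 + 2 * (N n \<omega>)\<^sup>2 \<partial>M)"
      by (rule integral_mono[OF i iB le])
    also have "\<dots> = 2 * (2 * U)\<^sup>2 + 2 * (\<integral>\<omega>. (N n \<omega>)\<^sup>2 \<partial>M)" using NM[OF n] by (simp add: prob_space)
    also have "\<dots> \<le> 2 * (2 * U)\<^sup>2 + 2 * (n * (2 * U\<^sup>2 * (h n + 2 * (h n)\<^sup>2)))"
      using NM[OF n] by linarith
    also have "n * (2 * U\<^sup>2 * (h n + 2 * (h n)\<^sup>2)) = 2 * U\<^sup>2 * ((t - s) + 2 * ((t - s) * h n))"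
      using n by (simp add: h_def field_simps power2_eq_square)
    also have "\<dots> \<le> 2 * U\<^sup>2 * ((t - s) + 2 * (t - s)\<^sup>2)"
    proof -
      have "h n \<le> (t - s) / 1"
        unfolding h_def using n st by (intro divide_left_mono) auto
      then have "(t - s) * h n \<le> (t - s)\<^sup>2"
        unfolding power2_eq_square using st by (intro mult_left_mono) auto
      then show ?thesis by (intro mult_left_mono) auto
    qed
    finally show ?thesis using i by (simp add: C1_def)
  qed
  have EQ: "integrable M (Q n) \<and> integral\<^sup>L M (Q n) = t - s" if n: "0 < n" for n
  proof -
    have "integrable M (\<lambda>\<omega>. (D n i \<omega>)\<^sup>2) \<and> (\<integral>\<omega>. (D n i \<omega>)\<^sup>2 \<partial>M) = h n" for i
    proof -
      have a: "s \<le> \<tau> n i" "\<tau> n i < \<tau> n (Suc i)" "\<tau> n (Suc i) - \<tau> n i = h n"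
        using hpos[OF n] by (auto simp: \<tau>_def algebra_simps)
      show ?thesis
        using brownian_increment_moments(3,4)[OF bm a(1,2)] a(3) by (simp add: D_def)
    qed
    then show ?thesis unfolding Q_def using n by (simp add: h_def)
  qed
  \<comment> \<open>\<open>S n\<close> is bounded in \<open>L\<^sup>2\<close> and, except on an event of vanishing probability, at most
      \<open>\<eta> (1 + Q n)\<close>; on the exceptional event use \<open>S n \<le> \<delta> (S n)\<^sup>2 + 1 / (4 \<delta>)\<close>.\<close>
  have key: "(\<integral>\<omega>. u t (X t \<omega>) \<partial>M) - u s x \<le> \<eta> * (1 + (t - s)) + \<delta> * C1"
    if \<eta>: "0 < \<eta>" and \<delta>: "0 < \<delta>" for \<eta> \<delta>
  proof -
    define bad where "bad n = {\<omega> \<in> space M. \<eta> * (1 + Q n \<omega>) < S n \<omega>}" for n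
    have bm_bad: "bad n \<in> sets M" if "0 < n" for n
    proof -
      have [measurable]: "Q n \<in> borel_measurable M" "S n \<in> borel_measurable M"
        using EQ[OF that] ES[OF that] by auto
      show ?thesis unfolding bad_def by measurable
    qed
    have ev: "AE \<omega> in M. \<forall>\<^sub>F n in sequentially. S n \<omega> \<le> \<eta> * (1 + Q n \<omega>)"
      using path
    proof eventually_elim
      case (elim \<omega>)
      show ?case
        using pathwise_remainder[OF sm st elim C K \<eta>]
      proof eventually_elim
        case (elim n)
        have "N n \<omega> = (\<Sum>i<n. ux (\<tau> n i) (X (\<tau> n i) \<omega>) * D n i \<omega>
            + uxx (\<tau> n i) (X (\<tau> n i) \<omega>) / 2 * ((D n i \<omega>)\<^sup>2 - h n))"
          unfolding N_def quadratic_martingale_def \<tau>_def[symmetric] D_def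
          by (rule sum.cong) (auto simp: \<alpha>_def \<gamma>_def)
        then show ?case
          using elim by (simp add: S_def Q_def D_def \<tau>_def h_def)
      qed
    qed
    \<comment> \<open>Along almost every path the indicators are eventually 0. The index is shifted
      because the estimates for \<open>S n\<close> and \<open>Q n\<close> assume
      \<open>0 < n\<close>.\<close>
    have lim: "(\<lambda>n. \<integral>\<omega>. indicator (bad (Suc n)) \<omega> \<partial>M) \<longlonglongrightarrow> (\<integral>\<omega>. 0 \<partial>M :: real)"
    proof (rule integral_dominated_convergence[where w="\<lambda>_. 1"])
      show "AE \<omega> in M. (\<lambda>n. indicator (bad (Suc n)) \<omega> :: real) \<longlonglongrightarrow> 0"
        using ev
      proof eventually_elim
        case (elim \<omega>)
        then have "\<forall>\<^sub>F n in sequentially. S (Suc n) \<omega> \<le> \<eta> * (1 + Q (Suc n) \<omega>)"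
          by (simp only: eventually_sequentially_Suc[where P="\<lambda>n. S n \<omega> \<le> \<eta> * (1 + Q n \<omega>)"])
        then show ?case
          by (intro tendsto_eventually) (auto elim!: eventually_mono simp: bad_def)
      qed
    qed (use bm_bad in auto)
    have le: "(\<integral>\<omega>. u t (X t \<omega>) \<partial>M) - u s x
        \<le> \<eta> * (1 + (t - s)) + \<delta> * C1 + 1 / (4 * \<delta>) * (\<integral>\<omega>. indicator (bad (Suc n)) \<omega> \<partial>M)" for n
    proof -
      note n = zero_less_Suc[of n]
      have pt: "S (Suc n) \<omega> \<le> \<eta> * (1 + Q (Suc n) \<omega>) + \<delta> * (S (Suc n) \<omega>)\<^sup>2
          + 1 / (4 * \<delta>) * indicator (bad (Suc n)) \<omega>" if "\<omega> \<in> space M" for \<omega>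
      proof (cases "\<omega> \<in> bad (Suc n)")
        case True
        have "0 \<le> \<delta> * (S (Suc n) \<omega> - 1 / (2 * \<delta>))\<^sup>2" using \<delta> by simp
        also have "\<dots> = \<delta> * (S (Suc n) \<omega>)\<^sup>2 - S (Suc n) \<omega> + 1 / (4 * \<delta>)"
          using \<delta> by (simp add: power2_diff field_simps power2_eq_square)
        moreover have "0 \<le> \<eta> * (1 + Q (Suc n) \<omega>)"
          using \<eta> by (auto simp: Q_def intro!: mult_nonneg_nonneg add_nonneg_nonneg sum_nonneg)
        ultimately show ?thesis using True by simp
      next
        case False
        then show ?thesis using \<delta> that by (auto simp: bad_def not_less intro: add_increasing2)
      qed
      have iI: "integrable M (indicator (bad (Suc n)) :: _ \<Rightarrow> real)"
        using bm_bad[OF n] by (auto intro!: integrable_real_indicator simp: emeasure_eq_measure)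
      have "integral\<^sup>L M (S (Suc n)) \<le> (\<integral>\<omega>. \<eta> * (1 + Q (Suc n) \<omega>) + \<delta> * (S (Suc n) \<omega>)\<^sup>2
          + 1 / (4 * \<delta>) * indicator (bad (Suc n)) \<omega> \<partial>M)"
        using ES[OF n] EQ[OF n] S2[OF n] iI
        by (intro integral_mono pt) auto
      also have "\<dots> = \<eta> * (1 + (t - s)) + \<delta> * (\<integral>\<omega>. (S (Suc n) \<omega>)\<^sup>2 \<partial>M)
          + 1 / (4 * \<delta>) * (\<integral>\<omega>. indicator (bad (Suc n)) \<omega> \<partial>M)"
        using EQ[OF n] S2[OF n] iI by (simp add: prob_space)
      also have "\<dots> \<le> \<eta> * (1 + (t - s)) + \<delta> * C1
          + 1 / (4 * \<delta>) * (\<integral>\<omega>. indicator (bad (Suc n)) \<omega> \<partial>M)"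
        using S2[OF n] \<delta> by (intro add_right_mono add_left_mono mult_left_mono) auto
      finally show ?thesis using ES[OF n] by simp
    qed
    have "(\<lambda>n. \<eta> * (1 + (t - s)) + \<delta> * C1 + 1 / (4 * \<delta>) * (\<integral>\<omega>. indicator (bad (Suc n)) \<omega> \<partial>M))
        \<longlonglongrightarrow> \<eta> * (1 + (t - s)) + \<delta> * C1 + 1 / (4 * \<delta>) * (\<integral>\<omega>. 0 \<partial>M)"
      by (intro tendsto_intros lim)
    from LIMSEQ_le_const[OF this] show ?thesis using le by auto
  qed
  have "(\<integral>\<omega>. u t (X t \<omega>) \<partial>M) - u s x \<le> 0"
  proof (rule field_le_epsilon)
    fix \<epsilon> :: real assume \<epsilon>: "0 < \<epsilon>"
    have "(\<integral>\<omega>. u t (X t \<omega>) \<partial>M) - u s x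
        \<le> \<epsilon> / (2 * (1 + (t - s))) * (1 + (t - s)) + \<epsilon> / (2 * (C1 + 1)) * C1"
      using \<epsilon> st C1 by (intro key) (auto intro!: divide_pos_pos)
    also have "\<epsilon> / (2 * (1 + (t - s))) * (1 + (t - s)) = \<epsilon> / 2"
    proof -
      have "\<epsilon> / (2 * y) * y = \<epsilon> / 2" if "y \<noteq> 0" for y using that by simp
      from this[of "1 + (t - s)"] show ?thesis using st by linarith
    qed
    also have "\<epsilon> / (2 * (C1 + 1)) * C1 = \<epsilon> / 2 * (C1 / (C1 + 1))" by simp
    also have "\<dots> \<le> \<epsilon> / 2 * 1" using \<epsilon> C1 by (intro mult_left_mono) auto
    finally show "(\<integral>\<omega>. u t (X t \<omega>) \<partial>M) - u s x \<le> 0 + \<epsilon>" by simp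
  qed
  then show ?thesis by simp
qed

section \<open>Gaussian kernels\<close>

definition Phi :: "real \<Rightarrow> real" where
  "Phi x = measure (density lborel std_normal_density) {..x}"

interpretation std_normal: prob_space "density lborel std_normal_density"
  by (rule prob_space_normal_density) simp

text \<open>\<open>Phi\<close> is the measure of a half line, whereas the fundamental theorem of
  calculus differentiates integrals over compact intervals. The end point \<open>a\<close>, present
  in one set and absent from the other, is a null set.\<close>

lemma Phi_diff:
  assumes "a \<le> b"
  shows "Phi b - Phi a = integral {a..b} std_normal_density"
proof -
  let ?N = "density lborel std_normal_density"
  have int: "set_integrable lborel {a..b} std_normal_density"
    unfolding set_integrable_def
    by (rule integrable_mult_indicator) auto
  have "Phi b - Phi a = measure ?N ({..b} - {..a})"
    unfolding Phi_def using assms by (subst std_normal.finite_measure_Diff) auto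
  also have "\<dots> = measure ?N {a..b}"
  proof (rule measure_eq_AE)
    have "AE x in lborel. x \<noteq> a" by (rule AE_lborel_singleton)
    then show "AE x in ?N. (x \<in> {..b} - {..a}) = (x \<in> {a..b})"
      by (subst AE_density) auto
  qed auto
  also have "\<dots> = (LBINT x:{a..b}. std_normal_density x)"
  proof -
    have "emeasure ?N {a..b} = (\<integral>\<^sup>+ x. ennreal (indicator {a..b} x * std_normal_density x) \<partial>lborel)"
      by (subst emeasure_density) (auto intro!: nn_integral_cong split: split_indicator)
    also have "\<dots> = ennreal (LBINT x:{a..b}. std_normal_density x)"
      using int unfolding set_lebesgue_integral_def set_integrable_def
      by (subst nn_integral_eq_integral) auto
    finally show ?thesis
      unfolding measure_def set_lebesgue_integral_def
      by (simp add: integral_nonneg_AE)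
  qed
  also have "\<dots> = integral {a..b} std_normal_density"
    by (rule set_borel_integral_eq_integral(2)[OF int])
  finally show ?thesis .
qed

lemma Phi_deriv: "(Phi has_real_derivative std_normal_density x) (at x)"
proof -
  have "((\<lambda>y. integral {x - 1..y} std_normal_density) has_real_derivative std_normal_density x)
      (at x within {x - 1..x + 1})"
    by (rule integral_has_real_derivative)
       (auto simp: std_normal_density_def intro!: continuous_intros)
  then have "((\<lambda>y. integral {x - 1..y} std_normal_density) has_real_derivative std_normal_density x) (at x)"
    by (simp add: at_within_Icc_at)
  from DERIV_add[OF DERIV_const[of "Phi (x - 1)"] this]
  have "((\<lambda>y. Phi (x - 1) + integral {x - 1..y} std_normal_density)
      has_real_derivative std_normal_density x) (at x)"
    by simp
  then show ?thesis
  proof (rule has_field_derivative_transform_within_open[where S="{x - 1<..}"])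
    show "Phi (x - 1) + integral {x - 1..y} std_normal_density = Phi y" if "y \<in> {x - 1<..}" for y
      using Phi_diff[of "x - 1" y] that by auto
  qed auto
qed

lemma Phi_real_deriv[derivative_intros]:
  assumes "(f has_real_derivative f') (at x within A)"
  shows "((\<lambda>x. Phi (f x)) has_real_derivative (std_normal_density (f x) * f')) (at x within A)"
  by (rule DERIV_chain2[OF Phi_deriv assms])

lemma isCont_Phi: "isCont Phi x"
  by (rule DERIV_isCont[OF Phi_deriv])

lemma Phi_bounds: "0 \<le> Phi x" "Phi x \<le> 1"
  by (auto simp: Phi_def)

lemma Phi_at_top: "(Phi \<longlongrightarrow> 1) at_top"
proof -
  have "real_distribution (density lborel std_normal_density)"
    by (simp add: real_distribution_def real_distribution_axioms_def std_normal.prob_space_axioms)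
  from real_distribution.cdf_lim_at_top_prob[OF this] show ?thesis
    unfolding cdf_def Phi_def[abs_def] .
qed

lemma Phi_at_bot: "(Phi \<longlongrightarrow> 0) at_bot"
proof -
  have "real_distribution (density lborel std_normal_density)"
    by (simp add: real_distribution_def real_distribution_axioms_def std_normal.prob_space_axioms)
  then have "finite_borel_measure (density lborel std_normal_density)"
    by (simp add: real_distribution.finite_borel_measure_M)
  from finite_borel_measure.cdf_lim_at_bot[OF this] show ?thesis
    unfolding cdf_def Phi_def[abs_def] .
qed

text \<open>The sum \<open>Phi x + Phi (- x)\<close> has derivative 0 because the density is even;
  its constant value is read off at infinity.\<close>

lemma Phi_minus: "Phi (- x) = 1 - Phi x"
proof -
  have "((\<lambda>x. Phi x + Phi (- x)) has_real_derivative 0) (at x)" for x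
    by (auto intro!: derivative_eq_intros simp: std_normal_density_def)
  then have const: "Phi x + Phi (- x) = Phi y + Phi (- y)" for x y
    by (metis (no_types, lifting) DERIV_isconst_all)
  have "((\<lambda>y. Phi y + Phi (- y)) \<longlongrightarrow> 1 + 0) at_top"
    by (intro tendsto_add Phi_at_top filterlim_compose[OF Phi_at_bot filterlim_uminus_at_bot_at_top])
  moreover have "(\<lambda>y. Phi y + Phi (- y)) = (\<lambda>y. Phi x + Phi (- x))"
    using const by blast
  ultimately have "((\<lambda>y::real. Phi x + Phi (- x)) \<longlongrightarrow> 1) at_top" by simp
  then have "Phi x + Phi (- x) = 1"
    by (simp add: tendsto_const_iff)
  then show ?thesis by simp
qed

lemma Phi_0: "Phi 0 = 1 / 2"
  using Phi_minus[of 0] by simp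

section \<open>Gaussian density and distribution function with variance \<tau>\<close>

definition gauss :: "real \<Rightarrow> real \<Rightarrow> real" where
  "gauss \<tau> w = exp (- (w\<^sup>2 / (2 * \<tau>))) / sqrt (2 * pi * \<tau>)"

definition gauss_cdf :: "real \<Rightarrow> real \<Rightarrow> real" where
  "gauss_cdf \<tau> w = Phi (w / sqrt \<tau>)"

lemma gauss_nonneg: "0 < \<tau> \<Longrightarrow> 0 \<le> gauss \<tau> w"
  by (simp add: gauss_def)

lemma gauss_minus: "gauss \<tau> (- w) = gauss \<tau> w"
  by (simp add: gauss_def)

lemma gauss_cdf_minus: "gauss_cdf \<tau> (- w) = 1 - gauss_cdf \<tau> w"
  by (simp add: gauss_cdf_def Phi_minus)

lemma gauss_cdf_bounds: "0 \<le> gauss_cdf \<tau> w" "gauss_cdf \<tau> w \<le> 1"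
  by (simp_all add: gauss_cdf_def Phi_bounds)

text \<open>Variance and argument may both move, so that one formula covers the derivative in space
  and the derivative in time, where \<tau> occurs also in the shift of the argument.\<close>

lemma gauss_real_deriv:
  assumes "(v has_real_derivative v') (at r within S)" "(w has_real_derivative w') (at r within S)" "0 < v r"
  shows "((\<lambda>r. gauss (v r) (w r)) has_real_derivative
    gauss (v r) (w r) * (((w r)\<^sup>2 / v r - 1) / (2 * v r) * v' - w r / v r * w')) (at r within S)"
proof -
  have e: "((\<lambda>r. exp (- ((w r)\<^sup>2 / (2 * v r)))) has_real_derivative
      exp (- ((w r)\<^sup>2 / (2 * v r))) * - ((2 * w r * w' * (2 * v r) - (w r)\<^sup>2 * (2 * v')) / ((2 * v r) * (2 * v r))))
      (at r within S)"
    using assms by (auto intro!: derivative_eq_intros)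
  have q: "((\<lambda>r. sqrt (2 * pi * v r)) has_real_derivative 2 * pi * v' * (inverse (sqrt (2 * pi * v r)) / 2))
      (at r within S)"
    using assms by (auto intro!: derivative_eq_intros simp: mult_less_0_iff)
  define R where "R = sqrt (2 * pi * v r)"
  have R: "0 < R" "R * R = 2 * pi * v r" using assms(3) by (auto simp: R_def)
  define X where "X = exp (- ((w r)\<^sup>2 / (2 * v r)))"
  have dq: "2 * pi * v' * (inverse R / 2) = R * v' / (2 * v r)"
  proof -
    have "2 * pi * v' * (inverse R / 2) = (R * R / v r) * v' * (inverse R / 2)"
      unfolding R(2) using assms(3) by simp
    also have "\<dots> = R * v' / (2 * v r)" using R(1) by (simp add: field_simps)
    finally show ?thesis .
  qed
  have "((\<lambda>r. gauss (v r) (w r)) has_real_derivative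
    ((X * - ((2 * w r * w' * (2 * v r) - (w r)\<^sup>2 * (2 * v')) / ((2 * v r) * (2 * v r)))) * R
      - X * (R * v' / (2 * v r))) / (R * R)) (at r within S)"
    unfolding gauss_def
    using DERIV_divide[OF e q R(1)[unfolded R_def, THEN less_imp_neq, symmetric]]
    unfolding R_def[symmetric] X_def[symmetric] dq .
  also have "((X * - ((2 * w r * w' * (2 * v r) - (w r)\<^sup>2 * (2 * v')) / ((2 * v r) * (2 * v r)))) * R
      - X * (R * v' / (2 * v r))) / (R * R)
    = X / R * (((w r)\<^sup>2 / v r - 1) / (2 * v r) * v' - w r / v r * w')"
    using R(1) assms(3) by (simp add: field_simps power2_eq_square)
  finally show ?thesis by (simp add: gauss_def X_def R_def)
qed

lemma gauss_cdf_real_deriv: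
  assumes "(v has_real_derivative v') (at r within S)" "(w has_real_derivative w') (at r within S)" "0 < v r"
  shows "((\<lambda>r. gauss_cdf (v r) (w r)) has_real_derivative
    gauss (v r) (w r) * (w' - w r / (2 * v r) * v')) (at r within S)"
proof -
  define R where "R = sqrt (v r)"
  have R: "0 < R" "R * R = v r" using assms(3) by (auto simp: R_def)
  have q: "((\<lambda>r. sqrt (v r)) has_real_derivative v' * (inverse (sqrt (v r)) / 2)) (at r within S)"
    using assms by (auto intro!: derivative_eq_intros)
  have "((\<lambda>r. w r / sqrt (v r)) has_real_derivative
      (w' * R - w r * (v' * (inverse R / 2))) / (R * R)) (at r within S)"
    using DERIV_divide[OF assms(2) q] assms(3) by (simp add: R_def)
  from Phi_real_deriv[OF this]
  have "((\<lambda>r. gauss_cdf (v r) (w r)) has_real_derivative std_normal_density (w r / R) *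
      ((w' * R - w r * (v' * (inverse R / 2))) / (R * R))) (at r within S)"
    by (simp add: gauss_cdf_def R_def)
  also have "(w' * R - w r * (v' * (inverse R / 2))) / (R * R) = (w' - w r / (2 * v r) * v') / R"
    unfolding R(2)[symmetric] using R(1) by (simp add: field_simps)
  also have "std_normal_density (w r / R) * ((w' - w r / (2 * v r) * v') / R)
      = gauss (v r) (w r) * (w' - w r / (2 * v r) * v')"
  proof -
    have "sqrt (2 * pi * v r) = sqrt (2 * pi) * R" by (simp add: R_def real_sqrt_mult)
    moreover have "(w r / R)\<^sup>2 = (w r)\<^sup>2 / v r" using R(2) by (simp add: power_divide power2_eq_square)
    ultimately show ?thesis by (simp add: gauss_def std_normal_density_def)
  qed
  finally show ?thesis .
qed


lemma gauss_deriv: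
  assumes "0 < \<tau>" shows "(gauss \<tau> has_real_derivative - (w / \<tau>) * gauss \<tau> w) (at w)"
  using gauss_real_deriv[where v="\<lambda>_. \<tau>" and w="\<lambda>w. w" and r=w, OF DERIV_const DERIV_ident assms]
  by (simp add: mult.commute)

lemma gauss_cdf_deriv:
  assumes "0 < \<tau>" shows "(gauss_cdf \<tau> has_real_derivative gauss \<tau> w) (at w)"
  using gauss_cdf_real_deriv[where v="\<lambda>_. \<tau>" and w="\<lambda>w. w" and r=w, OF DERIV_const DERIV_ident assms]
  by simp

lemma continuous_on_gauss [continuous_intros]:
  assumes "continuous_on S v" "continuous_on S w" "\<And>x. x \<in> S \<Longrightarrow> 0 < v x"
  shows "continuous_on S (\<lambda>x. gauss (v x) (w x))"
proof -
  have "2 * v x \<noteq> 0" "sqrt (2 * pi * v x) \<noteq> 0" if "x \<in> S" for x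
    using assms(3)[OF that] by auto
  then show ?thesis
    unfolding gauss_def by (intro continuous_intros assms(1,2)) blast+
qed

lemma continuous_on_gauss_cdf [continuous_intros]:
  assumes "continuous_on S v" "continuous_on S w" "\<And>x. x \<in> S \<Longrightarrow> 0 < v x"
  shows "continuous_on S (\<lambda>x. gauss_cdf (v x) (w x))"
proof -
  have "continuous_on UNIV Phi" using isCont_Phi by (simp add: continuous_at_imp_continuous_on)
  moreover have "sqrt (v x) \<noteq> 0" if "x \<in> S" for x
    using assms(3)[OF that] by simp
  then have "continuous_on S (\<lambda>x. w x / sqrt (v x))"
    by (intro continuous_intros assms(1,2)) blast
  ultimately show ?thesis
    unfolding gauss_cdf_def by (rule continuous_on_compose2) auto
qed

text \<open>With x = w^2/(2\<tau>) this rests on x exp(-x) \<le> 1. The weight absorbs the linear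
  and quadratic factors produced by differentiation, uniformly for \<tau> away from 0.\<close>

lemma weighted_gauss_le:
  assumes "0 < T1" "T1 \<le> \<tau>" "\<tau> \<le> T2"
  shows "(1 + w\<^sup>2) * gauss \<tau> w \<le> (1 + 2 * T2) / sqrt (2 * pi * T1)"
proof -
  have "0 < \<tau>" using assms by simp
  define x where "x = w\<^sup>2 / (2 * \<tau>)"
  have x: "0 \<le> x" "w\<^sup>2 = 2 * \<tau> * x" using \<open>0 < \<tau>\<close> by (auto simp: x_def)
  have "x * exp (- x) \<le> 1"
    using order_trans[OF _ exp_ge_add_one_self, of x x] by (simp add: exp_minus field_simps)
  moreover have "exp (- x) \<le> 1" using x by simp
  ultimately have "exp (- x) + 2 * \<tau> * (x * exp (- x)) \<le> 1 + 2 * \<tau> * 1"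
    using \<open>0 < \<tau>\<close> by (intro add_mono mult_left_mono) auto
  then have "(1 + w\<^sup>2) * exp (- x) \<le> 1 + 2 * T2"
    using assms by (simp add: x(2) algebra_simps)
  moreover have "sqrt (2 * pi * T1) \<le> sqrt (2 * pi * \<tau>)" using assms by simp
  ultimately have "(1 + w\<^sup>2) * exp (- x) / sqrt (2 * pi * \<tau>) \<le> (1 + 2 * T2) / sqrt (2 * pi * T1)"
    using assms by (intro frac_le) auto
  then show ?thesis by (simp add: gauss_def x_def)
qed

section \<open>Differentiation through the kink of |w|\<close>

lemma deriv_zero_factor:
  assumes "((f::real \<Rightarrow> real) has_real_derivative l) (at 0)" "f 0 = 0"
  obtains q where "\<And>a. f a = q a * a" "isCont q 0" "q 0 = l"
  using assms by (metis CARAT_DERIV diff_zero)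

lemma DERIV_abs_nonzero:
  fixes w :: real
  assumes "w \<noteq> 0"
  shows "((\<lambda>w. \<bar>w\<bar>) has_real_derivative sgn w) (at w)"
proof (cases "0 < w")
  case True
  have "((\<lambda>w. \<bar>w\<bar>) has_real_derivative 1) (at w)"
    by (rule has_field_derivative_transform_within_open[OF DERIV_ident open_greaterThan[of 0]])
       (use True in auto)
  then show ?thesis using True by simp
next
  case False
  have "((\<lambda>w. \<bar>w\<bar>) has_real_derivative - 1) (at w)"
    by (rule has_field_derivative_transform_within_open[OF DERIV_minus[OF DERIV_ident] open_lessThan[of 0]])
       (use False assms in auto)
  then show ?thesis using False assms by simp
qed

text \<open>At 0 the Caratheodory slope of \<open>k \<bar>w\<bar>\<close> is
  \<open>q \<bar>w\<bar> * sgn w\<close>; the jump of \<open>sgn\<close> is harmless because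
  \<open>q\<close> tends to \<open>k' 0 = 0\<close>.\<close>

lemma DERIV_even_extension:
  fixes k k' :: "real \<Rightarrow> real"
  assumes k: "\<And>a. (k has_real_derivative k' a) (at a)" and "k' 0 = 0"
  shows "((\<lambda>w. k \<bar>w\<bar>) has_real_derivative sgn w * k' \<bar>w\<bar>) (at w)"
proof (cases "w = 0")
  case False
  have "((\<lambda>w. k \<bar>w\<bar>) has_real_derivative k' \<bar>w\<bar> * sgn w) (at w)"
    by (rule DERIV_chain2[OF k]) (rule DERIV_abs_nonzero[OF False])
  then show ?thesis by (simp add: mult.commute)
next
  case True
  have "((\<lambda>a. k a - k 0) has_real_derivative 0) (at 0)"
    using DERIV_diff[OF k[of 0] DERIV_const[of "k 0"]] assms(2) by simp
  then obtain q where q: "\<And>a. k a - k 0 = q a * a" "isCont q 0" "q 0 = 0"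
    by (rule deriv_zero_factor) auto
  have "isCont (\<lambda>w. q \<bar>w\<bar>) 0"
    using isCont_o2[where f="\<lambda>w. \<bar>w\<bar>" and a=0 and g=q] q(2) by simp
  then have "((\<lambda>w. \<bar>q \<bar>w\<bar>\<bar>) \<longlongrightarrow> 0) (at 0)"
    using q(3) by (auto simp: isCont_def intro: tendsto_rabs_zero)
  then have "((\<lambda>w. q \<bar>w\<bar> * sgn w) \<longlongrightarrow> 0) (at 0)"
    by (rule Lim_null_comparison[rotated]) (auto simp: abs_mult abs_sgn_eq eventually_at intro!: exI[of _ 1])
  then have "isCont (\<lambda>w. q \<bar>w\<bar> * sgn w) 0" by (simp add: isCont_def)
  moreover have "k \<bar>w\<bar> - k \<bar>0\<bar> = q \<bar>w\<bar> * sgn w * (w - 0)" for w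
    using q(1)[of "\<bar>w\<bar>"] by (simp add: sgn_if abs_if)
  ultimately have "((\<lambda>w. k \<bar>w\<bar>) has_real_derivative 0) (at 0)"
    unfolding CARAT_DERIV by (intro exI[of _ "\<lambda>w. q \<bar>w\<bar> * sgn w"]) auto
  then show ?thesis using True by simp
qed

text \<open>The factor \<open>w\<close> removes the kink: at 0 the slope is
  \<open>m \<bar>w\<bar>\<close> itself, which is continuous. This is what makes the kernel twice
  differentiable at its centre.\<close>

lemma DERIV_odd_extension:
  fixes m m' :: "real \<Rightarrow> real"
  assumes m: "\<And>a. (m has_real_derivative m' a) (at a)"
  shows "((\<lambda>w. w * m \<bar>w\<bar>) has_real_derivative m \<bar>w\<bar> + \<bar>w\<bar> * m' \<bar>w\<bar>) (at w)"
proof (cases "w = 0")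
  case False
  have "((\<lambda>w. m \<bar>w\<bar>) has_real_derivative m' \<bar>w\<bar> * sgn w) (at w)"
    by (rule DERIV_chain2[OF m]) (rule DERIV_abs_nonzero[OF False])
  from DERIV_mult[OF DERIV_ident this] show ?thesis
  proof (rule DERIV_cong)
    show "1 * m \<bar>w\<bar> + m' \<bar>w\<bar> * sgn w * w = m \<bar>w\<bar> + \<bar>w\<bar> * m' \<bar>w\<bar>"
      by (simp add: sgn_if abs_if)
  qed
next
  case True
  have "isCont (\<lambda>w. m \<bar>w\<bar>) 0"
    using isCont_o2[where f="\<lambda>w. \<bar>w\<bar>" and a=0 and g=m] DERIV_isCont[OF m] by simp
  then have "((\<lambda>w. w * m \<bar>w\<bar>) has_real_derivative m 0) (at 0)"
    unfolding CARAT_DERIV by (intro exI[of _ "\<lambda>w. m \<bar>w\<bar>"]) auto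
  then show ?thesis using True by simp
qed

text \<open>Turns a primitive of the right half of an even function, normalised at 0, into a
  primitive on the whole line; used for the mass of the kernel.\<close>

lemma DERIV_sgn_extension:
  fixes k k' :: "real \<Rightarrow> real"
  assumes k: "\<And>a. (k has_real_derivative k' a) (at a)" and "k 0 = 0"
  shows "((\<lambda>w. sgn w * k \<bar>w\<bar>) has_real_derivative k' \<bar>w\<bar>) (at w)"
proof (cases "w = 0")
  case False
  have "((\<lambda>w. k \<bar>w\<bar>) has_real_derivative k' \<bar>w\<bar> * sgn w) (at w)"
    by (rule DERIV_chain2[OF k]) (rule DERIV_abs_nonzero[OF False])
  from DERIV_cmult[OF this, of "sgn w"]
  have "((\<lambda>v. sgn w * k \<bar>v\<bar>) has_real_derivative k' \<bar>w\<bar>) (at w)"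
    by (rule DERIV_cong) (use False in \<open>simp add: sgn_if\<close>)
  then show ?thesis
    by (rule has_field_derivative_transform_within[where d="\<bar>w\<bar>"])
       (use False in \<open>auto simp: dist_real_def sgn_if abs_if split: if_splits\<close>)
next
  case True
  obtain q where q: "\<And>a. k a = q a * a" "isCont q 0" "q 0 = k' 0"
    using deriv_zero_factor[OF k assms(2)] by metis
  have "isCont (\<lambda>w. q \<bar>w\<bar>) 0"
    using isCont_o2[where f="\<lambda>w. \<bar>w\<bar>" and a=0 and g=q] q(2) by simp
  moreover have "sgn w * k \<bar>w\<bar> = q \<bar>w\<bar> * w" for w
    using q(1)[of "\<bar>w\<bar>"] by (simp add: sgn_if abs_if)
  ultimately have "((\<lambda>w. sgn w * k \<bar>w\<bar>) has_real_derivative k' 0) (at 0)"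
    unfolding CARAT_DERIV using q(3) by (intro exI[of _ "\<lambda>w. q \<bar>w\<bar>"]) auto
  then show ?thesis using True by simp
qed

section \<open>The diffusion with drift towards or away from a point\<close>

text \<open>
  Closed form of the integral that defines \<open>p\<^sub>y\<^sup>\<beta>(x, \<tau>, y)\<close> for \<open>w = x - y\<close>. The suffixes \<open>_x\<close>, \<open>_xx\<close>
  and \<open>_t\<close> denote the derivatives in \<open>w\<close> and in \<open>\<tau>\<close>.
\<close>

definition sgn_kernel :: "real \<Rightarrow> real \<Rightarrow> real \<Rightarrow> real" where
  "sgn_kernel \<beta> \<tau> w = gauss \<tau> (\<bar>w\<bar> - \<beta> * \<tau>) + \<beta> * gauss_cdf \<tau> (\<beta> * \<tau> - \<bar>w\<bar>)"

definition sgn_kernel_x :: "real \<Rightarrow> real \<Rightarrow> real \<Rightarrow> real" where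
  "sgn_kernel_x \<beta> \<tau> w = - (w / \<tau>) * gauss \<tau> (\<bar>w\<bar> - \<beta> * \<tau>)"

definition sgn_kernel_xx :: "real \<Rightarrow> real \<Rightarrow> real \<Rightarrow> real" where
  "sgn_kernel_xx \<beta> \<tau> w =
    - (1 / \<tau>) * gauss \<tau> (\<bar>w\<bar> - \<beta> * \<tau>) * (1 - \<bar>w\<bar> * (\<bar>w\<bar> - \<beta> * \<tau>) / \<tau>)"

definition sgn_kernel_t :: "real \<Rightarrow> real \<Rightarrow> real \<Rightarrow> real" where
  "sgn_kernel_t \<beta> \<tau> w = sgn_kernel_xx \<beta> \<tau> w / 2 + \<beta> * (\<bar>w\<bar> / \<tau>) * gauss \<tau> (\<bar>w\<bar> - \<beta> * \<tau>)"

section \<open>Derivatives and bounds of the closed form\<close>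

lemma gauss_flip: "gauss \<tau> (b - a) = gauss \<tau> (a - b)"
  using gauss_minus[of \<tau> "a - b"] by simp

text \<open>The distribution term contributes \<open>- b\<close> times the Gaussian, which cancels
  the shift in \<open>(a - b * \<tau>) / \<tau>\<close>. The factor \<open>a\<close> that remains
  vanishes at 0, so the even extension is differentiable there.\<close>

lemma half_kernel_deriv:
  assumes "0 < \<tau>"
  shows "((\<lambda>a. gauss \<tau> (a - b * \<tau>) + b * gauss_cdf \<tau> (b * \<tau> - a)) has_real_derivative
    - (a / \<tau>) * gauss \<tau> (a - b * \<tau>)) (at a)"
proof -
  have 1: "((\<lambda>a. gauss \<tau> (a - b * \<tau>)) has_real_derivative
      - ((a - b * \<tau>) / \<tau>) * gauss \<tau> (a - b * \<tau>) * (1 - 0)) (at a)"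
    by (rule DERIV_chain2[OF gauss_deriv[OF assms] DERIV_diff[OF DERIV_ident DERIV_const]])
  have 2: "((\<lambda>a. gauss_cdf \<tau> (b * \<tau> - a)) has_real_derivative
      gauss \<tau> (b * \<tau> - a) * (0 - 1)) (at a)"
    by (rule DERIV_chain2[OF gauss_cdf_deriv[OF assms] DERIV_diff[OF DERIV_const DERIV_ident]])
  define x where "x = a - b * \<tau>"
  have a: "a = x + b * \<tau>" by (simp add: x_def)
  show ?thesis
  proof (rule DERIV_cong[OF DERIV_add[OF 1 DERIV_cmult[OF 2]]])
    show "- ((a - b * \<tau>) / \<tau>) * gauss \<tau> (a - b * \<tau>) * (1 - 0) + b * (gauss \<tau> (b * \<tau> - a) * (0 - 1))
      = - (a / \<tau>) * gauss \<tau> (a - b * \<tau>)"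
      unfolding gauss_flip[of \<tau> "b * \<tau>"] x_def[symmetric]
      unfolding a using assms by (simp add: field_simps)
  qed
qed

lemma sgn_kernel_deriv_x:
  assumes "0 < \<tau>"
  shows "(sgn_kernel b \<tau> has_real_derivative sgn_kernel_x b \<tau> w) (at w)"
proof -
  have "((\<lambda>w. gauss \<tau> (\<bar>w\<bar> - b * \<tau>) + b * gauss_cdf \<tau> (b * \<tau> - \<bar>w\<bar>)) has_real_derivative
      sgn w * (- (\<bar>w\<bar> / \<tau>) * gauss \<tau> (\<bar>w\<bar> - b * \<tau>))) (at w)"
    by (rule DERIV_even_extension[OF half_kernel_deriv[OF assms]]) simp
  then show ?thesis
    unfolding sgn_kernel_def[abs_def]
    by (rule DERIV_cong) (simp add: sgn_kernel_x_def sgn_if abs_if)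
qed

lemma sgn_kernel_deriv_xx:
  assumes "0 < \<tau>"
  shows "(sgn_kernel_x b \<tau> has_real_derivative sgn_kernel_xx b \<tau> w) (at w)"
proof -
  have m: "((\<lambda>a. - (1 / \<tau>) * gauss \<tau> (a - b * \<tau>)) has_real_derivative
      - (1 / \<tau>) * (- ((a - b * \<tau>) / \<tau>) * gauss \<tau> (a - b * \<tau>) * (1 - 0))) (at a)" for a
    by (rule DERIV_cmult[OF DERIV_chain2[OF gauss_deriv[OF assms] DERIV_diff[OF DERIV_ident DERIV_const]]])
  have eq: "sgn_kernel_x b \<tau> = (\<lambda>w. w * (- (1 / \<tau>) * gauss \<tau> (\<bar>w\<bar> - b * \<tau>)))"
    by (simp add: sgn_kernel_x_def fun_eq_iff)
  show ?thesis
    unfolding eq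
  proof (rule DERIV_cong[OF DERIV_odd_extension[OF m]])
    define x where "x = \<bar>w\<bar> - b * \<tau>"
    show "- (1 / \<tau>) * gauss \<tau> (\<bar>w\<bar> - b * \<tau>)
        + \<bar>w\<bar> * (- (1 / \<tau>) * (- ((\<bar>w\<bar> - b * \<tau>) / \<tau>) * gauss \<tau> (\<bar>w\<bar> - b * \<tau>) * (1 - 0)))
      = sgn_kernel_xx b \<tau> w"
      unfolding sgn_kernel_xx_def x_def[symmetric] using assms by (simp add: field_simps)
  qed
qed

text \<open>\<open>sgn_kernel_t\<close> is the right side of the backward equation: half the second
  derivative minus \<open>b * sgn w\<close> times the first. Recognising it as the time derivative
  therefore proves that equation.\<close>

lemma sgn_kernel_deriv_t:
  assumes "0 < \<tau>"
  shows "((\<lambda>\<tau>. sgn_kernel b \<tau> w) has_real_derivative sgn_kernel_t b \<tau> w) (at \<tau>)"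
proof -
  define a where "a = \<bar>w\<bar>"
  define x where "x = a - b * \<tau>"
  have a: "a = x + b * \<tau>" by (simp add: x_def)
  have "((\<lambda>\<tau>. a - b * \<tau>) has_real_derivative 0 - b * 1) (at \<tau>)"
    by (intro DERIV_diff DERIV_const DERIV_cmult DERIV_ident)
  note 1 = gauss_real_deriv[OF DERIV_ident this assms]
  have "((\<lambda>\<tau>. b * \<tau> - a) has_real_derivative b * 1 - 0) (at \<tau>)"
    by (intro DERIV_diff DERIV_const DERIV_cmult DERIV_ident)
  note 2 = gauss_cdf_real_deriv[OF DERIV_ident this assms]
  have "((\<lambda>\<tau>. gauss \<tau> (a - b * \<tau>) + b * gauss_cdf \<tau> (b * \<tau> - a)) has_real_derivative
      gauss \<tau> (a - b * \<tau>) * (((a - b * \<tau>)\<^sup>2 / \<tau> - 1) / (2 * \<tau>) * 1 - (a - b * \<tau>) / \<tau> * (0 - b * 1))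
      + b * (gauss \<tau> (b * \<tau> - a) * (b * 1 - 0 - (b * \<tau> - a) / (2 * \<tau>) * 1))) (at \<tau>)"
    by (rule DERIV_add[OF 1 DERIV_cmult[OF 2]])
  moreover have "gauss \<tau> (a - b * \<tau>) * (((a - b * \<tau>)\<^sup>2 / \<tau> - 1) / (2 * \<tau>) * 1 - (a - b * \<tau>) / \<tau> * (0 - b * 1))
      + b * (gauss \<tau> (b * \<tau> - a) * (b * 1 - 0 - (b * \<tau> - a) / (2 * \<tau>) * 1))
    = sgn_kernel_t b \<tau> w"
    unfolding sgn_kernel_t_def sgn_kernel_xx_def gauss_flip[of \<tau> "b * \<tau>"] a_def[symmetric]
      x_def[symmetric] minus_diff_eq[symmetric, of "b * \<tau>" a]
    unfolding a using assms by (simp add: field_simps power2_eq_square gauss_minus)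
  ultimately show ?thesis
    unfolding sgn_kernel_def a_def by (simp add: DERIV_cong)
qed

text \<open>Running time backwards keeps \<tau> = T - r between T - t > 0 and T - s, away from the
  singularity at 0. There the Gaussian in x = |w| - b\<tau> beats the polynomial factors in
  \<open>w\<close>.\<close>

lemma smooth_bounded_sgn_kernel:
  assumes "s \<le> t" "t < T"
  obtains U where "smooth_bounded s t U (\<lambda>r z. sgn_kernel b (T - r) (z - y))
    (\<lambda>r z. - sgn_kernel_t b (T - r) (z - y)) (\<lambda>r z. sgn_kernel_x b (T - r) (z - y))
    (\<lambda>r z. sgn_kernel_xx b (T - r) (z - y))"
proof -
  define T1 where "T1 = T - t"
  define T2 where "T2 = T - s"
  have T: "0 < T1" "T1 \<le> T2" using assms by (auto simp: T1_def T2_def)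
  define c where "c = (1 + 2 * T2) / sqrt (2 * pi * T1)"
  have c: "0 \<le> c" using T by (auto simp: c_def)
  \<comment> \<open>|w| exceeds |x| by at most |b| T2, so that \<open>d * (1 + x\<^sup>2)\<close>
    dominates both |w| and |w| |x|.\<close>
  define d where "d = 1 + \<bar>b\<bar> * T2"
  have d: "1 \<le> d" using T by (simp add: d_def)
  define U where "U = (c + \<bar>b\<bar>) + d * c / T1 + (1 + d / T1) * c / T1"
  have parts: "0 \<le> c + \<bar>b\<bar>" "0 \<le> d * c / T1" "0 \<le> (1 + d / T1) * c / T1"
    using c d T by (auto intro!: divide_nonneg_pos mult_nonneg_nonneg add_nonneg_nonneg)
  have bounds: "\<bar>sgn_kernel b \<tau> w\<bar> \<le> U \<and> \<bar>sgn_kernel_x b \<tau> w\<bar> \<le> U \<and> \<bar>sgn_kernel_xx b \<tau> w\<bar> \<le> U"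
    if \<tau>: "T1 \<le> \<tau>" "\<tau> \<le> T2" for \<tau> w
  proof -
    define x where "x = \<bar>w\<bar> - b * \<tau>"
    define G where "G = gauss \<tau> x"
    have \<tau>0: "0 < \<tau>" using \<tau> T by simp
    have G: "0 \<le> G" "(1 + x\<^sup>2) * G \<le> c"
      using gauss_nonneg[OF \<tau>0] weighted_gauss_le[OF T(1) \<tau>] by (auto simp: G_def c_def)
    have G1: "G \<le> (1 + x\<^sup>2) * G" using G by (simp add: distrib_right)
    have "\<bar>b\<bar> * \<tau> \<le> \<bar>b\<bar> * T2" using \<tau> by (intro mult_left_mono) auto
    then have "\<bar>b * \<tau>\<bar> \<le> \<bar>b\<bar> * T2" using \<tau>0 by (simp add: abs_mult)
    then have w: "\<bar>w\<bar> \<le> \<bar>x\<bar> + \<bar>b\<bar> * T2" by (simp add: x_def)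
    have x1: "2 * \<bar>x\<bar> \<le> 1 + x\<^sup>2"
      using zero_le_power2[of "\<bar>x\<bar> - 1"] by (simp add: power2_diff)
    have bT: "0 \<le> \<bar>b\<bar> * T2" using T by simp
    have wd: "\<bar>w\<bar> \<le> d * (1 + x\<^sup>2)"
    proof -
      have "\<bar>b\<bar> * T2 * 1 \<le> \<bar>b\<bar> * T2 * (1 + x\<^sup>2)" using bT by (intro mult_left_mono) auto
      then show ?thesis using w x1 unfolding d_def distrib_right by simp
    qed
    have wxd: "\<bar>w\<bar> * \<bar>x\<bar> \<le> d * (1 + x\<^sup>2)"
    proof -
      have "\<bar>w\<bar> * \<bar>x\<bar> \<le> (\<bar>x\<bar> + \<bar>b\<bar> * T2) * \<bar>x\<bar>" using w by (intro mult_right_mono) auto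
      also have "\<dots> = x\<^sup>2 + \<bar>b\<bar> * T2 * \<bar>x\<bar>" by (simp add: power2_eq_square distrib_right)
      also have "\<bar>b\<bar> * T2 * \<bar>x\<bar> \<le> \<bar>b\<bar> * T2 * (1 + x\<^sup>2)" using bT x1 by (intro mult_left_mono) auto
      finally show ?thesis unfolding d_def distrib_right by simp
    qed
    have dG: "d * (1 + x\<^sup>2) * G \<le> d * c"
      using mult_left_mono[OF G(2), of d] d by (simp add: mult.assoc)
    have "\<bar>sgn_kernel b \<tau> w\<bar> \<le> G + \<bar>b\<bar> * gauss_cdf \<tau> (b * \<tau> - \<bar>w\<bar>)"
      unfolding sgn_kernel_def x_def[symmetric] G_def[symmetric]
      using abs_triangle_ineq[of G "b * gauss_cdf \<tau> (b * \<tau> - \<bar>w\<bar>)"] G gauss_cdf_bounds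
      by (simp add: abs_mult)
    also have "\<dots> \<le> c + \<bar>b\<bar> * 1"
      using G G1 gauss_cdf_bounds by (intro add_mono mult_left_mono) auto
    finally have 1: "\<bar>sgn_kernel b \<tau> w\<bar> \<le> U" using parts by (simp add: U_def)
    have "\<bar>sgn_kernel_x b \<tau> w\<bar> = \<bar>w\<bar> * G / \<tau>"
      unfolding sgn_kernel_x_def x_def[symmetric] G_def[symmetric]
      using G \<tau>0 by (simp add: abs_mult)
    also have "\<dots> \<le> d * c / T1"
    proof (rule frac_le)
      show "\<bar>w\<bar> * G \<le> d * c" using mult_right_mono[OF wd G(1)] dG by linarith
    qed (use c d T \<tau> in auto)
    finally have 2: "\<bar>sgn_kernel_x b \<tau> w\<bar> \<le> U" using parts by (simp add: U_def)
    have "\<bar>sgn_kernel_xx b \<tau> w\<bar> = G * \<bar>1 - \<bar>w\<bar> * x / \<tau>\<bar> / \<tau>"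
      unfolding sgn_kernel_xx_def x_def[symmetric] G_def[symmetric]
      using G \<tau>0 by (simp add: abs_mult)
    also have "\<dots> \<le> (1 + d / T1) * c / T1"
    proof (rule frac_le)
      have "\<bar>1 - \<bar>w\<bar> * x / \<tau>\<bar> \<le> 1 + \<bar>w\<bar> * \<bar>x\<bar> / \<tau>"
        using abs_triangle_ineq4[of 1 "\<bar>w\<bar> * x / \<tau>"] \<tau>0 by (simp add: abs_mult)
      also have "\<dots> \<le> 1 + d * (1 + x\<^sup>2) / T1"
        using wxd T \<tau> d by (intro add_left_mono frac_le) auto
      finally have "G * \<bar>1 - \<bar>w\<bar> * x / \<tau>\<bar> \<le> G * (1 + d * (1 + x\<^sup>2) / T1)"
        using G by (intro mult_left_mono) auto
      also have "\<dots> = G + d * (1 + x\<^sup>2) * G / T1" by (simp add: algebra_simps)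
      also have "\<dots> \<le> c + d * c / T1"
        using G G1 dG T by (intro add_mono divide_right_mono) auto
      finally show "G * \<bar>1 - \<bar>w\<bar> * x / \<tau>\<bar> \<le> (1 + d / T1) * c" by (simp add: algebra_simps)
    qed (use c d T \<tau> in \<open>auto intro!: mult_nonneg_nonneg add_nonneg_nonneg\<close>)
    finally have 3: "\<bar>sgn_kernel_xx b \<tau> w\<bar> \<le> U" using parts by (simp add: U_def)
    show ?thesis using 1 2 3 by blast
  qed
  have pos: "0 < T - r" if "r \<in> {s..t}" for r using that assms by simp
  have cont_xx: "continuous_on ({s..t} \<times> UNIV) (\<lambda>(r, z). sgn_kernel_xx b (T - r) (z - y))"
    unfolding sgn_kernel_xx_def case_prod_beta'
    by (intro continuous_intros) (use assms in \<open>auto simp: mem_Times_iff\<close>)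
  have cont_t: "continuous_on ({s..t} \<times> UNIV) (\<lambda>(r, z). - sgn_kernel_t b (T - r) (z - y))"
    using cont_xx unfolding sgn_kernel_t_def case_prod_beta'
    by (intro continuous_intros) (use assms in \<open>auto simp: mem_Times_iff\<close>)
  show ?thesis
  proof (rule that[of U], unfold smooth_bounded_def, intro conjI ballI allI cont_xx cont_t)
    fix r z assume r: "r \<in> {s..t}"
    note p = pos[OF r]
    have "((\<lambda>r. sgn_kernel b (T - r) (z - y)) has_real_derivative
        sgn_kernel_t b (T - r) (z - y) * (0 - 1)) (at r)"
      by (rule DERIV_chain2[OF sgn_kernel_deriv_t[OF p] DERIV_diff[OF DERIV_const DERIV_ident]])
    then show "((\<lambda>r. sgn_kernel b (T - r) (z - y)) has_real_derivative
        - sgn_kernel_t b (T - r) (z - y)) (at r)" by simp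
    have sh: "((\<lambda>z. z - y) has_real_derivative 1 - 0) (at z)"
      by (rule DERIV_diff[OF DERIV_ident DERIV_const])
    show "((\<lambda>z. sgn_kernel b (T - r) (z - y)) has_real_derivative sgn_kernel_x b (T - r) (z - y)) (at z)"
      using DERIV_chain2[OF sgn_kernel_deriv_x[OF p] sh] by simp
    show "((\<lambda>z. sgn_kernel_x b (T - r) (z - y)) has_real_derivative sgn_kernel_xx b (T - r) (z - y)) (at z)"
      using DERIV_chain2[OF sgn_kernel_deriv_xx[OF p] sh] by simp
    have "T1 \<le> T - r" "T - r \<le> T2" using r by (auto simp: T1_def T2_def)
    from bounds[OF this, of "z - y"] show "\<bar>sgn_kernel b (T - r) (z - y)\<bar> \<le> U"
      "\<bar>sgn_kernel_x b (T - r) (z - y)\<bar> \<le> U" "\<bar>sgn_kernel_xx b (T - r) (z - y)\<bar> \<le> U" by auto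
  qed
qed

text \<open>The shift \<open>b * \<epsilon>\<close> is of smaller order than the width
  \<open>sqrt \<epsilon>\<close>, so all limits agree with those of the driftless Gaussian.\<close>

lemma gauss_limits_at_right_0:
  fixes b \<delta> :: real
  assumes "0 < \<delta>"
  shows "((\<lambda>\<epsilon>. gauss \<epsilon> (\<delta> - b * \<epsilon>)) \<longlongrightarrow> 0) (at_right 0)"
    "((\<lambda>\<epsilon>. gauss_cdf \<epsilon> (b * \<epsilon> - \<delta>)) \<longlongrightarrow> 0) (at_right 0)"
    "((\<lambda>\<epsilon>. gauss_cdf \<epsilon> (\<delta> - b * \<epsilon>)) \<longlongrightarrow> 1) (at_right 0)"
    "((\<lambda>\<epsilon>. gauss_cdf \<epsilon> (b * \<epsilon>)) \<longlongrightarrow> 1 / 2) (at_right 0)"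
    "((\<lambda>\<epsilon>. \<epsilon> * gauss \<epsilon> (b * \<epsilon>)) \<longlongrightarrow> 0) (at_right 0)"
proof -
  show "((\<lambda>\<epsilon>. gauss \<epsilon> (\<delta> - b * \<epsilon>)) \<longlongrightarrow> 0) (at_right 0)"
    unfolding gauss_def using assms by real_asymp
  have *: "filterlim (\<lambda>\<epsilon>. (b * \<epsilon> - \<delta>) / sqrt \<epsilon>) at_bot (at_right 0)"
    using assms by real_asymp
  show 2: "((\<lambda>\<epsilon>. gauss_cdf \<epsilon> (b * \<epsilon> - \<delta>)) \<longlongrightarrow> 0) (at_right 0)"
    unfolding gauss_cdf_def by (rule filterlim_compose[OF Phi_at_bot *])
  have "((\<lambda>\<epsilon>. 1 - gauss_cdf \<epsilon> (b * \<epsilon> - \<delta>)) \<longlongrightarrow> 1 - 0) (at_right 0)"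
    by (intro tendsto_intros 2)
  then show "((\<lambda>\<epsilon>. gauss_cdf \<epsilon> (\<delta> - b * \<epsilon>)) \<longlongrightarrow> 1) (at_right 0)"
    by (simp add: gauss_cdf_minus[symmetric])
  have "((\<lambda>\<epsilon>. b * \<epsilon> / sqrt \<epsilon>) \<longlongrightarrow> 0) (at_right 0)"
    by real_asymp
  from isCont_tendsto_compose[OF isCont_Phi this]
  show "((\<lambda>\<epsilon>. gauss_cdf \<epsilon> (b * \<epsilon>)) \<longlongrightarrow> 1 / 2) (at_right 0)"
    by (simp add: gauss_cdf_def Phi_0)
  show "((\<lambda>\<epsilon>. \<epsilon> * gauss \<epsilon> (b * \<epsilon>)) \<longlongrightarrow> 0) (at_right 0)"
  proof (rule Lim_null_comparison)
    show "((\<lambda>\<epsilon>::real. \<epsilon> / sqrt (2 * pi * \<epsilon>)) \<longlongrightarrow> 0) (at_right 0)" by real_asymp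
    show "\<forall>\<^sub>F \<epsilon> in at_right 0. norm (\<epsilon> * gauss \<epsilon> (b * \<epsilon>)) \<le> \<epsilon> / sqrt (2 * pi * \<epsilon>)"
      using eventually_at_right_less[of 0]
    proof eventually_elim
      case (elim \<epsilon>)
      have "gauss \<epsilon> (b * \<epsilon>) \<le> 1 / sqrt (2 * pi * \<epsilon>)"
        unfolding gauss_def using elim by (intro divide_right_mono) auto
      from mult_left_mono[OF this, of \<epsilon>] show ?case
        using elim gauss_nonneg[of \<epsilon>] by simp
    qed
  qed
qed

section \<open>Monotonicity, positivity and integral form of the kernel\<close>

lemma sgn_kernel_abs: "sgn_kernel b \<tau> \<bar>w\<bar> = sgn_kernel b \<tau> w"
  by (simp add: sgn_kernel_def)

lemma sgn_kernel_minus: "sgn_kernel b \<tau> (- w) = sgn_kernel b \<tau> w"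
  by (simp add: sgn_kernel_def)

lemma sgn_kernel_antimono:
  assumes \<tau>: "0 < \<tau>" and "\<bar>v\<bar> \<le> \<bar>w\<bar>"
  shows "sgn_kernel b \<tau> w \<le> sgn_kernel b \<tau> v"
proof -
  have "sgn_kernel b \<tau> \<bar>w\<bar> \<le> sgn_kernel b \<tau> \<bar>v\<bar>"
  proof (rule DERIV_nonpos_imp_nonincreasing[OF assms(2)])
    fix x assume "\<bar>v\<bar> \<le> x" "x \<le> \<bar>w\<bar>"
    then have "sgn_kernel_x b \<tau> x \<le> 0"
      using \<tau> gauss_nonneg[OF \<tau>] by (auto simp: sgn_kernel_x_def intro!: divide_nonneg_pos mult_nonneg_nonneg)
    then show "\<exists>y. (sgn_kernel b \<tau> has_real_derivative y) (at x) \<and> y \<le> 0"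
      using sgn_kernel_deriv_x[OF \<tau>] by blast
  qed
  then show ?thesis by (simp add: sgn_kernel_abs)
qed

text \<open>For negative \<open>b\<close> the two terms of the closed form have opposite signs. But
  the kernel decreases in |w| and tends to 0 at infinity.\<close>

lemma sgn_kernel_nonneg:
  assumes \<tau>: "0 < \<tau>"
  shows "0 \<le> sgn_kernel b \<tau> w"
proof -
  have "((\<lambda>a. gauss \<tau> (a - b * \<tau>)) \<longlongrightarrow> 0) at_top"
    unfolding gauss_def using \<tau> by real_asymp
  moreover have "filterlim (\<lambda>a. (b * \<tau> - a) / sqrt \<tau>) at_bot at_top"
    using \<tau> by real_asymp
  then have "((\<lambda>a. gauss_cdf \<tau> (b * \<tau> - a)) \<longlongrightarrow> 0) at_top"
    unfolding gauss_cdf_def by (rule filterlim_compose[OF Phi_at_bot])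
  ultimately have "((\<lambda>a. gauss \<tau> (a - b * \<tau>) + b * gauss_cdf \<tau> (b * \<tau> - a)) \<longlongrightarrow> 0 + b * 0) at_top"
    by (intro tendsto_intros)
  moreover have "\<forall>\<^sub>F a in at_top. gauss \<tau> (a - b * \<tau>) + b * gauss_cdf \<tau> (b * \<tau> - a) \<le> sgn_kernel b \<tau> w"
    using eventually_ge_at_top[of "\<bar>w\<bar>"]
  proof eventually_elim
    case (elim a)
    then show ?case using sgn_kernel_antimono[OF \<tau>, of w a b] by (simp add: sgn_kernel_def)
  qed
  ultimately show ?thesis using tendsto_upperbound by fastforce
qed

text \<open>Writing z = (z - m) + m splits the integrand into an exact derivative and
  \<open>m\<close> times a Gaussian, which explains the primitive \<open>F\<close>. On the domain z
  is nonnegative, so the integral is one of a nonnegative function.\<close>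

lemma sgn_kernel_eq_integral:
  assumes t: "0 < t"
  shows "sgn_kernel b t w = 1 / sqrt (2 * pi * t) *
    (LBINT z:{\<bar>w\<bar> / sqrt t..}. z * exp (- ((z - b * sqrt t)\<^sup>2) / 2))"
proof -
  define m where "m = b * sqrt t"
  define a where "a = \<bar>w\<bar> / sqrt t"
  define f where "f z = z * exp (- ((z - m)\<^sup>2) / 2)" for z
  define F where "F z = m * sqrt (2 * pi) * Phi (z - m) - exp (- ((z - m)\<^sup>2) / 2)" for z
  have a: "0 \<le> a" using t by (simp add: a_def)
  have fm[measurable]: "f \<in> borel_measurable borel" unfolding f_def by measurable
  have dens: "sqrt (2 * pi) * std_normal_density x = exp (- x\<^sup>2 / 2)" for x
    by (simp add: std_normal_density_def)
  have F': "(F has_real_derivative f z) (at z)" for z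
  proof -
    have e: "((\<lambda>z. exp (- ((z - m)\<^sup>2) / 2)) has_real_derivative - (z - m) * exp (- ((z - m)\<^sup>2) / 2)) (at z)"
      by (auto intro!: derivative_eq_intros simp: field_simps)
    have p: "((\<lambda>z. Phi (z - m)) has_real_derivative std_normal_density (z - m) * (1 - 0)) (at z)"
      by (intro Phi_real_deriv DERIV_diff DERIV_ident DERIV_const)
    have "(F has_real_derivative m * sqrt (2 * pi) * (std_normal_density (z - m) * (1 - 0))
        - - (z - m) * exp (- ((z - m)\<^sup>2) / 2)) (at z)"
      unfolding F_def by (intro DERIV_diff DERIV_cmult e p)
    also have "m * sqrt (2 * pi) * (std_normal_density (z - m) * (1 - 0)) = m * exp (- ((z - m)\<^sup>2) / 2)"
      by (simp add: mult.assoc dens)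
    finally show ?thesis by (simp add: f_def algebra_simps)
  qed
  have "((\<lambda>z. Phi (z - m)) \<longlongrightarrow> 1) at_top"
    by (rule filterlim_compose[OF Phi_at_top]) real_asymp
  moreover have "((\<lambda>z. exp (- ((z - m)\<^sup>2) / 2)) \<longlongrightarrow> 0) at_top" by real_asymp
  ultimately have lim: "(F \<longlongrightarrow> m * sqrt (2 * pi) * 1 - 0) at_top"
    unfolding F_def by (intro tendsto_intros)
  have val: "m * sqrt (2 * pi) - F a = sqrt (2 * pi * t) * sgn_kernel b t w"
  proof -
    have tt: "sqrt t * sqrt t = t" using t by simp
    have am: "a - m = (\<bar>w\<bar> - b * t) / sqrt t"
      unfolding a_def m_def using t tt by (simp add: field_simps)
    have "(a - m)\<^sup>2 = (\<bar>w\<bar> - b * t)\<^sup>2 / t"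
      unfolding am using t by (simp add: power_divide)
    then have 1: "exp (- ((a - m)\<^sup>2) / 2) = sqrt (2 * pi * t) * gauss t (\<bar>w\<bar> - b * t)"
      using t by (simp add: gauss_def mult.commute)
    have "1 - Phi (a - m) = Phi (- (a - m))" by (rule Phi_minus[symmetric])
    also have "\<dots> = gauss_cdf t (b * t - \<bar>w\<bar>)"
      unfolding am gauss_cdf_def by (simp add: minus_divide_left)
    finally have 2: "1 - Phi (a - m) = gauss_cdf t (b * t - \<bar>w\<bar>)" .
    have "m * sqrt (2 * pi) - F a = m * sqrt (2 * pi) * (1 - Phi (a - m)) + exp (- ((a - m)\<^sup>2) / 2)"
      by (simp add: F_def algebra_simps)
    also have "\<dots> = sqrt (2 * pi * t) * sgn_kernel b t w"
    proof -
      have "m * sqrt (2 * pi) = sqrt (2 * pi * t) * b" by (simp add: m_def real_sqrt_mult)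
      then show ?thesis
        unfolding 1 2 sgn_kernel_def by (simp add: distrib_left mult.assoc)
    qed
    finally show ?thesis .
  qed
  have "(\<integral>\<^sup>+z. ennreal (f z) * indicator {a..} z \<partial>lborel) = ennreal (m * sqrt (2 * pi) - F a)"
    using lim a by (intro nn_integral_FTC_atLeast[OF fm F']) (auto simp: f_def)
  then have "has_bochner_integral lborel (\<lambda>z. indicator {a..} z *\<^sub>R f z) (m * sqrt (2 * pi) - F a)"
  proof (intro has_bochner_integral_nn_integral)
    show "AE z in lborel. 0 \<le> indicator {a..} z *\<^sub>R f z"
      using a by (auto simp: f_def indicator_def)
    show "0 \<le> m * sqrt (2 * pi) - F a"
      unfolding val using sgn_kernel_nonneg[OF t] t by simp
    assume *: "(\<integral>\<^sup>+z. ennreal (f z) * indicator {a..} z \<partial>lborel) = ennreal (m * sqrt (2 * pi) - F a)"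
    show "(\<integral>\<^sup>+z. ennreal (indicator {a..} z *\<^sub>R f z) \<partial>lborel) = ennreal (m * sqrt (2 * pi) - F a)"
      unfolding *[symmetric] by (intro nn_integral_cong) (auto simp: indicator_def)
  qed measurable
  from has_bochner_integral_integral_eq[OF this]
  have "(LBINT z:{a..}. f z) = sqrt (2 * pi * t) * sgn_kernel b t w"
    unfolding set_lebesgue_integral_def val .
  then show ?thesis
    using t by (simp add: f_def a_def m_def)
qed

section \<open>The kernel as an approximate identity\<close>

lemma sgn_kernel_continuous: "0 < \<tau> \<Longrightarrow> continuous_on UNIV (sgn_kernel b \<tau>)"
  using DERIV_isCont[OF sgn_kernel_deriv_x] by (intro continuous_at_imp_continuous_on ballI)

text \<open>The bracket stems from the primitive
  \<open>w * gauss_cdf \<tau> w + \<tau> * gauss \<tau> w\<close> of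
  \<open>gauss_cdf \<tau>\<close>, in whose derivative the two Gaussian terms cancel.\<close>

lemma sgn_kernel_primitive:
  fixes b :: real
  assumes \<tau>: "0 < \<tau>"
  defines "A \<equiv> \<lambda>a. gauss_cdf \<tau> (a - b * \<tau>)
    - b * ((b * \<tau> - a) * gauss_cdf \<tau> (b * \<tau> - a) + \<tau> * gauss \<tau> (b * \<tau> - a))"
  shows "(A has_real_derivative gauss \<tau> (a - b * \<tau>) + b * gauss_cdf \<tau> (b * \<tau> - a)) (at a)"
proof -
  have s1: "((\<lambda>a. a - b * \<tau>) has_real_derivative 1 - 0) (at a)"
    by (rule DERIV_diff[OF DERIV_ident DERIV_const])
  have s2: "((\<lambda>a. b * \<tau> - a) has_real_derivative 0 - 1) (at a)"
    by (rule DERIV_diff[OF DERIV_const DERIV_ident])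
  have "(A has_real_derivative gauss \<tau> (a - b * \<tau>) * (1 - 0)
     - b * (((0 - 1) * gauss_cdf \<tau> (b * \<tau> - a) + (gauss \<tau> (b * \<tau> - a) * (0 - 1)) * (b * \<tau> - a))
        + \<tau> * (- ((b * \<tau> - a) / \<tau>) * gauss \<tau> (b * \<tau> - a) * (0 - 1)))) (at a)"
    unfolding A_def
    by (intro DERIV_diff DERIV_add DERIV_cmult DERIV_mult s2
        DERIV_chain2[OF gauss_cdf_deriv[OF \<tau>] s1] DERIV_chain2[OF gauss_cdf_deriv[OF \<tau>] s2]
        DERIV_chain2[OF gauss_deriv[OF \<tau>] s2])
  moreover have "gauss \<tau> (a - b * \<tau>) * (1 - 0)
     - b * (((0 - 1) * gauss_cdf \<tau> (b * \<tau> - a) + (gauss \<tau> (b * \<tau> - a) * (0 - 1)) * (b * \<tau> - a))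
        + \<tau> * (- ((b * \<tau> - a) / \<tau>) * gauss \<tau> (b * \<tau> - a) * (0 - 1)))
     = gauss \<tau> (a - b * \<tau>) + b * gauss_cdf \<tau> (b * \<tau> - a)"
    using \<tau> by (simp add: field_simps)
  ultimately show ?thesis by (rule DERIV_cong)
qed

text \<open>As a function of the starting point the kernel is not a probability density when
  \<open>b\<close> is nonzero. Its mass near the centre is therefore evaluated by a
  primitive.\<close>

lemma sgn_kernel_mass_tendsto:
  assumes \<delta>: "0 < \<delta>"
  shows "((\<lambda>\<epsilon>. LBINT z:{y - \<delta>..y + \<delta>}. sgn_kernel b \<epsilon> (z - y)) \<longlongrightarrow> 1) (at_right 0)"
proof -
  define A where "A \<epsilon> a = gauss_cdf \<epsilon> (a - b * \<epsilon>)
    - b * ((b * \<epsilon> - a) * gauss_cdf \<epsilon> (b * \<epsilon> - a) + \<epsilon> * gauss \<epsilon> (b * \<epsilon> - a))" for \<epsilon> a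
  have mass: "(LBINT z:{y - \<delta>..y + \<delta>}. sgn_kernel b \<epsilon> (z - y)) = 2 * (A \<epsilon> \<delta> - A \<epsilon> 0)" if \<epsilon>: "0 < \<epsilon>" for \<epsilon>
  proof -
    have prim: "((\<lambda>a. A \<epsilon> a - A \<epsilon> 0) has_real_derivative
        gauss \<epsilon> (a - b * \<epsilon>) + b * gauss_cdf \<epsilon> (b * \<epsilon> - a) - 0) (at a)" for a
      unfolding A_def by (intro DERIV_diff[OF sgn_kernel_primitive[OF \<epsilon>] DERIV_const])
    have "((\<lambda>w. sgn w * (A \<epsilon> \<bar>w\<bar> - A \<epsilon> 0)) has_real_derivative sgn_kernel b \<epsilon> w) (at w)" for w
      using DERIV_sgn_extension[OF prim, of w] by (simp add: sgn_kernel_def)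
    from DERIV_chain2[OF this DERIV_diff[OF DERIV_ident DERIV_const]]
    have d: "((\<lambda>z. sgn (z - y) * (A \<epsilon> \<bar>z - y\<bar> - A \<epsilon> 0)) has_real_derivative sgn_kernel b \<epsilon> (z - y)) (at z)" for z
      by simp
    have "(LBINT z. indicator {y - \<delta>..y + \<delta>} z *\<^sub>R sgn_kernel b \<epsilon> (z - y)) =
        sgn (y + \<delta> - y) * (A \<epsilon> \<bar>y + \<delta> - y\<bar> - A \<epsilon> 0) - sgn (y - \<delta> - y) * (A \<epsilon> \<bar>y - \<delta> - y\<bar> - A \<epsilon> 0)"
    proof (rule integral_FTC_atLeastAtMost)
      show "((\<lambda>z. sgn (z - y) * (A \<epsilon> \<bar>z - y\<bar> - A \<epsilon> 0)) has_vector_derivative sgn_kernel b \<epsilon> (z - y))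
          (at z within {y - \<delta>..y + \<delta>})" for z
        using has_field_derivative_at_within[OF d]
        by (simp add: has_real_derivative_iff_has_vector_derivative)
      show "continuous_on {y - \<delta>..y + \<delta>} (\<lambda>z. sgn_kernel b \<epsilon> (z - y))"
        by (rule continuous_on_compose2[OF sgn_kernel_continuous[OF \<epsilon>]]) (auto intro!: continuous_intros)
    qed (use \<delta> in simp)
    then show ?thesis using \<delta> by (simp add: set_lebesgue_integral_def)
  qed
  note L = gauss_limits_at_right_0[OF \<delta>, of b]
  have "((\<lambda>\<epsilon>. b * \<epsilon>) \<longlongrightarrow> b * 0) (at_right 0)" by (intro tendsto_intros)
  then have be: "((\<lambda>\<epsilon>. b * \<epsilon>) \<longlongrightarrow> 0) (at_right 0)" by simp
  have flip: "gauss \<epsilon> (b * \<epsilon> - \<delta>) = gauss \<epsilon> (\<delta> - b * \<epsilon>)" for \<epsilon> by (rule gauss_flip)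
  have "((\<lambda>\<epsilon>. A \<epsilon> \<delta>) \<longlongrightarrow> 1 - b * ((0 - \<delta>) * 0 + 0 * 0)) (at_right 0)"
    unfolding A_def flip by (intro tendsto_intros L be)
  moreover have "((\<lambda>\<epsilon>. (1 - gauss_cdf \<epsilon> (b * \<epsilon>))
      - b * (b * \<epsilon> * gauss_cdf \<epsilon> (b * \<epsilon>) + \<epsilon> * gauss \<epsilon> (b * \<epsilon>)))
      \<longlongrightarrow> (1 - 1 / 2) - b * (0 * (1 / 2) + 0)) (at_right 0)"
    by (intro tendsto_intros L be)
  then have "((\<lambda>\<epsilon>. A \<epsilon> 0) \<longlongrightarrow> 1 / 2) (at_right 0)"
    unfolding A_def by (simp add: gauss_cdf_minus)
  ultimately have "((\<lambda>\<epsilon>. 2 * (A \<epsilon> \<delta> - A \<epsilon> 0)) \<longlongrightarrow> 2 * (1 - b * ((0 - \<delta>) * 0 + 0 * 0) - 1 / 2)) (at_right 0)"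
    by (intro tendsto_intros)
  then have "((\<lambda>\<epsilon>. 2 * (A \<epsilon> \<delta> - A \<epsilon> 0)) \<longlongrightarrow> 1) (at_right 0)" by simp
  then show ?thesis
    by (rule Lim_transform_eventually)
       (use mass in \<open>auto simp: eventually_at_filter intro!: always_eventually\<close>)
qed

lemma bounded_borel_sgn_kernel:
  assumes \<epsilon>: "0 < \<epsilon>"
  shows "(\<lambda>z. sgn_kernel b \<epsilon> (z - y)) \<in> borel_measurable borel"
    "\<bar>sgn_kernel b \<epsilon> w\<bar> \<le> sgn_kernel b \<epsilon> 0"
proof -
  have [measurable]: "sgn_kernel b \<epsilon> \<in> borel_measurable borel"
    by (rule borel_measurable_continuous_onI[OF sgn_kernel_continuous[OF \<epsilon>]])
  show "(\<lambda>z. sgn_kernel b \<epsilon> (z - y)) \<in> borel_measurable borel" by measurable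
  show "\<bar>sgn_kernel b \<epsilon> w\<bar> \<le> sgn_kernel b \<epsilon> 0"
    using sgn_kernel_nonneg[OF \<epsilon>] sgn_kernel_antimono[OF \<epsilon>, of 0 w] by simp
qed

lemma integrable_mult_sgn_kernel:
  assumes Q: "integrable lborel Q" and \<epsilon>: "0 < \<epsilon>"
  shows "integrable lborel (\<lambda>z. Q z * sgn_kernel b \<epsilon> (z - y))"
proof (rule Bochner_Integration.integrable_bound[OF integrable_mult_left[OF Q, of "sgn_kernel b \<epsilon> 0"]])
  have [measurable]: "Q \<in> borel_measurable borel"
    using borel_measurable_integrable[OF Q] by simp
  note [measurable] = bounded_borel_sgn_kernel(1)[OF \<epsilon>]
  show "(\<lambda>z. Q z * sgn_kernel b \<epsilon> (z - y)) \<in> borel_measurable lborel" by measurable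
  show "AE z in lborel. norm (Q z * sgn_kernel b \<epsilon> (z - y)) \<le> norm (Q z * sgn_kernel b \<epsilon> 0)"
    unfolding real_norm_def abs_mult
    by (intro AE_I2 mult_left_mono order_trans[OF bounded_borel_sgn_kernel(2)[OF \<epsilon>] abs_ge_self]) simp
qed

text \<open>Near \<open>y\<close> continuity of \<open>Q\<close> is used. Farther than \<delta> the
  kernel is at most its value at \<delta>, which tends to 0, so integrability of \<open>Q\<close>
  controls the rest.\<close>

lemma sgn_kernel_approximate_identity:
  fixes Q :: "real \<Rightarrow> real"
  assumes Q: "integrable lborel Q" and cont: "isCont Q y"
  shows "((\<lambda>\<epsilon>. LBINT z. Q z * sgn_kernel b \<epsilon> (z - y)) \<longlongrightarrow> Q y) (at_right 0)"
proof (rule tendstoI)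
  fix e :: real assume e: "0 < e"
  define \<eta> where "\<eta> = e / 2"
  have \<eta>: "0 < \<eta>" using e by (simp add: \<eta>_def)
  from cont \<eta> obtain \<delta>' where \<delta>': "0 < \<delta>'" "\<And>z. \<bar>z - y\<bar> < \<delta>' \<Longrightarrow> \<bar>Q z - Q y\<bar> < \<eta>"
    unfolding continuous_at_eps_delta dist_real_def by metis
  define \<delta> where "\<delta> = \<delta>' / 2"
  have \<delta>: "0 < \<delta>" "\<And>z. \<bar>z - y\<bar> \<le> \<delta> \<Longrightarrow> \<bar>Q z - Q y\<bar> \<le> \<eta>"
    using \<delta>' less_imp_le by (auto simp: \<delta>_def intro!: less_imp_le[OF \<delta>'(2)])
  let ?N = "{y - \<delta>..y + \<delta>}"
  define m where "m \<epsilon> = (LBINT z:?N. sgn_kernel b \<epsilon> (z - y))" for \<epsilon>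
  define c where "c = (LBINT z. \<bar>Q z\<bar>)"
  have bound: "\<bar>(LBINT z. Q z * sgn_kernel b \<epsilon> (z - y)) - Q y\<bar>
      \<le> \<eta> * m \<epsilon> + sgn_kernel b \<epsilon> \<delta> * c + \<bar>Q y\<bar> * \<bar>m \<epsilon> - 1\<bar>" if \<epsilon>: "0 < \<epsilon>" for \<epsilon>
  proof -
    define k where "k z = sgn_kernel b \<epsilon> (z - y)" for z
    have contk: "continuous_on UNIV k"
      unfolding k_def
      by (rule continuous_on_compose2[OF sgn_kernel_continuous[OF \<epsilon>]]) (auto intro!: continuous_intros)
    have k: "0 \<le> k z" for z
      unfolding k_def by (rule sgn_kernel_nonneg[OF \<epsilon>])
    have kfar: "k z \<le> sgn_kernel b \<epsilon> \<delta>" if "z \<notin> ?N" for z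
      unfolding k_def using that \<delta>(1) by (intro sgn_kernel_antimono[OF \<epsilon>]) auto
    have iN: "integrable lborel (\<lambda>z. indicator ?N z * k z)"
      using borel_integrable_atLeastAtMost'[OF continuous_on_subset[OF contk subset_UNIV]]
      by (simp add: set_integrable_def)
    have mN: "(LBINT z. indicator ?N z * k z) = m \<epsilon>"
      by (simp add: m_def set_lebesgue_integral_def k_def)
    have iQk: "integrable lborel (\<lambda>z. Q z * k z)"
      unfolding k_def by (rule integrable_mult_sgn_kernel[OF Q \<epsilon>])
    have eq: "(LBINT z. Q z * k z) - Q y * m \<epsilon> = (LBINT z. Q z * k z - Q y * (indicator ?N z * k z))"
      by (simp add: Bochner_Integration.integral_diff[OF iQk integrable_mult_right[OF iN]] mN)
    have "\<bar>(LBINT z. Q z * k z) - Q y * m \<epsilon>\<bar> \<le> (LBINT z. \<bar>Q z * k z - Q y * (indicator ?N z * k z)\<bar>)"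
      unfolding eq by (rule integral_abs_bound)
    also have "\<dots> \<le> (LBINT z. \<eta> * (indicator ?N z * k z) + sgn_kernel b \<epsilon> \<delta> * \<bar>Q z\<bar>)"
    proof (rule integral_mono)
      show "integrable lborel (\<lambda>z. \<bar>Q z * k z - Q y * (indicator ?N z * k z)\<bar>)"
        by (rule integrable_abs[OF Bochner_Integration.integrable_diff[OF iQk integrable_mult_right[OF iN]]])
      show "integrable lborel (\<lambda>z. \<eta> * (indicator ?N z * k z) + sgn_kernel b \<epsilon> \<delta> * \<bar>Q z\<bar>)"
        by (rule Bochner_Integration.integrable_add[OF integrable_mult_right[OF iN]
              integrable_mult_right[OF integrable_abs[OF Q]]])
      show "\<bar>Q z * k z - Q y * (indicator ?N z * k z)\<bar>
          \<le> \<eta> * (indicator ?N z * k z) + sgn_kernel b \<epsilon> \<delta> * \<bar>Q z\<bar>" for z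
      proof (cases "z \<in> ?N")
        case True
        then have "\<bar>Q z - Q y\<bar> \<le> \<eta>" by (intro \<delta>(2)) auto
        then have "\<bar>Q z - Q y\<bar> * k z \<le> \<eta> * k z" using k by (intro mult_right_mono) auto
        moreover have "\<bar>Q z * k z - Q y * k z\<bar> = \<bar>Q z - Q y\<bar> * k z"
          using k[of z] by (simp add: left_diff_distrib[symmetric] abs_mult)
        moreover have "0 \<le> sgn_kernel b \<epsilon> \<delta> * \<bar>Q z\<bar>" using sgn_kernel_nonneg[OF \<epsilon>] by simp
        ultimately show ?thesis using True by simp
      next
        case False
        then show ?thesis
          using mult_right_mono[OF kfar[OF False], of "\<bar>Q z\<bar>"] k[of z]
          by (simp add: abs_mult mult.commute)
      qed
    qed
    also have "\<dots> = \<eta> * m \<epsilon> + sgn_kernel b \<epsilon> \<delta> * c"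
      by (simp add: Bochner_Integration.integral_add[OF integrable_mult_right[OF iN]
            integrable_mult_right[OF integrable_abs[OF Q]]] mN c_def)
    finally have 1: "\<bar>(LBINT z. Q z * k z) - Q y * m \<epsilon>\<bar> \<le> \<eta> * m \<epsilon> + sgn_kernel b \<epsilon> \<delta> * c" .
    have "\<bar>Q y * m \<epsilon> - Q y\<bar> = \<bar>Q y\<bar> * \<bar>m \<epsilon> - 1\<bar>"
      by (simp add: abs_mult[symmetric] right_diff_distrib)
    then show ?thesis using 1 unfolding k_def by linarith
  qed
  have far: "((\<lambda>\<epsilon>. sgn_kernel b \<epsilon> \<delta>) \<longlongrightarrow> 0) (at_right 0)"
  proof -
    have "((\<lambda>\<epsilon>. gauss \<epsilon> (\<delta> - b * \<epsilon>) + b * gauss_cdf \<epsilon> (b * \<epsilon> - \<delta>)) \<longlongrightarrow> 0 + b * 0) (at_right 0)"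
      by (intro tendsto_intros gauss_limits_at_right_0[OF \<delta>(1)])
    then show ?thesis using \<delta>(1) by (simp add: sgn_kernel_def)
  qed
  have "((\<lambda>\<epsilon>. \<eta> * m \<epsilon> + sgn_kernel b \<epsilon> \<delta> * c + \<bar>Q y\<bar> * \<bar>m \<epsilon> - 1\<bar>) \<longlongrightarrow> \<eta> * 1 + 0 * c + \<bar>Q y\<bar> * \<bar>1 - 1\<bar>) (at_right 0)"
    unfolding m_def by (intro tendsto_intros far sgn_kernel_mass_tendsto[OF \<delta>(1)])
  then have "\<forall>\<^sub>F \<epsilon> in at_right 0. \<eta> * m \<epsilon> + sgn_kernel b \<epsilon> \<delta> * c + \<bar>Q y\<bar> * \<bar>m \<epsilon> - 1\<bar> < e"
    by (rule order_tendstoD(2)) (use e in \<open>simp add: \<eta>_def\<close>)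
  moreover have "\<forall>\<^sub>F \<epsilon> in at_right (0::real). 0 < \<epsilon>"
    by (simp add: eventually_at_filter)
  ultimately show "\<forall>\<^sub>F \<epsilon> in at_right 0. dist (LBINT z. Q z * sgn_kernel b \<epsilon> (z - y)) (Q y) < e"
  proof eventually_elim
    case (elim \<epsilon>)
    then show ?case using bound[of \<epsilon>] by (simp add: dist_real_def)
  qed
qed

section \<open>Paths driven by a bounded drift and a boundary push\<close>

lemma LBINT_singleton:
  fixes s :: real and f :: "real \<Rightarrow> real"
  shows "(LBINT r:{s..s}. f r) = 0"
  unfolding set_lebesgue_integral_def
proof (rule integral_eq_zero_AE)
  show "AE r in lborel. indicator {s..s} r *\<^sub>R f r = 0"
    using AE_lborel_singleton[of s] by eventually_elim (simp add: atLeastAtMost_singleton)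
qed

text \<open>The drift may be arbitrarily rough in time, so \<open>gen\<close> pairs derivatives at
  the left end point \<open>a\<close> with the drift at a later time \<open>q\<close>, and is
  integrated over \<open>q\<close>. An increase of \<open>L\<close> is charged through
  \<open>refl\<close>, which bounds \<open>ux a (X a)\<close> by the oscillation of the
  path.\<close>

lemma drift_controlled_path:
  assumes s: "0 \<le> s" and st: "s < t" and \<kappa>: "0 \<le> \<kappa>" and K: "0 \<le> K"
    and contX: "continuous_on {s..t} X" and contB: "continuous_on {s..t} B"
    and int: "set_integrable lborel {s..t} c"
    and eq: "\<And>r. r \<in> {s..t} \<Longrightarrow> X r = x + (LBINT q:{s..r}. c q) + B r + L r"
    and c: "\<And>q. q \<in> {s..t} \<Longrightarrow> 0 < q \<Longrightarrow> \<bar>c q\<bar> \<le> \<kappa>"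
    and L: "mono_on {s..t} L"
    and gen: "\<And>a q. a \<in> {s..t} \<Longrightarrow> q \<in> {a..t} \<Longrightarrow> 0 < q \<Longrightarrow>
      ut a (X a) + uxx a (X a) / 2 + ux a (X a) * c q \<le> K * \<bar>X q - X a\<bar>"
    and refl: "\<And>a b. s \<le> a \<Longrightarrow> a \<le> b \<Longrightarrow> b \<le> t \<Longrightarrow> L a \<noteq> L b \<Longrightarrow>
      \<exists>q\<in>{a..b}. ux a (X a) \<le> K * \<bar>X q - X a\<bar>"
  shows "controlled_path s t (\<kappa> + 1) K ut ux uxx X B"
  unfolding controlled_path_def
proof (intro conjI contX contB exI[of _ "\<lambda>r. r + L r"] allI impI)
  fix a b assume ab': "s \<le> a \<and> a \<le> b \<and> b \<le> t"
  then have ab: "s \<le> a" "a \<le> b" "b \<le> t" by auto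
  have Lab: "L a \<le> L b" using L ab by (auto simp: mono_on_def)
  then show "b - a \<le> b + L b - (a + L a)" by simp
  have int': "set_integrable lborel S c" if "S \<subseteq> {s..t}" "S \<in> sets borel" for S
    by (rule set_integrable_subset[OF int]) (use that in auto)
  \<comment> \<open>Open on the left, so that \<open>q > 0\<close> even for
    \<open>a = s = 0\<close>; the drift bound is assumed only at positive times.\<close>
  have ii: "set_integrable lborel {a<..b} c" using ab by (intro int') auto
  define I where "I = (LBINT q:{a<..b}. c q)"
  have len: "(LBINT q:{a<..b}. (k::real)) = k * (b - a)" for k
    using ab by (simp add: set_lebesgue_integral_def)
  have ik: "set_integrable lborel {a<..b} (\<lambda>_. k::real)" for k
    using ab by (auto simp: set_integrable_def intro!: integrable_mult_left integrable_real_indicator)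
  have "(LBINT q:{s..a} \<union> {a<..b}. c q) = (LBINT q:{s..a}. c q) + I"
    unfolding I_def using ab by (intro set_integral_Un int') auto
  moreover have "{s..a} \<union> {a<..b} = {s..b}" using ab by auto
  ultimately have dW: "(X b - B b) - (X a - B a) = I + (L b - L a)"
    using eq[of a] eq[of b] ab by simp
  have cq: "\<bar>c q\<bar> \<le> \<kappa>" if "q \<in> {a<..b}" for q
    using that s ab by (intro c) auto
  have "I \<le> \<kappa> * (b - a)"
    unfolding I_def len[symmetric] using cq by (intro set_integral_mono ii ik) (auto simp: abs_le_iff)
  moreover have "- \<kappa> * (b - a) \<le> I"
    unfolding I_def len[symmetric] using cq by (intro set_integral_mono ii ik) (auto simp: abs_le_iff minus_le_iff)
  ultimately have I: "\<bar>I\<bar> \<le> \<kappa> * (b - a)" by (simp add: abs_le_iff)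
  show "\<bar>(X b - B b) - (X a - B a)\<bar> \<le> (\<kappa> + 1) * (b + L b - (a + L a))"
  proof -
    have "\<bar>(X b - B b) - (X a - B a)\<bar> \<le> \<kappa> * (b - a) + (L b - L a)"
      unfolding dW using I Lab by linarith
    moreover have "0 \<le> \<kappa> * (L b - L a)" "0 \<le> b - a" using \<kappa> Lab ab by auto
    ultimately show ?thesis by (simp add: algebra_simps)
  qed
  fix \<delta> assume \<delta>: "\<forall>r\<in>{a..b}. \<bar>X r - X a\<bar> \<le> \<delta>"
  define G where "G = ut a (X a) + uxx a (X a) / 2"
  have "(LBINT q:{a<..b}. G + ux a (X a) * c q) \<le> (LBINT q:{a<..b}. K * \<delta>)"
  proof (rule set_integral_mono)
    show "set_integrable lborel {a<..b} (\<lambda>q. G + ux a (X a) * c q)"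
      using ii ik by (intro set_integral_add set_integrable_mult_right) auto
    fix q assume q: "q \<in> {a<..b}"
    have "G + ux a (X a) * c q \<le> K * \<bar>X q - X a\<bar>"
      unfolding G_def using q s ab by (intro gen) auto
    also have "\<dots> \<le> K * \<delta>" using \<delta> q K by (intro mult_left_mono) auto
    finally show "G + ux a (X a) * c q \<le> K * \<delta>" .
  qed (rule ik)
  also have "(LBINT q:{a<..b}. G + ux a (X a) * c q) = G * (b - a) + ux a (X a) * I"
    using ii ik by (simp add: set_integral_add set_integrable_mult_right len I_def)
  also have "(LBINT q:{a<..b}. K * \<delta>) = K * \<delta> * (b - a)" by (rule len)
  finally have 1: "G * (b - a) + ux a (X a) * I \<le> K * \<delta> * (b - a)" .
  have 2: "ux a (X a) * (L b - L a) \<le> K * \<delta> * (L b - L a)"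
  proof (cases "L a = L b")
    case False
    then obtain q where q: "q \<in> {a..b}" "ux a (X a) \<le> K * \<bar>X q - X a\<bar>"
      using refl ab by blast
    have "K * \<bar>X q - X a\<bar> \<le> K * \<delta>" using \<delta> q K by (intro mult_left_mono) auto
    then show ?thesis using q(2) Lab by (intro mult_right_mono) auto
  qed simp
  show "(ut a (X a) + uxx a (X a) / 2) * (b - a) + ux a (X a) * ((X b - B b) - (X a - B a))
      \<le> K * \<delta> * (b + L b - (a + L a))"
    using 1 2 unfolding dW G_def by (simp add: algebra_simps)
qed

text \<open>By the backward equation only the mismatch of drifts, \<open>c + b * sgn w\<close>,
  times the first derivative survives. Its sign is opposite to that of
  \<open>b * \<bar>w\<bar> + c * w\<close>, hence determined by \<open>b\<close> whenever |c| \<le>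
  |b|.\<close>

lemma sgn_kernel_generator:
  assumes "0 < \<tau>"
  shows "- sgn_kernel_t b \<tau> w + sgn_kernel_xx b \<tau> w / 2 + sgn_kernel_x b \<tau> w * c
    = - (gauss \<tau> (\<bar>w\<bar> - b * \<tau>) / \<tau>) * (b * \<bar>w\<bar> + c * w)"
  using assms by (simp add: sgn_kernel_t_def sgn_kernel_x_def field_simps)

section \<open>The density at the centre\<close>

lemma sgn_kernel_continuous_time:
  assumes "0 < t"
  shows "((\<lambda>\<epsilon>. sgn_kernel b (t + \<epsilon>) w) \<longlongrightarrow> sgn_kernel b t w) (at_right 0)"
proof -
  have "((\<lambda>\<epsilon>. t + \<epsilon>) \<longlongrightarrow> t + 0) (at_right 0)" by (intro tendsto_intros)
  then have "((\<lambda>\<epsilon>. t + \<epsilon>) \<longlongrightarrow> t) (at_right 0)" by simp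
  from isCont_tendsto_compose[OF DERIV_isCont[OF sgn_kernel_deriv_t[OF assms]] this]
  show ?thesis .
qed

text \<open>The drift is the one in the backward equation, so the generator term vanishes up to an
  error caused by the jump of \<open>sgn\<close>. Testing with the kernel and with its negative
  gives equality.\<close>

lemma expectation_sgn_kernel:
  assumes sol: "weak_solution (\<lambda>r z. - b * sgn (z - y)) 0 x M F B Z" and t: "0 < t" and \<epsilon>: "0 < \<epsilon>"
  shows "(\<integral>\<omega>. sgn_kernel b \<epsilon> (Z t \<omega> - y) \<partial>M) = sgn_kernel b (t + \<epsilon>) (x - y)"
proof -
  have bm: "brownian_motion_from 0 M F B" and ad: "adapted_on 0 F Z"
    and path: "AE \<omega> in M. continuous_on {0..} (\<lambda>t. Z t \<omega>) \<and>
       (\<forall>t\<ge>0. set_integrable lborel {0..t} (\<lambda>r. - b * sgn (Z r \<omega> - y)) \<and>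
          Z t \<omega> = x + (LBINT r:{0..t}. - b * sgn (Z r \<omega> - y)) + B t \<omega>)"
    using sol unfolding weak_solution_def by blast+
  note bmD = brownian_motion_fromD[OF bm]
  obtain U where sm: "smooth_bounded 0 t U (\<lambda>r z. sgn_kernel b (t + \<epsilon> - r) (z - y))
    (\<lambda>r z. - sgn_kernel_t b (t + \<epsilon> - r) (z - y)) (\<lambda>r z. sgn_kernel_x b (t + \<epsilon> - r) (z - y))
    (\<lambda>r z. sgn_kernel_xx b (t + \<epsilon> - r) (z - y))"
    using smooth_bounded_sgn_kernel[of 0 t "t + \<epsilon>"] t \<epsilon> by auto
  define K where "K = 2 * \<bar>b\<bar> / (\<epsilon> * sqrt (2 * pi * \<epsilon>))"
  have K: "0 \<le> K" using \<epsilon> by (simp add: K_def)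
  \<comment> \<open>The drift is evaluated at \<open>v\<close>, the derivatives at \<open>w\<close>.
    On the same side of the centre the mismatch is 0; otherwise |w| \<le> |v - w|, hence the factor
    2.\<close>
  have key: "\<bar>- (gauss \<tau> (\<bar>w\<bar> - b * \<tau>) / \<tau>) * (b * \<bar>w\<bar> + - b * sgn v * w)\<bar> \<le> K * \<bar>v - w\<bar>"
    if "\<epsilon> \<le> \<tau>" for \<tau> v w
  proof -
    have "gauss \<tau> (\<bar>w\<bar> - b * \<tau>) \<le> 1 / sqrt (2 * pi * \<epsilon>)"
      unfolding gauss_def using that \<epsilon> by (intro frac_le) auto
    then have "gauss \<tau> (\<bar>w\<bar> - b * \<tau>) / \<tau> \<le> 1 / sqrt (2 * pi * \<epsilon>) / \<epsilon>"
      using that \<epsilon> by (intro frac_le) auto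
    then have g: "\<bar>gauss \<tau> (\<bar>w\<bar> - b * \<tau>) / \<tau>\<bar> \<le> 1 / (\<epsilon> * sqrt (2 * pi * \<epsilon>))"
      using that \<epsilon> gauss_nonneg[of \<tau>] by (simp add: mult.commute)
    have "\<bar>\<bar>w\<bar> - sgn v * w\<bar> \<le> 2 * \<bar>v - w\<bar>" by (auto simp: sgn_if abs_if)
    then have "\<bar>b\<bar> * \<bar>\<bar>w\<bar> - sgn v * w\<bar> \<le> \<bar>b\<bar> * (2 * \<bar>v - w\<bar>)"
      by (intro mult_left_mono) auto
    moreover have "b * \<bar>w\<bar> + - b * sgn v * w = b * (\<bar>w\<bar> - sgn v * w)" by (simp add: algebra_simps)
    ultimately have "\<bar>b * \<bar>w\<bar> + - b * sgn v * w\<bar> \<le> 2 * \<bar>b\<bar> * \<bar>v - w\<bar>"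
      by (simp add: abs_mult)
    from mult_mono[OF g this] show ?thesis
      using \<epsilon> by (simp add: K_def abs_mult)
  qed
  have one: "\<sigma> * (\<integral>\<omega>. sgn_kernel b \<epsilon> (Z t \<omega> - y) \<partial>M) \<le> \<sigma> * sgn_kernel b (t + \<epsilon>) (x - y)"
    if \<sigma>: "\<bar>\<sigma>\<bar> = 1" for \<sigma>
  proof -
    have "(\<integral>\<omega>. \<sigma> * sgn_kernel b (t + \<epsilon> - t) (Z t \<omega> - y) \<partial>M) \<le> \<sigma> * sgn_kernel b (t + \<epsilon> - 0) (x - y)"
    proof (rule expectation_smooth_le[OF bm t smooth_bounded_cmult[OF sm, of \<sigma>] ad _ K])
      show "AE \<omega> in M. Z 0 \<omega> = x"
        using path bmD(6)
      proof eventually_elim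
        case (elim \<omega>)
        then have "Z 0 \<omega> = x + (LBINT r:{0..0}. - b * sgn (Z r \<omega> - y)) + B 0 \<omega>" by blast
        then show ?case using elim by (simp only: LBINT_singleton)
      qed
      show "AE \<omega> in M. controlled_path 0 t (\<bar>b\<bar> + 1) K
          (\<lambda>r z. \<sigma> * - sgn_kernel_t b (t + \<epsilon> - r) (z - y))
          (\<lambda>r z. \<sigma> * sgn_kernel_x b (t + \<epsilon> - r) (z - y))
          (\<lambda>r z. \<sigma> * sgn_kernel_xx b (t + \<epsilon> - r) (z - y)) (\<lambda>r. Z r \<omega>) (\<lambda>r. B r \<omega>)"
        using path bmD(6)
      proof eventually_elim
        case (elim \<omega>)
        show ?case
        proof (rule drift_controlled_path[where c="\<lambda>r. - b * sgn (Z r \<omega> - y)" and L="\<lambda>_. 0" and x=x])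
          show "continuous_on {0..t} (\<lambda>r. Z r \<omega>)" "continuous_on {0..t} (\<lambda>r. B r \<omega>)"
            using elim by (auto intro: continuous_on_subset)
          show "set_integrable lborel {0..t} (\<lambda>r. - b * sgn (Z r \<omega> - y))"
            using elim t less_imp_le by blast
          show "Z r \<omega> = x + (LBINT q:{0..r}. - b * sgn (Z q \<omega> - y)) + B r \<omega> + 0" if "r \<in> {0..t}" for r
            using elim that by auto
          show "\<bar>- b * sgn (Z q \<omega> - y)\<bar> \<le> \<bar>b\<bar>" for q
            by (simp add: abs_mult sgn_if)
          fix a q assume aq: "a \<in> {0..t}" "q \<in> {a..t}"
          define \<tau> where "\<tau> = t + \<epsilon> - a"
          define v w where "v = Z q \<omega> - y" and "w = Z a \<omega> - y"
          have \<tau>: "\<epsilon> \<le> \<tau>" "0 < \<tau>" using aq \<epsilon> by (auto simp: \<tau>_def)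
          have "\<sigma> * - sgn_kernel_t b \<tau> w + \<sigma> * sgn_kernel_xx b \<tau> w / 2
              + \<sigma> * sgn_kernel_x b \<tau> w * (- b * sgn v)
            = \<sigma> * (- sgn_kernel_t b \<tau> w + sgn_kernel_xx b \<tau> w / 2 + sgn_kernel_x b \<tau> w * (- b * sgn v))"
            by (simp add: algebra_simps)
          also have "\<dots> \<le> \<bar>- sgn_kernel_t b \<tau> w + sgn_kernel_xx b \<tau> w / 2 + sgn_kernel_x b \<tau> w * (- b * sgn v)\<bar>"
            by (rule order_trans[OF abs_ge_self]) (simp only: abs_mult \<sigma> mult_1 order_refl)
          also have "\<dots> \<le> K * \<bar>v - w\<bar>"
            unfolding sgn_kernel_generator[OF \<tau>(2)] by (rule key[OF \<tau>(1)])
          finally show "\<sigma> * - sgn_kernel_t b (t + \<epsilon> - a) (Z a \<omega> - y)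
              + \<sigma> * sgn_kernel_xx b (t + \<epsilon> - a) (Z a \<omega> - y) / 2
              + \<sigma> * sgn_kernel_x b (t + \<epsilon> - a) (Z a \<omega> - y) * (- b * sgn (Z q \<omega> - y)) \<le> K * \<bar>Z q \<omega> - Z a \<omega>\<bar>"
            by (simp add: \<tau>_def v_def w_def)
        qed (use t K in \<open>auto simp: mono_on_def\<close>)
      qed
    qed simp
    then show ?thesis by simp
  qed
  show ?thesis using one[of 1] one[of "- 1"] by simp
qed

lemma sgn_transition_density_at_centre:
  assumes dens: "sgn_transition_density TYPE('a) b y p" and t: "0 < t"
  shows "p x t y = sgn_kernel b t (x - y)"
proof -
  obtain M :: "'a measure" and F B Z
    where sol: "weak_solution (\<lambda>r z. - b * sgn (z - y)) 0 x M F B Z"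
    using dens unfolding sgn_transition_density_def by blast
  interpret prob_space M
    using sol brownian_motion_fromD(1) by (auto simp: weak_solution_def)
  have cont: "continuous_on UNIV (p x t)"
    and law: "\<And>f. f \<in> borel_measurable borel \<Longrightarrow> bounded (range f) \<Longrightarrow>
      (LINT \<omega>|M. f (Z t \<omega>)) = (LBINT z. p x t z * f z)"
    using dens t sol unfolding sgn_transition_density_def by blast+
  have "(LBINT z. p x t z) = 1"
    using law[of "\<lambda>_. 1"] by (simp add: prob_space)
  \<comment> \<open>The integral of a nonintegrable function is 0 by convention, so the value 1
    forces integrability.\<close>
  then have int: "integrable lborel (p x t)"
    using not_integrable_integral_eq by fastforce
  have "((\<lambda>\<epsilon>. LBINT z. p x t z * sgn_kernel b \<epsilon> (z - y)) \<longlongrightarrow> p x t y) (at_right 0)"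
    using cont by (intro sgn_kernel_approximate_identity int) (simp add: continuous_on_eq_continuous_at)
  moreover have "((\<lambda>\<epsilon>. LBINT z. p x t z * sgn_kernel b \<epsilon> (z - y)) \<longlongrightarrow> sgn_kernel b t (x - y)) (at_right 0)"
  proof (rule Lim_transform_eventually[OF sgn_kernel_continuous_time[OF t]])
    show "\<forall>\<^sub>F \<epsilon> in at_right 0. sgn_kernel b (t + \<epsilon>) (x - y) = (LBINT z. p x t z * sgn_kernel b \<epsilon> (z - y))"
      using eventually_at_right_less[of 0]
    proof eventually_elim
      case (elim \<epsilon>)
      have "bounded (range (\<lambda>z. sgn_kernel b \<epsilon> (z - y)))"
        unfolding bounded_iff using bounded_borel_sgn_kernel(2)[OF elim, of b] by auto
      from law[OF bounded_borel_sgn_kernel(1)[OF elim] this]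
      show ?case using expectation_sgn_kernel[OF sol t elim] by simp
    qed
  qed
  ultimately show ?thesis
    using tendsto_unique trivial_limit_at_right_real by blast
qed

section \<open>Comparison for reflecting diffusions\<close>

lemma reflecting_weak_solutionD:
  assumes "reflecting_weak_solution b s x M F B L X"
  shows "brownian_motion_from s M F B" "adapted_on s F X" "adapted_on s F L"
    "AE \<omega> in M. continuous_on {s..} (\<lambda>t. X t \<omega>) \<and> (\<forall>t\<ge>s. 0 \<le> X t \<omega>) \<and>
       (\<forall>t\<ge>s. set_integrable lborel {s..t} (\<lambda>r. b r (X r \<omega>)) \<and>
              X t \<omega> = x + (LBINT r:{s..t}. b r (X r \<omega>)) + B t \<omega> + L t \<omega>) \<and>
       continuous_on {s..} (\<lambda>t. L t \<omega>) \<and> mono_on {s..} (\<lambda>t. L t \<omega>) \<and> L s \<omega> = 0 \<and>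
       (\<forall>u v. s \<le> u \<and> u \<le> v \<and> (\<forall>r\<in>{u..v}. X r \<omega> \<noteq> 0) \<longrightarrow> L u \<omega> = L v \<omega>)"
  using assms unfolding reflecting_weak_solution_def by blast+

text \<open>By \<open>neumann\<close> and the bound on \<open>uxx\<close>, \<open>ux r z\<close> is
  at most \<open>U * \<bar>z\<bar>\<close>. If \<open>L\<close> increases on an interval, the path
  visits 0 there, so |X a| is an oscillation of the path and the local time term is absorbed by the
  error. In \<open>gen\<close> the drift may be evaluated at any other time and place, since it
  cannot be frozen at \<open>a\<close>.\<close>

lemma reflecting_expectation_le:
  assumes s: "0 \<le> s" and st: "s < t" and \<kappa>: "0 \<le> \<kappa>"
    and b: "\<And>r z. 0 < r \<Longrightarrow> 0 \<le> z \<Longrightarrow> \<bar>b r z\<bar> \<le> \<kappa>"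
    and sol: "reflecting_weak_solution b s x M F B L X"
    and sm: "smooth_bounded s t U u ut ux uxx"
    and neumann: "\<And>r. r \<in> {s..t} \<Longrightarrow> ux r 0 = 0"
    and gen: "\<And>r z q z'. r \<in> {s..t} \<Longrightarrow> 0 \<le> z \<Longrightarrow> 0 < q \<Longrightarrow> 0 \<le> z' \<Longrightarrow>
      ut r z + uxx r z / 2 + ux r z * b q z' \<le> 0"
  shows "(\<integral>\<omega>. u t (X t \<omega>) \<partial>M) \<le> u s x"
proof -
  note solD = reflecting_weak_solutionD[OF sol]
  note bmD = brownian_motion_fromD[OF solD(1)]
  have U: "0 \<le> U" using smooth_boundedD(4)[OF sm, of s 0] st by auto
  have ux: "ux r z \<le> U * \<bar>z\<bar>" if r: "r \<in> {s..t}" for r z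
  proof -
    have "\<bar>ux r z - ux r 0\<bar> \<le> U * \<bar>z - 0\<bar>"
    proof (rule field_differentiable_bound[where S=UNIV and f'="uxx r", unfolded real_norm_def])
      show "(ux r has_real_derivative uxx r w) (at w within UNIV)" for w
        using smooth_boundedD(3)[OF sm r] by simp
      show "\<bar>uxx r w\<bar> \<le> U" for w by (rule smooth_boundedD(6)[OF sm r])
    qed auto
    then show ?thesis using neumann[OF r] by simp
  qed
  show ?thesis
  proof (rule expectation_smooth_le[OF solD(1) st sm solD(2) _ U])
    show "AE \<omega> in M. X s \<omega> = x"
      using solD(4) bmD(6)
    proof eventually_elim
      case (elim \<omega>)
      then have "X s \<omega> = x + (LBINT r:{s..s}. b r (X r \<omega>)) + B s \<omega> + L s \<omega>" by blast
      then show ?case using elim by (simp only: LBINT_singleton)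
    qed
    show "AE \<omega> in M. controlled_path s t (\<kappa> + 1) U ut ux uxx (\<lambda>r. X r \<omega>) (\<lambda>r. B r \<omega>)"
      using solD(4) bmD(6)
    proof eventually_elim
      case (elim \<omega>)
      then have pos: "\<And>r. s \<le> r \<Longrightarrow> 0 \<le> X r \<omega>"
        and flat: "\<And>u v. s \<le> u \<Longrightarrow> u \<le> v \<Longrightarrow> \<forall>r\<in>{u..v}. X r \<omega> \<noteq> 0 \<Longrightarrow> L u \<omega> = L v \<omega>"
        by blast+
      show ?case
      proof (rule drift_controlled_path[where c="\<lambda>r. b r (X r \<omega>)" and L="\<lambda>r. L r \<omega>" and x=x])
        show "continuous_on {s..t} (\<lambda>r. X r \<omega>)" "continuous_on {s..t} (\<lambda>r. B r \<omega>)"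
          using elim by (auto intro: continuous_on_subset)
        show "set_integrable lborel {s..t} (\<lambda>r. b r (X r \<omega>))"
          using elim st less_imp_le by blast
        show "X r \<omega> = x + (LBINT q:{s..r}. b q (X q \<omega>)) + B r \<omega> + L r \<omega>" if "r \<in> {s..t}" for r
          using elim that by simp
        show "\<bar>b q (X q \<omega>)\<bar> \<le> \<kappa>" if "q \<in> {s..t}" "0 < q" for q
          using that by (intro b pos) auto
        show "mono_on {s..t} (\<lambda>r. L r \<omega>)"
          using elim by (auto intro: mono_on_subset)
        show "ut a (X a \<omega>) + uxx a (X a \<omega>) / 2 + ux a (X a \<omega>) * b q (X q \<omega>) \<le> U * \<bar>X q \<omega> - X a \<omega>\<bar>"
          if "a \<in> {s..t}" "q \<in> {a..t}" "0 < q" for a q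
        proof -
          have "ut a (X a \<omega>) + uxx a (X a \<omega>) / 2 + ux a (X a \<omega>) * b q (X q \<omega>) \<le> 0"
            using that by (intro gen pos) auto
          also have "0 \<le> U * \<bar>X q \<omega> - X a \<omega>\<bar>" using U by simp
          finally show ?thesis .
        qed
        show "\<exists>q\<in>{a'..b'}. ux a' (X a' \<omega>) \<le> U * \<bar>X q \<omega> - X a' \<omega>\<bar>"
          if "s \<le> a'" "a' \<le> b'" "b' \<le> t" "L a' \<omega> \<noteq> L b' \<omega>" for a' b'
        proof -
          have "\<not> (\<forall>q\<in>{a'..b'}. X q \<omega> \<noteq> 0)" using flat[of a' b'] that by blast
          then obtain q where "q \<in> {a'..b'}" "X q \<omega> = 0" by blast
          moreover have "ux a' (X a' \<omega>) \<le> U * \<bar>X a' \<omega>\<bar>" using that by (intro ux) simp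
          ultimately show ?thesis by (intro bexI[of _ q]) simp_all
        qed
      qed (use s st \<kappa> U in simp_all)
    qed
  qed (use \<kappa> in simp)
qed

text \<open>The sign \<open>\<sigma>\<close> is \<open>1\<close> for the upper and \<open>- 1\<close> for the lower bound.\<close>

lemma reflecting_kernel_comparison:
  assumes s: "0 \<le> s" and st: "s < t" and \<kappa>: "0 \<le> \<kappa>" and \<epsilon>: "0 < \<epsilon>" and \<sigma>: "\<bar>\<sigma>\<bar> = 1"
    and b: "\<And>r z. 0 < r \<Longrightarrow> 0 \<le> z \<Longrightarrow> \<bar>b r z\<bar> \<le> \<kappa>"
    and sol: "reflecting_weak_solution b s x M F B L X"
  defines "\<beta> \<equiv> \<sigma> * \<kappa>"
  shows "\<sigma> * (\<integral>\<omega>. sgn_kernel \<beta> \<epsilon> (X t \<omega> - y) + sgn_kernel \<beta> \<epsilon> (X t \<omega> - - y) \<partial>M)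
    \<le> \<sigma> * (sgn_kernel \<beta> (t - s + \<epsilon>) (x - y) + sgn_kernel \<beta> (t - s + \<epsilon>) (x - - y))"
proof -
  define T where "T = t + \<epsilon>"
  have T: "s \<le> t" "t < T" using st \<epsilon> by (auto simp: T_def)
  \<comment> \<open>Valid for every admissible drift value and for each image separately;
    multiplication by \<sigma> reduces both bounds to one inequality.\<close>
  have gen: "\<sigma> * (- sgn_kernel_t \<beta> \<tau> w + sgn_kernel_xx \<beta> \<tau> w / 2 + sgn_kernel_x \<beta> \<tau> w * c) \<le> 0"
    if "0 < \<tau>" "\<bar>c\<bar> \<le> \<kappa>" for \<tau> w c
  proof -
    have "\<bar>\<sigma> * c * w\<bar> \<le> \<kappa> * \<bar>w\<bar>" using that \<sigma> by (simp add: abs_mult mult_right_mono)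
    then have "0 \<le> \<kappa> * \<bar>w\<bar> + \<sigma> * c * w" by linarith
    moreover have "\<sigma> * \<sigma> = 1" using \<sigma> by (auto simp: abs_if split: if_splits)
    then have "\<sigma> * (\<beta> * \<bar>w\<bar> + c * w) = \<kappa> * \<bar>w\<bar> + \<sigma> * c * w"
      by (simp add: \<beta>_def distrib_left mult.assoc[symmetric])
    moreover have "0 \<le> gauss \<tau> (\<bar>w\<bar> - \<beta> * \<tau>) / \<tau>" using gauss_nonneg[OF that(1)] that by simp
    ultimately have "0 \<le> gauss \<tau> (\<bar>w\<bar> - \<beta> * \<tau>) / \<tau> * (\<sigma> * (\<beta> * \<bar>w\<bar> + c * w))"
      by (metis mult_nonneg_nonneg)
    moreover have "\<sigma> * (- sgn_kernel_t \<beta> \<tau> w + sgn_kernel_xx \<beta> \<tau> w / 2 + sgn_kernel_x \<beta> \<tau> w * c)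
      = - (gauss \<tau> (\<bar>w\<bar> - \<beta> * \<tau>) / \<tau> * (\<sigma> * (\<beta> * \<bar>w\<bar> + c * w)))"
      unfolding sgn_kernel_generator[OF that(1)] by (simp only: mult_minus_left mult_minus_right mult.left_commute)
    ultimately show ?thesis by linarith
  qed
  obtain U1 where sm1: "smooth_bounded s t U1 (\<lambda>r z. sgn_kernel \<beta> (T - r) (z - y))
    (\<lambda>r z. - sgn_kernel_t \<beta> (T - r) (z - y)) (\<lambda>r z. sgn_kernel_x \<beta> (T - r) (z - y))
    (\<lambda>r z. sgn_kernel_xx \<beta> (T - r) (z - y))"
    by (rule smooth_bounded_sgn_kernel[OF T])
  obtain U2 where sm2: "smooth_bounded s t U2 (\<lambda>r z. sgn_kernel \<beta> (T - r) (z - - y))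
    (\<lambda>r z. - sgn_kernel_t \<beta> (T - r) (z - - y)) (\<lambda>r z. sgn_kernel_x \<beta> (T - r) (z - - y))
    (\<lambda>r z. sgn_kernel_xx \<beta> (T - r) (z - - y))"
    by (rule smooth_bounded_sgn_kernel[OF T])
  note sm = smooth_bounded_cmult[OF smooth_bounded_add[OF sm1 sm2], of \<sigma>]
  have "(\<integral>\<omega>. \<sigma> * (sgn_kernel \<beta> (T - t) (X t \<omega> - y) + sgn_kernel \<beta> (T - t) (X t \<omega> - - y)) \<partial>M)
    \<le> \<sigma> * (sgn_kernel \<beta> (T - s) (x - y) + sgn_kernel \<beta> (T - s) (x - - y))"
  proof (rule reflecting_expectation_le[OF s st \<kappa> b sol sm])
    \<comment> \<open>The first derivative of the kernel is odd, so the contributions of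
      \<open>y\<close> and \<open>- y\<close> cancel on the boundary.\<close>
    show "\<sigma> * (sgn_kernel_x \<beta> (T - r) (0 - y) + sgn_kernel_x \<beta> (T - r) (0 - - y)) = 0" for r
      by (simp add: sgn_kernel_x_def)
    fix r z q z' :: real assume r: "r \<in> {s..t}" and "0 \<le> z" "0 < q" "0 \<le> z'"
    have Tr: "0 < T - r" using r T by simp
    have bq: "\<bar>b q z'\<bar> \<le> \<kappa>" by (rule b) fact+
    show "\<sigma> * (- sgn_kernel_t \<beta> (T - r) (z - y) + - sgn_kernel_t \<beta> (T - r) (z - - y))
        + \<sigma> * (sgn_kernel_xx \<beta> (T - r) (z - y) + sgn_kernel_xx \<beta> (T - r) (z - - y)) / 2
        + \<sigma> * (sgn_kernel_x \<beta> (T - r) (z - y) + sgn_kernel_x \<beta> (T - r) (z - - y)) * b q z' \<le> 0"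
      using add_mono[OF gen[OF Tr bq, of "z - y"] gen[OF Tr bq, of "z - - y"]]
      by (simp add: algebra_simps add_divide_distrib)
  qed
  moreover have "T - t = \<epsilon>" "T - s = t - s + \<epsilon>" by (simp_all add: T_def)
  ultimately show ?thesis by (simp only: integral_mult_right_zero)
qed

text \<open>For \<open>y = 0\<close> half of the kernel's mass falls outside the half line, but
  there the two images coincide. Passing to an even extension of the density treats
  \<open>y = 0\<close> and \<open>y > 0\<close> alike.\<close>

lemma reflecting_transition_density_bound:
  assumes s: "0 \<le> s" and st: "s < t" and x: "0 \<le> x" and y: "0 \<le> y" and \<kappa>: "0 \<le> \<kappa>" and \<sigma>: "\<bar>\<sigma>\<bar> = 1"
    and b: "bounded_drift \<kappa> b" and dens: "reflecting_transition_density TYPE('a) b q"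
  defines "\<beta> \<equiv> \<sigma> * \<kappa>"
  shows "\<sigma> * q s x t y \<le> \<sigma> * (sgn_kernel \<beta> (t - s) (x - y) + sgn_kernel \<beta> (t - s) (x - - y))"
proof -
  obtain M :: "'a measure" and F B L X where sol: "reflecting_weak_solution b s x M F B L X"
    using dens s x unfolding reflecting_transition_density_def by blast
  interpret prob_space M
    by (rule brownian_motion_fromD(1)[OF reflecting_weak_solutionD(1)[OF sol]])
  have law: "(LINT \<omega>|M. f (X t \<omega>)) = (LBINT y:{0..}. q s x t y * f y)"
    if "f \<in> borel_measurable borel" "bounded (range f)" for f
    using dens s x sol st that unfolding reflecting_transition_density_def by blast
  have bb: "\<And>r z. 0 < r \<Longrightarrow> 0 \<le> z \<Longrightarrow> \<bar>b r z\<bar> \<le> \<kappa>"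
    using b by (simp add: bounded_drift_def)
  \<comment> \<open>Integrating the sum of the two kernels over the half line amounts to integrating one of them
      against the even extension \<open>Q\<close> of the density, which is continuous also at \<open>0\<close>.\<close>
  define Q1 where "Q1 z = indicator {0..} z * q s x t z" for z
  define Q where "Q z = q s x t \<bar>z\<bar>" for z
  have contq: "continuous_on {0..} (q s x t)"
  proof -
    have "continuous_on {(s, x, t, y). 0 \<le> s \<and> s < t \<and> 0 \<le> x \<and> 0 \<le> y} (\<lambda>(s, x, t, y). q s x t y)"
      using dens unfolding reflecting_transition_density_def by blast
    moreover have "continuous_on {0..} (\<lambda>y. (s, x, t, y))" by (intro continuous_intros)
    ultimately have "continuous_on {0..} (\<lambda>y. case (s, x, t, y) of (s, x, t, y) \<Rightarrow> q s x t y)"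
      by (rule continuous_on_compose2) (use s st x in auto)
    then show ?thesis by simp
  qed
  have contQ: "continuous_on UNIV Q"
    unfolding Q_def by (rule continuous_on_compose2[OF contq]) (auto intro!: continuous_intros)
  have Q1: "integrable lborel Q1"
  proof -
    have "(LBINT z. Q1 z) = 1"
      using law[of "\<lambda>_. 1"] by (simp add: prob_space set_lebesgue_integral_def Q1_def)
    then show ?thesis using not_integrable_integral_eq by fastforce
  qed
  have Q1': "integrable lborel (\<lambda>z. Q1 (- z))"
    using lborel_integrable_real_affine[OF Q1, of "- 1" 0] by simp
  \<comment> \<open>May fail at 0, where both half-line terms contribute.\<close>
  have AEQ: "AE z in lborel. Q1 z + Q1 (- z) = Q z"
    using AE_lborel_singleton[of 0] by eventually_elim (auto simp: Q1_def Q_def indicator_def)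
  have [measurable]: "Q \<in> borel_measurable borel"
    by (rule borel_measurable_continuous_onI[OF contQ])
  have Q: "integrable lborel Q"
    by (rule integrable_cong_AE_imp[OF Bochner_Integration.integrable_add[OF Q1 Q1'] _ AEQ]) measurable
  have fold: "(LBINT z. Q z * sgn_kernel \<beta> \<epsilon> (z - y))
      = (\<integral>\<omega>. sgn_kernel \<beta> \<epsilon> (X t \<omega> - y) + sgn_kernel \<beta> \<epsilon> (X t \<omega> - - y) \<partial>M)" if \<epsilon>: "0 < \<epsilon>" for \<epsilon>
  proof -
    note [measurable] = bounded_borel_sgn_kernel(1)[OF \<epsilon>]
    have flip: "sgn_kernel \<beta> \<epsilon> (- z - y) = sgn_kernel \<beta> \<epsilon> (z - - y)" for z
      using sgn_kernel_minus[of \<beta> \<epsilon> "z - - y"] by simp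
    have [measurable]: "Q1 \<in> borel_measurable borel"
      using borel_measurable_integrable[OF Q1] by simp
    have i1: "integrable lborel (\<lambda>z. Q1 z * sgn_kernel \<beta> \<epsilon> (z - y))"
      and i2: "integrable lborel (\<lambda>z. Q1 (- z) * sgn_kernel \<beta> \<epsilon> (z - y))"
      and i3: "integrable lborel (\<lambda>z. Q1 z * sgn_kernel \<beta> \<epsilon> (z - - y))"
      by (intro integrable_mult_sgn_kernel Q1 Q1' \<epsilon>)+
    have "(LBINT z. Q z * sgn_kernel \<beta> \<epsilon> (z - y))
        = (LBINT z. Q1 z * sgn_kernel \<beta> \<epsilon> (z - y) + Q1 (- z) * sgn_kernel \<beta> \<epsilon> (z - y))"
    proof (rule integral_cong_AE)
      show "AE z in lborel. Q z * sgn_kernel \<beta> \<epsilon> (z - y)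
          = Q1 z * sgn_kernel \<beta> \<epsilon> (z - y) + Q1 (- z) * sgn_kernel \<beta> \<epsilon> (z - y)"
        using AEQ by eventually_elim (simp add: distrib_right[symmetric])
    qed measurable
    also have "\<dots> = (LBINT z. Q1 z * sgn_kernel \<beta> \<epsilon> (z - y)) + (LBINT z. Q1 (- z) * sgn_kernel \<beta> \<epsilon> (z - y))"
      by (rule Bochner_Integration.integral_add[OF i1 i2])
    also have "(LBINT z. Q1 (- z) * sgn_kernel \<beta> \<epsilon> (z - y)) = (LBINT z. Q1 z * sgn_kernel \<beta> \<epsilon> (z - - y))"
      by (subst lborel_integral_real_affine[where c="- 1" and t=0]) (simp_all add: flip)
    also have "(LBINT z. Q1 z * sgn_kernel \<beta> \<epsilon> (z - y)) + (LBINT z. Q1 z * sgn_kernel \<beta> \<epsilon> (z - - y))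
        = (LBINT z. Q1 z * sgn_kernel \<beta> \<epsilon> (z - y) + Q1 z * sgn_kernel \<beta> \<epsilon> (z - - y))"
      by (rule Bochner_Integration.integral_add[OF i1 i3, symmetric])
    also have "\<dots> = (LBINT z:{0..}. q s x t z * (sgn_kernel \<beta> \<epsilon> (z - y) + sgn_kernel \<beta> \<epsilon> (z - - y)))"
      unfolding set_lebesgue_integral_def Q1_def
      by (rule Bochner_Integration.integral_cong) (simp_all add: distrib_left mult.assoc)
    also have "\<dots> = (\<integral>\<omega>. sgn_kernel \<beta> \<epsilon> (X t \<omega> - y) + sgn_kernel \<beta> \<epsilon> (X t \<omega> - - y) \<partial>M)"
    proof (rule law[symmetric])
      have "\<bar>sgn_kernel \<beta> \<epsilon> (z - y) + sgn_kernel \<beta> \<epsilon> (z - - y)\<bar> \<le> 2 * sgn_kernel \<beta> \<epsilon> 0" for z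
        using bounded_borel_sgn_kernel(2)[OF \<epsilon>, of \<beta> "z - y"] bounded_borel_sgn_kernel(2)[OF \<epsilon>, of \<beta> "z - - y"]
        by linarith
      then show "bounded (range (\<lambda>z. sgn_kernel \<beta> \<epsilon> (z - y) + sgn_kernel \<beta> \<epsilon> (z - - y)))"
        unfolding bounded_iff by auto
    qed measurable
    finally show ?thesis .
  qed
  have lim1: "((\<lambda>\<epsilon>. \<sigma> * (LBINT z. Q z * sgn_kernel \<beta> \<epsilon> (z - y))) \<longlongrightarrow> \<sigma> * Q y) (at_right 0)"
    using contQ by (intro tendsto_intros sgn_kernel_approximate_identity Q)
      (simp add: continuous_on_eq_continuous_at)
  have lim2: "((\<lambda>\<epsilon>. \<sigma> * (sgn_kernel \<beta> (t - s + \<epsilon>) (x - y) + sgn_kernel \<beta> (t - s + \<epsilon>) (x - - y)))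
      \<longlongrightarrow> \<sigma> * (sgn_kernel \<beta> (t - s) (x - y) + sgn_kernel \<beta> (t - s) (x - - y))) (at_right 0)"
    using st by (intro tendsto_intros sgn_kernel_continuous_time) simp_all
  have ev: "\<forall>\<^sub>F \<epsilon> in at_right 0. \<sigma> * (LBINT z. Q z * sgn_kernel \<beta> \<epsilon> (z - y))
      \<le> \<sigma> * (sgn_kernel \<beta> (t - s + \<epsilon>) (x - y) + sgn_kernel \<beta> (t - s + \<epsilon>) (x - - y))"
    using eventually_at_right_less[of 0]
  proof eventually_elim
    case (elim \<epsilon>)
    show ?case
      unfolding fold[OF elim]
      by (rule reflecting_kernel_comparison[OF s st \<kappa> elim \<sigma> bb sol, folded \<beta>_def])
  qed
  have "\<sigma> * Q y \<le> \<sigma> * (sgn_kernel \<beta> (t - s) (x - y) + sgn_kernel \<beta> (t - s) (x - - y))"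
    by (rule tendsto_le[OF trivial_limit_at_right_real lim2 lim1 ev])
  then show ?thesis using y by (simp add: Q_def)
qed

section \<open>Reflecting Brownian motion with constant drift\<close>

text \<open>Solutions are required from every starting time, whereas the available Brownian motion
  starts at time 0. The filtration is indexed by all reals, so it can be shifted as a whole.\<close>

lemma brownian_motion_from_shift:
  assumes bm: "brownian_motion_from 0 M F B"
  shows "brownian_motion_from s M (\<lambda>t. F (t - s)) (\<lambda>t. B (t - s))"
proof -
  note bmD = brownian_motion_fromD[OF bm]
  have 1: "filtered_prob_space M (\<lambda>t. F (t - s))"
    unfolding filtered_prob_space_def filtration_def subalgebra_def
    using bmD(1-4) by (simp add: bmD)
  have 2: "adapted_on s (\<lambda>t. F (t - s)) (\<lambda>t. B (t - s))"
    unfolding adapted_on_def by (simp add: bmD)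
  have 3: "AE \<omega> in M. B (s - s) \<omega> = 0 \<and> continuous_on {s..} (\<lambda>t. B (t - s) \<omega>)"
    using bmD(6)
  proof eventually_elim
    case (elim \<omega>)
    have "continuous_on {s..} (\<lambda>t. B (t - s) \<omega>)"
      by (rule continuous_on_compose2[of "{0..}" "\<lambda>t. B t \<omega>"]) (use elim in \<open>auto intro!: continuous_intros\<close>)
    then show ?case using elim by simp
  qed
  have 4: "distributed M lborel (\<lambda>\<omega>. B (t - s) \<omega> - B (u - s) \<omega>) (normal_density 0 (sqrt (t - u))) \<and>
        prob_space.indep_set M (sets (F (u - s)))
          {(\<lambda>\<omega>. B (t - s) \<omega> - B (u - s) \<omega>) -` A \<inter> space M |A. A \<in> sets borel}"
    if "s \<le> u \<and> u < t" for u t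
    using bmD(7)[of "u - s" "t - s"] bmD(8)[of "u - s" "t - s"] that by simp
  show ?thesis
    unfolding brownian_motion_from_def using 1 2 3 4 by blast
qed

text \<open>
  The supremum of \<open>max 0 (- y)\<close> over \<open>[s, t]\<close>, taken over countably many points so that it is
  measurable as a functional of the path without any path regularity.
\<close>

definition skorokhod_push :: "real \<Rightarrow> (real \<Rightarrow> real) \<Rightarrow> real \<Rightarrow> real" where
  "skorokhod_push s y t = real_of_ereal (SUP p :: nat \<times> nat.
     ereal (max 0 (- y (s + (t - s) * min 1 (real (fst p) / real (Suc (snd p)))))))"

text \<open>The sample points are dense in [s, t], so for a continuous path the countable supremum
  is the maximum over the interval. The point of attainment is what later arguments use.\<close>

lemma skorokhod_push_attained:
  assumes cont: "continuous_on {s..} y" and st: "s \<le> t"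
  shows "\<exists>r\<in>{s..t}. skorokhod_push s y t = max 0 (- y r) \<and> (\<forall>r'\<in>{s..t}. max 0 (- y r') \<le> max 0 (- y r))"
proof -
  define f where "f r = max 0 (- y r)" for r
  have contf: "continuous_on {s..t} f"
    unfolding f_def by (intro continuous_intros continuous_on_subset[OF cont]) auto
  obtain r where r: "r \<in> {s..t}" "\<And>r'. r' \<in> {s..t} \<Longrightarrow> f r' \<le> f r"
    using continuous_attains_sup[OF compact_Icc _ contf] st by auto
  define g where "g p = s + (t - s) * min 1 (real (fst p) / real (Suc (snd p)))" for p :: "nat \<times> nat"
  have g: "g p \<in> {s..t}" for p
  proof -
    have "0 \<le> min 1 (real (fst p) / real (Suc (snd p)))" "min 1 (real (fst p) / real (Suc (snd p))) \<le> 1" by auto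
    from mult_left_mono[OF this(2), of "t - s"] mult_nonneg_nonneg[OF _ this(1), of "t - s"]
    show ?thesis using st unfolding g_def by simp
  qed
  have "(SUP p. ereal (f (g p))) = ereal (f r)"
  proof (rule SUP_eqI)
    show "ereal (f (g p)) \<le> ereal (f r)" for p using r(2)[OF g] by simp
    fix u assume u: "\<And>p. p \<in> UNIV \<Longrightarrow> ereal (f (g p)) \<le> u"
    show "ereal (f r) \<le> u"
    proof (rule ereal_le_epsilon2)
      fix e :: real assume e: "0 < e"
      have "uniformly_continuous_on {s..t} f" by (rule compact_uniformly_continuous[OF contf compact_Icc])
      then obtain d where d: "0 < d" "\<And>a b. a \<in> {s..t} \<Longrightarrow> b \<in> {s..t} \<Longrightarrow> \<bar>b - a\<bar> < d \<Longrightarrow> \<bar>f b - f a\<bar> < e"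
        unfolding uniformly_continuous_on_def dist_real_def using e by metis
      obtain n where n: "(t - s) / d < real n" using reals_Archimedean2 by blast
      define \<theta> where "\<theta> = (if s = t then 0 else (r - s) / (t - s))"
      have \<theta>: "0 \<le> \<theta>" "\<theta> \<le> 1" "r = s + (t - s) * \<theta>" using r(1) st by (auto simp: \<theta>_def)
      \<comment> \<open>Rounds the relative position \<theta> of the maximiser down to a multiple of
        1/(n + 1); the grid point then lies within (t - s)/(n + 1) < d of it.\<close>
      define i where "i = nat \<lfloor>\<theta> * real (Suc n)\<rfloor>"
      have i0: "real i = of_int \<lfloor>\<theta> * real (Suc n)\<rfloor>" using \<theta>(1) by (simp add: i_def)
      have i: "real i \<le> \<theta> * real (Suc n)" "\<theta> * real (Suc n) < real i + 1"
        unfolding i0 by linarith+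
      define \<phi> where "\<phi> = real i / real (Suc n)"
      have \<phi>: "\<phi> \<le> \<theta>" "\<theta> - \<phi> \<le> 1 / real (Suc n)"
      proof -
        show "\<phi> \<le> \<theta>" unfolding \<phi>_def using i(1) by (simp add: pos_divide_le_eq del: of_nat_Suc)
        have "\<theta> \<le> (real i + 1) / real (Suc n)"
          using i(2) by (simp add: pos_le_divide_eq del: of_nat_Suc)
        then show "\<theta> - \<phi> \<le> 1 / real (Suc n)" by (simp add: \<phi>_def add_divide_distrib del: of_nat_Suc)
      qed
      have "min 1 \<phi> = \<phi>" using \<phi>(1) \<theta>(2) by linarith
      then have "g (i, n) = s + (t - s) * \<phi>" by (simp only: g_def \<phi>_def fst_conv snd_conv)
      then have "\<bar>g (i, n) - r\<bar> = (t - s) * (\<theta> - \<phi>)"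
        using \<phi>(1) st unfolding \<theta>(3) by (simp add: abs_mult right_diff_distrib[symmetric])
      also have "\<dots> \<le> (t - s) * (1 / real (Suc n))" using st by (intro mult_left_mono \<phi>) auto
      also have "\<dots> < d"
      proof -
        have "(t - s) < d * real n" using n d(1) by (simp add: field_simps)
        also have "\<dots> \<le> d * real (Suc n)" using d(1) by simp
        finally show ?thesis by (simp add: field_simps)
      qed
      finally have "\<bar>f (g (i, n)) - f r\<bar> < e" by (rule d(2)[OF r(1) g])
      then have "f r \<le> f (g (i, n)) + e" by linarith
      then have "ereal (f r) \<le> ereal (f (g (i, n))) + ereal e" by simp
      also have "\<dots> \<le> u + ereal e" using u by (intro add_mono) auto
      finally show "ereal (f r) \<le> u + ereal e" .
    qed
  qed
  then have "skorokhod_push s y t = f r"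
    unfolding skorokhod_push_def g_def[symmetric] f_def[symmetric] by simp
  then show ?thesis using r unfolding f_def by blast
qed

text \<open>If \<open>L\<close> grows from \<open>u\<close> to \<open>v\<close>, the maximum
  defining \<open>L v\<close> is attained at some \<open>r\<close> in (u, v]; there
  \<open>L r = L v = - y r\<close>, so the reflected path is 0. For continuity, growth of
  \<open>L\<close> over a short interval is at most the oscillation of \<open>max 0 (- y)\<close> on
  it.\<close>

lemma skorokhod_push_properties:
  assumes cont: "continuous_on {s..} y" and ys: "0 \<le> y s"
  defines "L \<equiv> skorokhod_push s y"
  shows "\<And>t. s \<le> t \<Longrightarrow> 0 \<le> y t + L t" "mono_on {s..} L" "L s = 0" "continuous_on {s..} L"
    "\<And>u v. s \<le> u \<Longrightarrow> u \<le> v \<Longrightarrow> \<forall>r\<in>{u..v}. y r + L r \<noteq> 0 \<Longrightarrow> L u = L v"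
proof -
  define f where "f r = max 0 (- y r)" for r
  have contf: "continuous_on {s..} f" unfolding f_def by (intro continuous_intros cont)
  have att: "\<exists>r\<in>{s..t}. L t = f r \<and> (\<forall>r'\<in>{s..t}. f r' \<le> f r)" if "s \<le> t" for t
    using skorokhod_push_attained[OF cont that] unfolding f_def L_def .
  have ge: "f r \<le> L t" if "s \<le> r" "r \<le> t" for r t
    using att[of t] that by fastforce
  show "0 \<le> y t + L t" if "s \<le> t" for t
    using ge[of t t] that by (simp add: f_def)
  have mono: "L u \<le> L v" if "s \<le> u" "u \<le> v" for u v
    using att[of u] ge[of _ v] that by fastforce
  then show "mono_on {s..} L" by (auto simp: mono_on_def)
  show "L s = 0" using att[of s] ys by (auto simp: f_def)
  show "L u = L v" if uv: "s \<le> u" "u \<le> v" and nz: "\<forall>r\<in>{u..v}. y r + L r \<noteq> 0" for u v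
  proof (rule ccontr)
    assume "L u \<noteq> L v"
    then have lt: "L u < L v" using mono[OF uv] by simp
    obtain r where r: "s \<le> r" "r \<le> v" "L v = f r" using att[of v] uv by auto
    have "u < r" using ge[of r u] r lt by fastforce
    have "0 \<le> L u" using ge[of u u] uv by (simp add: f_def)
    then have "L v = - y r" using lt r(3) by (auto simp: f_def max_def split: if_splits)
    moreover have "L r = L v" using ge[of r r] mono[of r v] r by simp
    ultimately have "y r + L r = 0" using r(3) by simp
    moreover have "r \<in> {u..v}" using \<open>u < r\<close> r by simp
    ultimately show False using nz by blast
  qed
  show "continuous_on {s..} L"
    unfolding continuous_on_iff dist_real_def
  proof (intro ballI allI impI)
    fix t and e :: real assume t: "t \<in> {s..}" and e: "0 < e"
    have "uniformly_continuous_on {s..t + 1} f"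
      by (rule compact_uniformly_continuous[OF continuous_on_subset[OF contf] compact_Icc]) auto
    then obtain d where d: "0 < d"
      "\<And>a b. a \<in> {s..t + 1} \<Longrightarrow> b \<in> {s..t + 1} \<Longrightarrow> \<bar>b - a\<bar> < d \<Longrightarrow> \<bar>f b - f a\<bar> < e"
      unfolding uniformly_continuous_on_def dist_real_def using e by metis
    have step: "L v < L u + e" if uv: "s \<le> u" "u \<le> v" "v \<le> t + 1" "v - u < d" for u v
    proof -
      obtain r where r: "s \<le> r" "r \<le> v" "L v = f r" using att[of v] uv by auto
      show ?thesis
      proof (cases "r \<le> u")
        case True
        then show ?thesis using ge[of r u] r e by linarith
      next
        case False
        then have "\<bar>f r - f u\<bar> < e" using r uv by (intro d) auto
        then show ?thesis using ge[of u u] uv r by linarith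
      qed
    qed
    show "\<exists>d>0. \<forall>x'\<in>{s..}. \<bar>x' - t\<bar> < d \<longrightarrow> \<bar>L x' - L t\<bar> < e"
    proof (intro exI[of _ "min d 1"] conjI ballI impI)
      fix v assume v: "v \<in> {s..}" "\<bar>v - t\<bar> < min d 1"
      show "\<bar>L v - L t\<bar> < e"
      proof (cases "v \<le> t")
        case True
        then show ?thesis using step[of v t] mono[of v t] v t e by auto
      next
        case False
        then show ?thesis using step[of t v] mono[of t v] v t e by auto
      qed
    qed (use d in simp)
  qed
qed

text \<open>With a constant drift the unreflected path \<open>Y\<close> does not depend on
  \<open>X\<close>, so reflecting \<open>Y\<close> solves the equation directly, without a fixed
  point argument.\<close>

lemma reflected_drifted_brownian_motion:
  assumes bm: "brownian_motion_from s M F B" and x: "0 \<le> x"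
  obtains L X where "reflecting_weak_solution (\<lambda>_ _. \<mu>) s x M F B L X"
proof -
  note bmD = brownian_motion_fromD[OF bm]
  define Y where "Y t \<omega> = x + \<mu> * (t - s) + B t \<omega>" for t \<omega>
  define L where "L t \<omega> = skorokhod_push s (\<lambda>r. Y r \<omega>) t" for t \<omega>
  define X where "X t \<omega> = Y t \<omega> + L t \<omega>" for t \<omega>
  have Ym: "Y r \<in> borel_measurable (F t)" if "s \<le> r" "r \<le> t" for r t
    unfolding Y_def
    by (intro borel_measurable_add borel_measurable_const filtered_measurable_mono[OF bm bmD(5)[OF that(1)] that(2)])
  have Lm: "L t \<in> borel_measurable (F t)" if t: "s \<le> t" for t
  proof -
    have [measurable]: "Y (s + (t - s) * min 1 (real (fst p) / real (Suc (snd p)))) \<in> borel_measurable (F t)"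
      for p :: "nat \<times> nat"
    proof (rule Ym)
      have "0 \<le> min 1 (real (fst p) / real (Suc (snd p)))" "min 1 (real (fst p) / real (Suc (snd p))) \<le> 1" by auto
      from mult_left_mono[OF this(2), of "t - s"] mult_nonneg_nonneg[OF _ this(1), of "t - s"]
      show "s \<le> s + (t - s) * min 1 (real (fst p) / real (Suc (snd p)))"
        "s + (t - s) * min 1 (real (fst p) / real (Suc (snd p))) \<le> t" using t by auto
    qed
    show ?thesis unfolding L_def skorokhod_push_def by measurable
  qed
  have "reflecting_weak_solution (\<lambda>_ _. \<mu>) s x M F B L X"
    unfolding reflecting_weak_solution_def
  proof (intro conjI bm)
    show "adapted_on s F L" using Lm by (simp add: adapted_on_def)
    show "adapted_on s F X"
      unfolding adapted_on_def X_def using Lm Ym by (auto intro!: borel_measurable_add)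
    show "AE \<omega> in M.
       continuous_on {s..} (\<lambda>t. X t \<omega>) \<and> (\<forall>t\<ge>s. 0 \<le> X t \<omega>) \<and>
       (\<forall>t\<ge>s. set_integrable lborel {s..t} (\<lambda>r. \<mu>) \<and>
              X t \<omega> = x + (LBINT r:{s..t}. \<mu>) + B t \<omega> + L t \<omega>) \<and>
       continuous_on {s..} (\<lambda>t. L t \<omega>) \<and> mono_on {s..} (\<lambda>t. L t \<omega>) \<and> L s \<omega> = 0 \<and>
       (\<forall>u v. s \<le> u \<and> u \<le> v \<and> (\<forall>r\<in>{u..v}. X r \<omega> \<noteq> 0) \<longrightarrow> L u \<omega> = L v \<omega>)"
      using bmD(6)
    proof eventually_elim
      case (elim \<omega>)
      have contY: "continuous_on {s..} (\<lambda>r. Y r \<omega>)"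
        unfolding Y_def using elim by (intro continuous_intros) auto
      have Ys: "0 \<le> Y s \<omega>" using elim x by (simp add: Y_def)
      have L_eq: "skorokhod_push s (\<lambda>r. Y r \<omega>) = (\<lambda>t. L t \<omega>)" by (simp add: L_def)
      note P = skorokhod_push_properties[OF contY Ys, unfolded L_eq]
      have "set_integrable lborel {s..t} (\<lambda>r. \<mu>)" for t
        by (cases "s \<le> t") (auto simp: set_integrable_def intro!: integrable_mult_left integrable_real_indicator)
      moreover have "X t \<omega> = x + (LBINT r:{s..t}. \<mu>) + B t \<omega> + L t \<omega>" if "s \<le> t" for t
        using that by (simp add: X_def Y_def set_lebesgue_integral_def mult.commute)
      moreover have "continuous_on {s..} (\<lambda>t. X t \<omega>)"
        unfolding X_def by (intro continuous_intros contY P(4))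
      ultimately show ?case using P unfolding X_def by blast
    qed
  qed
  then show ?thesis by (rule that)
qed

section \<open>Transition function of reflecting Brownian motion with drift\<close>

lemma smooth_bounded_gauss_cdf:
  assumes "s \<le> t" "t < T"
  obtains U where "smooth_bounded s t U (\<lambda>r z. gauss_cdf (T - r) (c - z - \<mu> * (T - r)))
    (\<lambda>r z. gauss (T - r) (c - z - \<mu> * (T - r)) * (\<mu> + (c - z - \<mu> * (T - r)) / (2 * (T - r))))
    (\<lambda>r z. - gauss (T - r) (c - z - \<mu> * (T - r)))
    (\<lambda>r z. - ((c - z - \<mu> * (T - r)) / (T - r)) * gauss (T - r) (c - z - \<mu> * (T - r)))"
proof -
  define T1 where "T1 = T - t"
  define T2 where "T2 = T - s"
  have T: "0 < T1" "T1 \<le> T2" using assms by (auto simp: T1_def T2_def)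
  define d where "d = (1 + 2 * T2) / sqrt (2 * pi * T1)"
  have d: "0 \<le> d" using T by (auto simp: d_def)
  define U where "U = 1 + d + d / T1"
  have dT: "0 \<le> d / T1" using d T by simp
  have bounds: "\<bar>gauss_cdf \<tau> w\<bar> \<le> U \<and> \<bar>- gauss \<tau> w\<bar> \<le> U \<and> \<bar>- (w / \<tau>) * gauss \<tau> w\<bar> \<le> U"
    if \<tau>: "T1 \<le> \<tau>" "\<tau> \<le> T2" for \<tau> w
  proof -
    have \<tau>0: "0 < \<tau>" using \<tau> T by simp
    define G where "G = gauss \<tau> w"
    have G: "0 \<le> G" "(1 + w\<^sup>2) * G \<le> d"
      using gauss_nonneg[OF \<tau>0] weighted_gauss_le[OF T(1) \<tau>] by (auto simp: G_def d_def)
    have "G \<le> (1 + w\<^sup>2) * G" using G by (simp add: distrib_right)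
    then have 1: "G \<le> d" using G by simp
    have "2 * \<bar>w\<bar> \<le> 1 + w\<^sup>2"
      using zero_le_power2[of "\<bar>w\<bar> - 1"] by (simp add: power2_diff)
    then have "\<bar>w\<bar> \<le> 1 + w\<^sup>2" by simp
    from mult_right_mono[OF this G(1)] G have 2: "\<bar>w\<bar> * G \<le> d" by linarith
    have "\<bar>- (w / \<tau>) * G\<bar> = \<bar>w\<bar> * G / \<tau>" using \<tau>0 G by (simp add: abs_mult)
    also have "\<dots> \<le> d / T1" using 2 d T \<tau> by (intro frac_le) auto
    finally show ?thesis
      using 1 G d dT gauss_cdf_bounds[of \<tau> w] unfolding U_def G_def[symmetric] by simp
  qed
  have pos: "0 < T - r" if "r \<in> {s..t}" for r using that assms by simp
  show ?thesis
  proof (rule that[of U], unfold smooth_bounded_def, intro conjI ballI allI)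
    show "continuous_on ({s..t} \<times> UNIV) (\<lambda>(r, z).
        gauss (T - r) (c - z - \<mu> * (T - r)) * (\<mu> + (c - z - \<mu> * (T - r)) / (2 * (T - r))))"
      unfolding case_prod_beta'
      by (intro continuous_intros) (use assms in \<open>auto simp: mem_Times_iff\<close>)
    show "continuous_on ({s..t} \<times> UNIV) (\<lambda>(r, z).
        - ((c - z - \<mu> * (T - r)) / (T - r)) * gauss (T - r) (c - z - \<mu> * (T - r)))"
      unfolding case_prod_beta'
      by (intro continuous_intros) (use assms in \<open>auto simp: mem_Times_iff\<close>)
    fix r z assume r: "r \<in> {s..t}"
    note p = pos[OF r]
    have dT: "((\<lambda>r. T - r) has_real_derivative 0 - 1) (at r)"
      by (rule DERIV_diff[OF DERIV_const DERIV_ident])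
    have dw: "((\<lambda>r. c - z - \<mu> * (T - r)) has_real_derivative 0 - \<mu> * (0 - 1)) (at r)"
      by (intro DERIV_diff DERIV_cmult DERIV_const DERIV_ident)
    show "((\<lambda>r. gauss_cdf (T - r) (c - z - \<mu> * (T - r))) has_real_derivative
        gauss (T - r) (c - z - \<mu> * (T - r)) * (\<mu> + (c - z - \<mu> * (T - r)) / (2 * (T - r)))) (at r)"
      by (rule DERIV_cong[OF gauss_cdf_real_deriv[OF dT dw p]]) simp
    have dz: "((\<lambda>z. c - z - \<mu> * (T - r)) has_real_derivative 0 - 1 - 0) (at z)"
      by (intro DERIV_diff DERIV_const DERIV_ident)
    show "((\<lambda>z. gauss_cdf (T - r) (c - z - \<mu> * (T - r))) has_real_derivative
        - gauss (T - r) (c - z - \<mu> * (T - r))) (at z)"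
      by (rule DERIV_cong[OF DERIV_chain2[OF gauss_cdf_deriv[OF p] dz]]) simp
    show "((\<lambda>z. - gauss (T - r) (c - z - \<mu> * (T - r))) has_real_derivative
        - ((c - z - \<mu> * (T - r)) / (T - r)) * gauss (T - r) (c - z - \<mu> * (T - r))) (at z)"
      by (rule DERIV_cong[OF DERIV_minus[OF DERIV_chain2[OF gauss_deriv[OF p] dz]]]) simp
    have "T1 \<le> T - r" "T - r \<le> T2" using r by (auto simp: T1_def T2_def)
    from bounds[OF this, of "c - z - \<mu> * (T - r)"]
    show "\<bar>gauss_cdf (T - r) (c - z - \<mu> * (T - r))\<bar> \<le> U"
      "\<bar>- gauss (T - r) (c - z - \<mu> * (T - r))\<bar> \<le> U"
      "\<bar>- ((c - z - \<mu> * (T - r)) / (T - r)) * gauss (T - r) (c - z - \<mu> * (T - r))\<bar> \<le> U" by auto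
  qed
qed

text \<open>
  Here \<open>z\<close> is the starting point and \<open>\<tau>\<close> the elapsed time. The weight \<open>exp (2 \<mu> y)\<close> of the image term
  makes the derivative in \<open>z\<close> vanish at \<open>z = 0\<close>.
\<close>

definition reflected_cdf :: "real \<Rightarrow> real \<Rightarrow> real \<Rightarrow> real \<Rightarrow> real" where
  "reflected_cdf \<mu> \<tau> z y = gauss_cdf \<tau> (y - z - \<mu> * \<tau>) - exp (2 * \<mu> * y) * gauss_cdf \<tau> (- y - z - \<mu> * \<tau>)"

definition reflected_density :: "real \<Rightarrow> real \<Rightarrow> real \<Rightarrow> real \<Rightarrow> real" where
  "reflected_density \<mu> \<tau> z y = gauss \<tau> (y - z - \<mu> * \<tau>)
    + exp (2 * \<mu> * y) * (gauss \<tau> (- y - z - \<mu> * \<tau>) - 2 * \<mu> * gauss_cdf \<tau> (- y - z - \<mu> * \<tau>))"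

lemma reflected_cdf_deriv:
  assumes "0 < \<tau>"
  shows "(reflected_cdf \<mu> \<tau> z has_real_derivative reflected_density \<mu> \<tau> z y) (at y)"
proof -
  have d1: "((\<lambda>y. y - z - \<mu> * \<tau>) has_real_derivative 1 - 0 - 0) (at y)"
    by (intro DERIV_diff DERIV_const DERIV_ident)
  have d2: "((\<lambda>y. - y - z - \<mu> * \<tau>) has_real_derivative - 1 - 0 - 0) (at y)"
    by (intro DERIV_diff DERIV_minus DERIV_const DERIV_ident)
  have d3: "((\<lambda>y. exp (2 * \<mu> * y)) has_real_derivative exp (2 * \<mu> * y) * (2 * \<mu> * 1)) (at y)"
    by (intro DERIV_fun_exp DERIV_cmult DERIV_ident)
  show ?thesis
    unfolding reflected_cdf_def[abs_def]
    by (rule DERIV_cong[OF DERIV_diff[OF DERIV_chain2[OF gauss_cdf_deriv[OF assms] d1]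
          DERIV_mult[OF d3 DERIV_chain2[OF gauss_cdf_deriv[OF assms] d2]]]])
       (simp add: reflected_density_def algebra_simps)
qed

lemma reflected_cdf_0: "reflected_cdf \<mu> \<tau> z 0 = 0"
  by (simp add: reflected_cdf_def)

text \<open>Completing the square. It makes the two Gaussians in the space derivative of
  \<open>reflected_cdf\<close> cancel at z = 0, which is the Neumann condition.\<close>

lemma gauss_reflect:
  assumes "0 < \<tau>"
  shows "exp (2 * \<mu> * y) * gauss \<tau> (- y - \<mu> * \<tau>) = gauss \<tau> (y - \<mu> * \<tau>)"
proof -
  have "2 * \<mu> * y + - ((- y - \<mu> * \<tau>)\<^sup>2 / (2 * \<tau>)) = - ((y - \<mu> * \<tau>)\<^sup>2 / (2 * \<tau>))"
    using assms by (simp add: field_simps power2_eq_square)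
  then show ?thesis unfolding gauss_def by (simp add: exp_add[symmetric])
qed

text \<open>The image point \<open>- y\<close> has distance y + z > 0 from \<open>z\<close>, so only
  the direct term survives. At z = y the Gaussian is centred at the jump, whence 1/2.\<close>

lemma reflected_cdf_at_right_0:
  assumes y: "0 < y" and z: "0 \<le> z"
  shows "((\<lambda>\<epsilon>. reflected_cdf \<mu> \<epsilon> z y) \<longlongrightarrow> (if z < y then 1 else if z = y then 1 / 2 else 0)) (at_right 0)"
proof -
  have yz: "0 < y + z" using y z by simp
  have eq: "- \<mu> * \<epsilon> - (y + z) = - y - z - \<mu> * \<epsilon>" for \<epsilon> by simp
  have 2: "((\<lambda>\<epsilon>. gauss_cdf \<epsilon> (- y - z - \<mu> * \<epsilon>)) \<longlongrightarrow> 0) (at_right 0)"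
    using gauss_limits_at_right_0(2)[OF yz, of "- \<mu>"] unfolding eq .
  have 1: "((\<lambda>\<epsilon>. gauss_cdf \<epsilon> (y - z - \<mu> * \<epsilon>)) \<longlongrightarrow> (if z < y then 1 else if z = y then 1 / 2 else 0)) (at_right 0)"
  proof -
    consider "z < y" | "z = y" | "y < z" by linarith
    then show ?thesis
    proof cases
      case 1
      then show ?thesis using gauss_limits_at_right_0(3)[of "y - z" \<mu>] by simp
    next
      case 2
      then show ?thesis using gauss_limits_at_right_0(4)[of 1 "- \<mu>"] by simp
    next
      case 3
      then show ?thesis using gauss_limits_at_right_0(2)[of "z - y" "- \<mu>"] by (simp add: algebra_simps)
    qed
  qed
  have "((\<lambda>\<epsilon>. gauss_cdf \<epsilon> (y - z - \<mu> * \<epsilon>) - exp (2 * \<mu> * y) * gauss_cdf \<epsilon> (- y - z - \<mu> * \<epsilon>))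
      \<longlongrightarrow> (if z < y then 1 else if z = y then 1 / 2 else 0) - exp (2 * \<mu> * y) * 0) (at_right 0)"
    by (intro tendsto_intros 1 2)
  then show ?thesis by (simp add: reflected_cdf_def)
qed

text \<open>Both Gaussian distribution functions solve the backward equation with drift \<mu>, so
  the generator term is exactly 0 and the sign \<sigma> is arbitrary; 1 and - 1 together give
  equality.\<close>

lemma expectation_reflected_cdf:
  assumes s: "0 \<le> s" and st: "s < t" and \<epsilon>: "0 < \<epsilon>"
    and sol: "reflecting_weak_solution (\<lambda>_ _. \<mu>) s x M F B L X"
  shows "(\<integral>\<omega>. reflected_cdf \<mu> \<epsilon> (X t \<omega>) y \<partial>M) = reflected_cdf \<mu> (t - s + \<epsilon>) x y"
proof -
  define T where "T = t + \<epsilon>"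
  have T: "s \<le> t" "t < T" using st \<epsilon> by (auto simp: T_def)
  define e where "e = - exp (2 * \<mu> * y)"
  obtain U1 where sm1: "smooth_bounded s t U1 (\<lambda>r z. gauss_cdf (T - r) (y - z - \<mu> * (T - r)))
    (\<lambda>r z. gauss (T - r) (y - z - \<mu> * (T - r)) * (\<mu> + (y - z - \<mu> * (T - r)) / (2 * (T - r))))
    (\<lambda>r z. - gauss (T - r) (y - z - \<mu> * (T - r)))
    (\<lambda>r z. - ((y - z - \<mu> * (T - r)) / (T - r)) * gauss (T - r) (y - z - \<mu> * (T - r)))"
    by (rule smooth_bounded_gauss_cdf[OF T])
  obtain U2 where sm2: "smooth_bounded s t U2 (\<lambda>r z. gauss_cdf (T - r) (- y - z - \<mu> * (T - r)))
    (\<lambda>r z. gauss (T - r) (- y - z - \<mu> * (T - r)) * (\<mu> + (- y - z - \<mu> * (T - r)) / (2 * (T - r))))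
    (\<lambda>r z. - gauss (T - r) (- y - z - \<mu> * (T - r)))
    (\<lambda>r z. - ((- y - z - \<mu> * (T - r)) / (T - r)) * gauss (T - r) (- y - z - \<mu> * (T - r)))"
    by (rule smooth_bounded_gauss_cdf[OF T])
  have gen: "g * (\<mu> + w / (2 * \<tau>)) + - (w / \<tau>) * g / 2 + - g * \<mu> = 0" if "0 < \<tau>" for g w \<tau> :: real
    using that by (simp add: field_simps)
  have ring: "\<sigma> * (P1 + e * P2) + \<sigma> * (N1 + e * N2) / 2 + \<sigma> * (- g1 + e * - g2) * \<mu>
      = \<sigma> * (P1 + N1 / 2 + - g1 * \<mu>) + \<sigma> * e * (P2 + N2 / 2 + - g2 * \<mu>)"
    for \<sigma> P1 P2 N1 N2 g1 g2 :: real
    by (simp add: field_simps)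
  have main: "(\<integral>\<omega>. \<sigma> * (gauss_cdf (T - t) (y - X t \<omega> - \<mu> * (T - t)) + e * gauss_cdf (T - t) (- y - X t \<omega> - \<mu> * (T - t))) \<partial>M)
      \<le> \<sigma> * (gauss_cdf (T - s) (y - x - \<mu> * (T - s)) + e * gauss_cdf (T - s) (- y - x - \<mu> * (T - s)))" for \<sigma>
  proof (rule reflecting_expectation_le[OF s st abs_ge_zero[of \<mu>] order_refl sol
      smooth_bounded_cmult[OF smooth_bounded_add[OF sm1 smooth_bounded_cmult[OF sm2, of e]], of \<sigma>]])
    fix r assume r: "r \<in> {s..t}"
    then have Tr: "0 < T - r" using T by simp
    show "\<sigma> * (- gauss (T - r) (y - 0 - \<mu> * (T - r)) + e * - gauss (T - r) (- y - 0 - \<mu> * (T - r))) = 0"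
      using gauss_reflect[OF Tr, of \<mu> y] by (simp add: e_def)
    fix z q z' :: real
    show "\<sigma> * (gauss (T - r) (y - z - \<mu> * (T - r)) * (\<mu> + (y - z - \<mu> * (T - r)) / (2 * (T - r)))
        + e * (gauss (T - r) (- y - z - \<mu> * (T - r)) * (\<mu> + (- y - z - \<mu> * (T - r)) / (2 * (T - r)))))
        + \<sigma> * (- ((y - z - \<mu> * (T - r)) / (T - r)) * gauss (T - r) (y - z - \<mu> * (T - r))
          + e * (- ((- y - z - \<mu> * (T - r)) / (T - r)) * gauss (T - r) (- y - z - \<mu> * (T - r)))) / 2
        + \<sigma> * (- gauss (T - r) (y - z - \<mu> * (T - r)) + e * - gauss (T - r) (- y - z - \<mu> * (T - r))) * \<mu> \<le> 0"
      by (simp only: ring gen[OF Tr] mult_zero_right add_0 order_refl)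
  qed
  have Teq: "T - t = \<epsilon>" "T - s = t - s + \<epsilon>" by (simp_all add: T_def)
  have main': "\<sigma> * (\<integral>\<omega>. reflected_cdf \<mu> \<epsilon> (X t \<omega>) y \<partial>M) \<le> \<sigma> * reflected_cdf \<mu> (t - s + \<epsilon>) x y" for \<sigma>
    using main[of \<sigma>] unfolding Teq e_def reflected_cdf_def integral_mult_right_zero
      mult_minus_left diff_conv_add_uminus[symmetric] by (simp only: diff_conv_add_uminus)
  show ?thesis using main'[of 1] main'[of "- 1"] by simp
qed

section \<open>Law of the reflecting diffusion with constant drift\<close>

lemma reflected_cdf_continuous_time:
  assumes "0 < \<tau>"
  shows "((\<lambda>\<epsilon>. reflected_cdf \<mu> (\<tau> + \<epsilon>) z y) \<longlongrightarrow> reflected_cdf \<mu> \<tau> z y) (at_right 0)"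
proof -
  have "continuous_on {0<..} (\<lambda>\<tau>. reflected_cdf \<mu> \<tau> z y)"
    unfolding reflected_cdf_def by (intro continuous_intros) auto
  then have "isCont (\<lambda>\<tau>. reflected_cdf \<mu> \<tau> z y) \<tau>"
    using assms by (simp add: continuous_on_eq_continuous_at)
  moreover have "((\<lambda>\<epsilon>. \<tau> + \<epsilon>) \<longlongrightarrow> \<tau> + 0) (at_right 0)" by (intro tendsto_intros)
  then have "((\<lambda>\<epsilon>. \<tau> + \<epsilon>) \<longlongrightarrow> \<tau>) (at_right 0)" by simp
  ultimately show ?thesis by (rule isCont_tendsto_compose)
qed

text \<open>The short-time limit takes the value 1/2 at z = y, and an atom at \<open>y\<close> is
  not excluded beforehand. So the probability is squeezed between \<open>H y\<close> and
  \<open>H y'\<close> for y' > y, and continuity of \<open>H\<close> finishes. At y = 0 the upper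
  bound suffices because \<open>H 0 = 0\<close>.\<close>

lemma reflected_distribution_function:
  assumes s: "0 \<le> s" and st: "s < t"
    and sol: "reflecting_weak_solution (\<lambda>_ _. \<mu>) s x M F B L X"
  shows "measure M {\<omega> \<in> space M. X t \<omega> \<le> y} = (if 0 \<le> y then reflected_cdf \<mu> (t - s) x y else 0)"
proof -
  note solD = reflecting_weak_solutionD[OF sol]
  interpret prob_space M by (rule brownian_motion_fromD(1)[OF solD(1)])
  have Xm[measurable]: "X t \<in> borel_measurable M"
    by (rule filtered_measurable_ambient[OF solD(1), of _ t])
       (use solD(2) st in \<open>simp add: adapted_on_def\<close>)
  have pos: "AE \<omega> in M. 0 \<le> X t \<omega>"
    using solD(4)
  proof eventually_elim
    case (elim \<omega>)
    then show ?case using less_imp_le[OF st] by blast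
  qed
  define H where "H = reflected_cdf \<mu> (t - s) x"
  define \<phi> where "\<phi> y z = (if z < y then 1 else if z = y then 1 / 2 else 0 :: real)" for y z :: real
  have [measurable]: "\<phi> y \<in> borel_measurable borel" for y
    unfolding \<phi>_def by measurable
  have E\<phi>: "(\<integral>\<omega>. \<phi> y (X t \<omega>) \<partial>M) = H y" if y: "0 < y" for y
  proof -
    define \<epsilon> where "\<epsilon> n = 1 / real (Suc n)" for n
    have \<epsilon>pos: "0 < \<epsilon> n" for n by (simp add: \<epsilon>_def)
    have \<epsilon>: "filterlim \<epsilon> (at_right 0) sequentially"
    proof (rule tendsto_imp_filterlim_at_right)
      show "\<epsilon> \<longlonglongrightarrow> 0"
        using LIMSEQ_inverse_real_of_nat by (simp add: \<epsilon>_def[abs_def] inverse_eq_divide)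
      show "\<forall>\<^sub>F n in sequentially. 0 < \<epsilon> n" by (simp add: \<epsilon>pos)
    qed
    have "(\<lambda>n. \<integral>\<omega>. reflected_cdf \<mu> (\<epsilon> n) (X t \<omega>) y \<partial>M) \<longlonglongrightarrow> (\<integral>\<omega>. \<phi> y (X t \<omega>) \<partial>M)"
    proof (rule integral_dominated_convergence[where w="\<lambda>_. 1 + exp (2 * \<mu> * y)"])
      show "(\<lambda>\<omega>. reflected_cdf \<mu> (\<epsilon> n) (X t \<omega>) y) \<in> borel_measurable M" for n
      proof (rule measurable_compose[OF Xm], rule borel_measurable_continuous_onI)
        show "continuous_on UNIV (\<lambda>z. reflected_cdf \<mu> (\<epsilon> n) z y)"
          unfolding reflected_cdf_def by (intro continuous_intros) (auto simp: \<epsilon>pos)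
      qed
      show "AE \<omega> in M. (\<lambda>n. reflected_cdf \<mu> (\<epsilon> n) (X t \<omega>) y) \<longlonglongrightarrow> \<phi> y (X t \<omega>)"
        using pos
      proof eventually_elim
        case (elim \<omega>)
        show ?case unfolding \<phi>_def
          by (rule filterlim_compose[OF reflected_cdf_at_right_0[OF y elim] \<epsilon>])
      qed
      show "AE \<omega> in M. norm (reflected_cdf \<mu> (\<epsilon> n) (X t \<omega>) y) \<le> 1 + exp (2 * \<mu> * y)" for n
      proof (rule AE_I2)
        fix \<omega>
        have "\<bar>a - c * b\<bar> \<le> 1 + c" if "0 \<le> a" "a \<le> 1" "0 \<le> b" "b \<le> 1" "0 \<le> c" for a b c :: real
        proof -
          have "0 \<le> c * b" "c * b \<le> c * 1" using that by (auto intro!: mult_left_mono mult_nonneg_nonneg simp del: mult_1_right)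
          then show ?thesis using that by linarith
        qed
        then show "norm (reflected_cdf \<mu> (\<epsilon> n) (X t \<omega>) y) \<le> 1 + exp (2 * \<mu> * y)"
          unfolding reflected_cdf_def real_norm_def by (simp add: gauss_cdf_bounds)
      qed
    qed simp_all
    moreover have "(\<lambda>n. \<integral>\<omega>. reflected_cdf \<mu> (\<epsilon> n) (X t \<omega>) y \<partial>M) \<longlonglongrightarrow> H y"
      unfolding expectation_reflected_cdf[OF s st \<epsilon>pos sol] H_def
      by (rule filterlim_compose[OF reflected_cdf_continuous_time \<epsilon>]) (use st in simp)
    ultimately show ?thesis by (rule LIMSEQ_unique)
  qed
  define P where "P y = measure M {\<omega> \<in> space M. X t \<omega> \<le> y}" for y
  have P_int: "P y = (\<integral>\<omega>. indicator {\<omega> \<in> space M. X t \<omega> \<le> y} \<omega> \<partial>M)" for y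
    by (simp add: P_def)
  have int\<phi>: "integrable M (\<lambda>\<omega>. \<phi> y (X t \<omega>))" for y
    by (rule integrable_const_bound[where B=1]) (auto simp: \<phi>_def)
  have intI: "integrable M (indicator {\<omega> \<in> space M. X t \<omega> \<le> y} :: _ \<Rightarrow> real)" for y
    by (auto intro!: integrable_real_indicator simp: emeasure_eq_measure)
  have upper: "P y \<le> H y'" if "y < y'" "0 < y'" for y y'
    unfolding P_int E\<phi>[OF that(2), symmetric]
    by (intro integral_mono int\<phi> intI) (use that in \<open>auto simp: \<phi>_def indicator_def\<close>)
  have lower: "H y \<le> P y" if "0 < y" for y
    unfolding P_int E\<phi>[OF that, symmetric]
    by (intro integral_mono int\<phi> intI) (auto simp: \<phi>_def indicator_def)
  have contH: "isCont H y" for y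
    unfolding H_def using st by (intro DERIV_isCont[OF reflected_cdf_deriv]) simp
  have le: "P y \<le> H y" if "0 \<le> y" for y
  proof (rule tendsto_lowerbound[OF _ _ trivial_limit_at_right_real])
    show "(H \<longlongrightarrow> H y) (at_right y)"
      using contH[of y] unfolding isCont_def by (rule tendsto_within_subset) simp
    show "\<forall>\<^sub>F y' in at_right y. P y \<le> H y'"
      using eventually_at_right_less[of y] by eventually_elim (use that in \<open>auto intro: upper\<close>)
  qed
  have "P y = (if 0 \<le> y then H y else 0)" for y
  proof -
    consider "0 < y" | "y = 0" | "y < 0" by linarith
    then show ?thesis
    proof cases
      case 1
      then show ?thesis using le[of y] lower[of y] by simp
    next
      case 2
      then show ?thesis using le[of 0] by (simp add: P_def H_def reflected_cdf_0 measure_le_0_iff)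
    next
      case 3
      have "measure M {\<omega> \<in> space M. X t \<omega> \<le> y} = 0"
      proof (subst prob_eq_0)
        show "AE \<omega> in M. \<omega> \<notin> {\<omega> \<in> space M. X t \<omega> \<le> y}"
          using pos by eventually_elim (use 3 in simp)
      qed measurable
      then show ?thesis using 3 by (simp add: P_def)
    qed
  qed
  then show ?thesis by (simp add: P_def H_def)
qed

lemma reflected_density_continuous_on:
  "continuous_on {(s, x, t, y). 0 \<le> s \<and> s < t \<and> 0 \<le> x \<and> 0 \<le> y}
    (\<lambda>(s, x, t, y). reflected_density \<mu> (t - s) x y)"
  unfolding reflected_density_def case_prod_beta'
  by (intro continuous_intros) auto

text \<open>For positive \<mu> the formula does not show the sign of the density. Nonnegativity is
  inferred from monotonicity of the distribution function, and it is what permits integrating the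
  density by the fundamental theorem. Equal distribution functions then identify the law.\<close>

lemma reflected_law:
  assumes s: "0 \<le> s" and st: "s < t"
    and sol: "reflecting_weak_solution (\<lambda>_ _. \<mu>) s x M F B L X"
  shows "distr M borel (X t) =
    density lborel (\<lambda>y. ennreal (indicator {0..} y * reflected_density \<mu> (t - s) x y))"
    "\<And>y. 0 \<le> y \<Longrightarrow> 0 \<le> reflected_density \<mu> (t - s) x y"
proof -
  note solD = reflecting_weak_solutionD[OF sol]
  interpret prob_space M by (rule brownian_motion_fromD(1)[OF solD(1)])
  have Xm[measurable]: "X t \<in> borel_measurable M"
    by (rule filtered_measurable_ambient[OF solD(1), of _ t])
       (use solD(2) st in \<open>simp add: adapted_on_def\<close>)
  define H where "H = reflected_cdf \<mu> (t - s) x"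
  define h where "h = reflected_density \<mu> (t - s) x"
  have dH: "(H has_real_derivative h y) (at y)" for y
    unfolding H_def h_def using st by (intro reflected_cdf_deriv) simp
  have conth: "continuous_on UNIV h"
    unfolding h_def reflected_density_def by (intro continuous_intros) (use st in auto)
  have hm[measurable]: "h \<in> borel_measurable borel" by (rule borel_measurable_continuous_onI[OF conth])
  define N where "N = distr M borel (X t)"
  interpret N: real_distribution N
    unfolding N_def by (rule real_distribution_distr) measurable
  have cdfN: "cdf N y = (if 0 \<le> y then H y else 0)" for y
  proof -
    have "cdf N y = measure M (X t -` {..y} \<inter> space M)"
      unfolding cdf_def N_def by (rule measure_distr) auto
    also have "X t -` {..y} \<inter> space M = {\<omega> \<in> space M. X t \<omega> \<le> y}" by auto
    finally show ?thesis using reflected_distribution_function[OF s st sol, of y] by (simp add: H_def)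
  qed
  have monoH: "mono_on {0..} H"
  proof (rule mono_onI)
    fix a b :: real assume "a \<in> {0..}" "b \<in> {0..}" "a \<le> b"
    then show "H a \<le> H b" using N.cdf_nondecreasing[of a b] by (simp add: cdfN)
  qed
  have hpos: "0 \<le> h y" if "0 < y" for y
    by (rule mono_on_imp_deriv_nonneg[OF monoH dH]) (use that in \<open>simp add: interior_real_atLeast\<close>)
  have hnn: "0 \<le> h y" if "0 \<le> y" for y
  proof (cases "y = 0")
    case True
    have "(h \<longlongrightarrow> h 0) (at_right 0)"
      using conth by (simp add: continuous_on_def filterlim_at_split)
    moreover have "\<forall>\<^sub>F y in at_right 0. 0 \<le> h y"
      using eventually_at_right_less[of 0] by eventually_elim (rule hpos)
    ultimately show ?thesis
      unfolding True by (rule tendsto_lowerbound) simp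
  qed (use that hpos in auto)
  then show "0 \<le> reflected_density \<mu> (t - s) x y" if "0 \<le> y" for y
    using that by (simp add: h_def)
  define D where "D = density lborel (\<lambda>y. ennreal (indicator {0..} y * h y))"
  have H0: "H 0 = 0" by (simp add: H_def reflected_cdf_0)
  have limH: "(H \<longlongrightarrow> 1) at_top"
  proof (rule Lim_transform_eventually[OF N.cdf_lim_at_top_prob])
    show "\<forall>\<^sub>F y in at_top. cdf N y = H y"
      using eventually_ge_at_top[of 0] by eventually_elim (simp add: cdfN)
  qed
  have ind: "ennreal (indicator {0..} y * h y) = ennreal (h y) * indicator {0..} y" for y
    by (auto simp: indicator_def)
  have mass: "emeasure D (space D) = 1"
  proof -
    have "emeasure D UNIV = (\<integral>\<^sup>+y. ennreal (h y) * indicator {0..} y \<partial>lborel)"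
      unfolding D_def by (subst emeasure_density) (auto simp: ind)
    also have "\<dots> = ennreal (1 - H 0)"
      by (rule nn_integral_FTC_atLeast[OF hm dH hnn limH])
    finally show ?thesis by (simp add: D_def H0)
  qed
  interpret D: prob_space D by (rule prob_spaceI[OF mass])
  interpret D: real_distribution D by unfold_locales (simp_all add: D_def)
  have cdfD: "cdf D y = (if 0 \<le> y then H y else 0)" for y
  proof (cases "0 \<le> y")
    case True
    have "emeasure D {..y} = (\<integral>\<^sup>+z. ennreal (h z) * indicator {0..y} z \<partial>lborel)"
      unfolding D_def
      by (subst emeasure_density) (auto simp: ind indicator_def intro!: nn_integral_cong)
    also have "\<dots> = ennreal (H y - H 0)"
      by (rule nn_integral_FTC_Icc[OF hm]) (use dH hnn True in \<open>auto intro: has_field_derivative_at_within\<close>)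
    finally have "emeasure D {..y} = ennreal (H y)" by (simp add: H0)
    moreover have "0 \<le> H y" using mono_onD[OF monoH, of 0 y] True H0 by simp
    ultimately show ?thesis using True by (simp add: cdf_def measure_def)
  next
    case False
    have "emeasure D {..y} = (\<integral>\<^sup>+z. ennreal (indicator {0..} z * h z) * indicator {..y} z \<partial>lborel)"
      unfolding D_def by (rule emeasure_density) auto
    also have "\<dots> = (\<integral>\<^sup>+z. 0 \<partial>(lborel :: real measure))"
      by (rule nn_integral_cong) (use False in \<open>auto simp: indicator_def\<close>)
    finally show ?thesis using False by (simp add: cdf_def measure_def)
  qed
  have "N = D"
    by (rule cdf_unique) (auto simp: cdfN cdfD fun_eq_iff intro: N.real_distribution_axioms D.real_distribution_axioms)
  then show "distr M borel (X t) =
    density lborel (\<lambda>y. ennreal (indicator {0..} y * reflected_density \<mu> (t - s) x y))"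
    by (simp add: N_def D_def h_def)
qed

text \<open>Every reflecting solution contains a Brownian motion, so existence of solutions over
  \<open>'a\<close> needs one on that type; \<open>BM\<close> provides it.\<close>

lemma reflected_transition_density:
  assumes BM: "\<exists>(M :: 'a measure) F B. brownian_motion_from 0 M F B"
  shows "reflecting_transition_density TYPE('a) (\<lambda>_ _. \<mu>) (\<lambda>s x t y. reflected_density \<mu> (t - s) x y)"
  unfolding reflecting_transition_density_def
proof (intro conjI allI impI ballI reflected_density_continuous_on)
  fix s x :: real assume s: "0 \<le> s" and x: "0 \<le> x"
  obtain M :: "'a measure" and F B where "brownian_motion_from 0 M F B" using BM by blast
  from reflected_drifted_brownian_motion[OF brownian_motion_from_shift[OF this] x]
  show "\<exists>(M :: 'a measure) F B L X. reflecting_weak_solution (\<lambda>_ _. \<mu>) s x M F B L X" by metis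
next
  fix s x t :: real and M :: "'a measure" and F B L X and f :: "real \<Rightarrow> real"
  assume s: "0 \<le> s" and sol: "reflecting_weak_solution (\<lambda>_ _. \<mu>) s x M F B L X"
    and st: "s < t" and f[measurable]: "f \<in> borel_measurable borel"
  note solD = reflecting_weak_solutionD[OF sol]
  note law = reflected_law[OF s st sol]
  have Xm[measurable]: "X t \<in> borel_measurable M"
    by (rule filtered_measurable_ambient[OF solD(1), of _ t])
       (use solD(2) st in \<open>simp add: adapted_on_def\<close>)
  have "continuous_on UNIV (reflected_density \<mu> (t - s) x)"
    unfolding reflected_density_def by (intro continuous_intros) (use st in auto)
  then have [measurable]: "reflected_density \<mu> (t - s) x \<in> borel_measurable borel"
    by (rule borel_measurable_continuous_onI)
  have "(LINT \<omega>|M. f (X t \<omega>)) = integral\<^sup>L (distr M borel (X t)) f"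
    by (rule integral_distr[symmetric]) measurable
  also have "\<dots> = (LBINT y. (indicator {0..} y * reflected_density \<mu> (t - s) x y) *\<^sub>R f y)"
    unfolding law(1)
    by (rule integral_density) (use law(2) in \<open>auto simp: indicator_def\<close>)
  also have "\<dots> = (LBINT y:{0..}. reflected_density \<mu> (t - s) x y * f y)"
    by (simp add: set_lebesgue_integral_def mult.assoc)
  finally show "(LINT \<omega>|M. f (X t \<omega>)) = (LBINT y:{0..}. reflected_density \<mu> (t - s) x y * f y)" .
qed

text \<open>Behind the identity: the modulus of the diffusion with drift
  \<open>\<mu> * sgn z\<close> is the reflecting diffusion with drift \<mu>, whence the factor 2 and
  the parameter \<open>- \<mu>\<close>.\<close>

lemma reflected_density_at_0:
  assumes "0 \<le> x"
  shows "reflected_density \<mu> \<tau> x 0 = 2 * sgn_kernel (- \<mu>) \<tau> x"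
proof -
  have "gauss \<tau> (- x - \<mu> * \<tau>) = gauss \<tau> (x + \<mu> * \<tau>)"
    using gauss_minus[of \<tau> "x + \<mu> * \<tau>"] by simp
  moreover have "gauss_cdf \<tau> (- (\<mu> * \<tau>) - x) = gauss_cdf \<tau> (- x - \<mu> * \<tau>)"
    by (rule arg_cong) simp
  ultimately show ?thesis
    using assms by (simp add: reflected_density_def sgn_kernel_def)
qed

section \<open>Two-sided bounds and their attainment on the boundary\<close>

theorem corollary5:
  fixes \<kappa> :: real
    and p :: "real \<Rightarrow> real \<Rightarrow> real \<Rightarrow> real \<Rightarrow> real \<Rightarrow> real"
  assumes "0 \<le> \<kappa>"
    and "\<And>\<beta> y. sgn_transition_density TYPE('a) \<beta> y (p \<beta> y)"
  shows
    "(\<forall>\<beta> y x t. 0 < t \<longrightarrow>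
        p \<beta> y x t y = 1 / sqrt (2 * pi * t) *
          (LBINT z:{\<bar>x - y\<bar> / sqrt t..}. z * exp (- ((z - \<beta> * sqrt t)\<^sup>2) / 2))) \<and>
     (\<forall>b q. bounded_drift \<kappa> b \<and> reflecting_transition_density TYPE('a) b q \<longrightarrow>
        (\<forall>s x t y. 0 \<le> s \<and> s < t \<and> 0 \<le> x \<and> 0 \<le> y \<longrightarrow>
           p (- \<kappa>) y x (t - s) y + p (- \<kappa>) (- y) x (t - s) (- y) \<le> q s x t y \<and>
           q s x t y \<le> p \<kappa> y x (t - s) y + p \<kappa> (- y) x (t - s) (- y))) \<and>
     (\<exists>b q. bounded_drift \<kappa> b \<and> reflecting_transition_density TYPE('a) b q \<and>
        (\<forall>s x t. 0 \<le> s \<and> s < t \<and> 0 \<le> x \<longrightarrow>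
           q s x t 0 = p (- \<kappa>) 0 x (t - s) 0 + p (- \<kappa>) (- 0) x (t - s) (- 0))) \<and>
     (\<exists>b q. bounded_drift \<kappa> b \<and> reflecting_transition_density TYPE('a) b q \<and>
        (\<forall>s x t. 0 \<le> s \<and> s < t \<and> 0 \<le> x \<longrightarrow>
           q s x t 0 = p \<kappa> 0 x (t - s) 0 + p \<kappa> (- 0) x (t - s) (- 0)))"
proof -
  \<comment> \<open>Any instance of the hypothesis on \<open>p\<close> contains a Brownian motion
    over \<open>'a\<close>; the parameters 0 are arbitrary.\<close>
  have bm: "\<exists>(M :: 'a measure) F B. brownian_motion_from 0 M F B"
    using assms(2)[of 0 0] unfolding sgn_transition_density_def weak_solution_def by blast
  have centre: "p \<beta> y x t y = sgn_kernel \<beta> t (x - y)" if "0 < t" for \<beta> y x t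
    by (rule sgn_transition_density_at_centre[OF assms(2) that])
  \<comment> \<open>On the half line the drift \<open>- \<beta> * sgn z\<close> towards or away from
    0 is the constant \<open>- \<beta>\<close> for z > 0, which suggests the extremal drift for
    either sign of \<beta>.\<close>
  have attained: "\<exists>b q. bounded_drift \<kappa> b \<and> reflecting_transition_density TYPE('a) b q \<and>
      (\<forall>s x t. 0 \<le> s \<and> s < t \<and> 0 \<le> x \<longrightarrow>
         q s x t 0 = p \<beta> 0 x (t - s) 0 + p \<beta> (- 0) x (t - s) (- 0))"
    if "\<bar>\<beta>\<bar> \<le> \<kappa>" for \<beta>
  proof (intro exI[of _ "\<lambda>_ _. - \<beta>"] exI[of _ "\<lambda>s x t y. reflected_density (- \<beta>) (t - s) x y"]
      conjI allI impI reflected_transition_density bm)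
    show "bounded_drift \<kappa> (\<lambda>_ _. - \<beta>)" using that by (simp add: bounded_drift_def)
    show "reflected_density (- \<beta>) (t - s) x 0 = p \<beta> 0 x (t - s) 0 + p \<beta> (- 0) x (t - s) (- 0)"
      if "0 \<le> s \<and> s < t \<and> 0 \<le> x" for s x t
      using that centre[of "t - s" \<beta> 0 x] by (simp add: reflected_density_at_0)
  qed
  show ?thesis
  proof (intro conjI allI impI)
    fix \<beta> y x t :: real assume "0 < t"
    then show "p \<beta> y x t y = 1 / sqrt (2 * pi * t) *
        (LBINT z:{\<bar>x - y\<bar> / sqrt t..}. z * exp (- ((z - \<beta> * sqrt t)\<^sup>2) / 2))"
      using centre sgn_kernel_eq_integral by simp
  next
    fix b q and s x t y :: real
    assume bq: "bounded_drift \<kappa> b \<and> reflecting_transition_density TYPE('a) b q"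
      and h: "0 \<le> s \<and> s < t \<and> 0 \<le> x \<and> 0 \<le> y"
    then have st: "0 < t - s" and h': "0 \<le> s" "s < t" "0 \<le> x" "0 \<le> y" by auto
    have *: "\<sigma> * q s x t y \<le> \<sigma> * (p (\<sigma> * \<kappa>) y x (t - s) y + p (\<sigma> * \<kappa>) (- y) x (t - s) (- y))"
      if "\<bar>\<sigma>\<bar> = 1" for \<sigma>
      unfolding centre[OF st]
      by (rule reflecting_transition_density_bound[OF h' assms(1) that conjunct1[OF bq] conjunct2[OF bq]])
    show "p (- \<kappa>) y x (t - s) y + p (- \<kappa>) (- y) x (t - s) (- y) \<le> q s x t y"
      using *[of "- 1"] by simp
    show "q s x t y \<le> p \<kappa> y x (t - s) y + p \<kappa> (- y) x (t - s) (- y)"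
      using *[of 1] by simp
  qed (rule attained, use assms(1) in simp)+
qed

end
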